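(* Let $(R,\mathfrak m)$ be a Cohen-Macaulay local ring of dimension one admitting a fractional canonical ideal, and let $I$ be a fractional ideal of $R$. Then the following conditions are equivalent. (1) $r(R\ltimes I)=r_R(I)$. (2) $I$ is a closed ideal of $R$. When this is the case, $r(R\ltimes I)=r(R/I)$, if $I\subsetneq R$.
   Context: All rings are commutative. For a ring $R$ and an $R$-module $M$, the idealization $R\ltimes M$ is the ring with additive group $R\oplus M$ and multiplication $(a,x)(b,y)=(ab,ay+bx)$. If $(R,\mathfrak m)$ is a Cohen-Macaulay (Noetherian) local ring of dimension $d$ and $M$ is a finitely generated $R$-module with $\operatorname{depth}_RM=d$, then $R\ltimes M$ is a Cohen-Macaulay local ring of dimension $d$ with maximal ideal $\mathfrak m\times M$. The Cohen-Macaulay type of such an $M$ is $r_R(M)=\ell_R(\operatorname{Ext}^d_R(R/\mathfrak m,M))$, where $\ell_R$ denotes length, and $r(R)=r_R(R)$; for the Artinian ring $R/I$, $r(R/I)$ is the length of its socle. $\mathrm Q(R)$ is the total ring of fractions of $R$ and $\overline R$ the integral closure of $R$ in $\mathrm Q(R)$. For $R$-submodules $X,Y$ of $\mathrm Q(R)$, $X:Y=\{a\in\mathrm Q(R)\mid aY\subseteq X\}$. A fractional canonical ideal of $R$ is an $R$-submodule $K$ of $\overline R$ such that $R\subseteq K\subseteq\overline R$ and $K\cong K_R$, the canonical module of $R$. A fractional ideal is a finitely generated $R$-submodule $I$ of $\mathrm Q(R)$ with $\mathrm Q(R)\cdot I=\mathrm Q(R)$. A fractional ideal $I$ is called closed if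 $I:I=R$; this is equivalent to each of the following: $(K:I)\cdot I=K$; $J\cdot I=K$ for some fractional ideal $J$; $I/fI$ is a faithful $R/fR$-module for every (equivalently, some) parameter $f$ of $R$. *)

theory Defs
  imports "HOL-Algebra.Polynomials" "HOL-Algebra.Module" "HOL-Library.Extended_Nat"
begin

hide_const (open) Multiset.mult

section \<open>Modules\<close>

text \<open>A module is a record over a ring; as in HOL-Algebra its unused fields \<open>mult\<close> and \<open>one\<close> are
  irrelevant. Submodules are passed around as modules by updating the carrier.\<close>

definition self_module :: "('a, 'q) ring_scheme \<Rightarrow> ('a, 'a) module" where
  "self_module A = \<lparr>carrier = carrier A, mult = mult A, one = one A,
     zero = zero A, add = add A, smult = mult A\<rparr>"

definition mod_span :: "('a, 'q) ring_scheme \<Rightarrow> ('a, 'm, 'c) module_scheme \<Rightarrow> 'm set \<Rightarrow> 'm set" where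
  "mod_span A M S = \<Inter>{N. submodule N A M \<and> S \<subseteq> N}"

definition fin_gen_module :: "('a, 'q) ring_scheme \<Rightarrow> ('a, 'm, 'c) module_scheme \<Rightarrow> bool" where
  "fin_gen_module A M \<longleftrightarrow> module A M \<and>
     (\<exists>S. finite S \<and> S \<subseteq> carrier M \<and> mod_span A M S = carrier M)"

text \<open>The length of a module, as the supremum of the lengths of its chains of submodules.\<close>

definition mod_length :: "('a, 'q) ring_scheme \<Rightarrow> ('a, 'm, 'c) module_scheme \<Rightarrow> enat" where
  "mod_length A M = Sup {enat n | n. \<exists>C. (\<forall>i\<le>n. submodule (C i) A M) \<and> (\<forall>i<n. C i \<subset> C (Suc i))}"

definition quot_module :: "('a, 'm, 'c) module_scheme \<Rightarrow> 'm set \<Rightarrow> ('a, 'm set) module" where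
  "quot_module M H = \<lparr>carrier = a_rcosets\<^bsub>M\<^esub> H, mult = undefined, one = undefined,
     zero = H, add = set_add M, smult = (\<lambda>a C. \<Union>x\<in>C. H +>\<^bsub>M\<^esub> (a \<odot>\<^bsub>M\<^esub> x))\<rparr>"

text \<open>Homomorphisms are extensional functions, so that equality of homomorphisms is equality.\<close>

definition mod_hom ::
  "('a, 'q) ring_scheme \<Rightarrow> ('a, 'm, 'c) module_scheme \<Rightarrow> ('a, 'n, 'd) module_scheme \<Rightarrow> ('m \<Rightarrow> 'n) set" where
  "mod_hom A M N = {f \<in> carrier M \<rightarrow>\<^sub>E carrier N.
     (\<forall>x\<in>carrier M. \<forall>y\<in>carrier M. f (x \<oplus>\<^bsub>M\<^esub> y) = f x \<oplus>\<^bsub>N\<^esub> f y) \<and>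
     (\<forall>a\<in>carrier A. \<forall>x\<in>carrier M. f (a \<odot>\<^bsub>M\<^esub> x) = a \<odot>\<^bsub>N\<^esub> f x)}"

definition Hom_module ::
  "('a, 'q) ring_scheme \<Rightarrow> ('a, 'm, 'c) module_scheme \<Rightarrow> ('a, 'n, 'd) module_scheme \<Rightarrow> ('a, 'm \<Rightarrow> 'n) module" where
  "Hom_module A M N = \<lparr>carrier = mod_hom A M N, mult = undefined, one = undefined,
     zero = (\<lambda>x\<in>carrier M. \<zero>\<^bsub>N\<^esub>),
     add = (\<lambda>f g. \<lambda>x\<in>carrier M. f x \<oplus>\<^bsub>N\<^esub> g x),
     smult = (\<lambda>a f. \<lambda>x\<in>carrier M. a \<odot>\<^bsub>N\<^esub> f x)\<rparr>"

definition free_module :: "('a, 'q) ring_scheme \<Rightarrow> nat \<Rightarrow> ('a, nat \<Rightarrow> 'a) module" where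
  "free_module A n = \<lparr>carrier = {..<n} \<rightarrow>\<^sub>E carrier A, mult = undefined, one = undefined,
     zero = (\<lambda>i\<in>{..<n}. \<zero>\<^bsub>A\<^esub>),
     add = (\<lambda>v w. \<lambda>i\<in>{..<n}. v i \<oplus>\<^bsub>A\<^esub> w i),
     smult = (\<lambda>a v. \<lambda>i\<in>{..<n}. a \<otimes>\<^bsub>A\<^esub> v i)\<rparr>"


section \<open>Ext\<close>

text \<open>A resolution \<open>\<dots> \<rightarrow> A\<^bsup>b 1\<^esup> \<rightarrow> A\<^bsup>b 0\<^esup> \<rightarrow> N \<rightarrow> 0\<close> by free modules of finite rank, with
  differentials \<open>\<delta> i : A\<^bsup>b (i+1)\<^esup> \<rightarrow> A\<^bsup>b i\<^esup>\<close> and augmentation \<open>\<epsilon>\<close>. It exists whenever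
  \<open>A\<close> is Noetherian and \<open>N\<close> is finitely generated.\<close>

definition free_resolution :: "('a, 'q) ring_scheme \<Rightarrow> ('a, 'n, 'c) module_scheme \<Rightarrow>
    (nat \<Rightarrow> nat) \<times> (nat \<Rightarrow> (nat \<Rightarrow> 'a) \<Rightarrow> (nat \<Rightarrow> 'a)) \<times> ((nat \<Rightarrow> 'a) \<Rightarrow> 'n) \<Rightarrow> bool" where
  "free_resolution A N = (\<lambda>(b, \<delta>, \<epsilon>).
     \<epsilon> \<in> mod_hom A (free_module A (b 0)) N \<and>
     (\<forall>i. \<delta> i \<in> mod_hom A (free_module A (b (Suc i))) (free_module A (b i))) \<and>
     \<epsilon> ` carrier (free_module A (b 0)) = carrier N \<and>
     {v \<in> carrier (free_module A (b 0)). \<epsilon> v = \<zero>\<^bsub>N\<^esub>} = \<delta> 0 ` carrier (free_module A (b 1)) \<and>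
     (\<forall>i. {v \<in> carrier (free_module A (b (Suc i))). \<delta> i v = \<zero>\<^bsub>free_module A (b i)\<^esub>}
        = \<delta> (Suc i) ` carrier (free_module A (b (Suc (Suc i))))))"

definition cocycles where
  "cocycles A b \<delta> M i = {f \<in> mod_hom A (free_module A (b i)) M.
     \<forall>v\<in>carrier (free_module A (b (Suc i))). f (\<delta> i v) = \<zero>\<^bsub>M\<^esub>}"

fun coboundaries where
  "coboundaries A b \<delta> M 0 = {\<lambda>v\<in>carrier (free_module A (b 0)). \<zero>\<^bsub>M\<^esub>}"
| "coboundaries A b \<delta> M (Suc i) =
     {compose (carrier (free_module A (b (Suc i)))) g (\<delta> i) | g. g \<in> mod_hom A (free_module A (b i)) M}"

text \<open>\<open>Ext\<close> of a finitely generated module \<open>N\<close> over a Noetherian ring \<open>A\<close>, as the cohomology of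
  \<open>Hom(F, M)\<close> for an arbitrarily chosen resolution \<open>F\<close> of \<open>N\<close>; up to isomorphism it does not depend
  on the choice.\<close>

definition Ext_module :: "('a, 'q) ring_scheme \<Rightarrow> nat \<Rightarrow> ('a, 'n, 'c) module_scheme \<Rightarrow>
    ('a, 'm, 'd) module_scheme \<Rightarrow> ('a, ((nat \<Rightarrow> 'a) \<Rightarrow> 'm) set) module" where
  "Ext_module A i N M = (case (SOME F. free_resolution A N F) of (b, \<delta>, \<epsilon>) \<Rightarrow>
     quot_module ((Hom_module A (free_module A (b i)) M)\<lparr>carrier := cocycles A b \<delta> M i\<rparr>)
       (coboundaries A b \<delta> M i))"


section \<open>Local rings, dimension, depth and type\<close>

definition krull_dim :: "('a, 'q) ring_scheme \<Rightarrow> enat" where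
  "krull_dim A = Sup {enat n | n. \<exists>P. (\<forall>i\<le>n. primeideal (P i) A) \<and> (\<forall>i<n. P i \<subset> P (Suc i))}"

definition noetherian_local_ring :: "('a, 'q) ring_scheme \<Rightarrow> 'a set \<Rightarrow> bool" where
  "noetherian_local_ring A \<mm> \<longleftrightarrow> cring A \<and> noetherian_ring A \<and> {J. maximalideal J A} = {\<mm>}"

text \<open>Meaningful for local rings only.\<close>

definition max_ideal :: "('a, 'q) ring_scheme \<Rightarrow> 'a set" where
  "max_ideal A = (THE J. maximalideal J A)"

definition list_times_module :: "('a, 'q) ring_scheme \<Rightarrow> ('a, 'm, 'c) module_scheme \<Rightarrow> 'a list \<Rightarrow> 'm set" where
  "list_times_module A M xs = mod_span A M {x \<odot>\<^bsub>M\<^esub> y | x y. x \<in> set xs \<and> y \<in> carrier M}"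

definition regular_sequence :: "('a, 'q) ring_scheme \<Rightarrow> ('a, 'm, 'c) module_scheme \<Rightarrow> 'a list \<Rightarrow> bool" where
  "regular_sequence A M xs \<longleftrightarrow> set xs \<subseteq> carrier A \<and>
     (\<forall>i<length xs. \<forall>y\<in>carrier M.
        xs ! i \<odot>\<^bsub>M\<^esub> y \<in> list_times_module A M (take i xs) \<longrightarrow> y \<in> list_times_module A M (take i xs)) \<and>
     list_times_module A M xs \<noteq> carrier M"

definition depth :: "('a, 'q) ring_scheme \<Rightarrow> ('a, 'm, 'c) module_scheme \<Rightarrow> enat" where
  "depth A M = Sup {enat (length xs) | xs. set xs \<subseteq> max_ideal A \<and> regular_sequence A M xs}"

definition cohen_macaulay_local_ring :: "('a, 'q) ring_scheme \<Rightarrow> 'a set \<Rightarrow> bool" where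
  "cohen_macaulay_local_ring A \<mm> \<longleftrightarrow>
     noetherian_local_ring A \<mm> \<and> depth A (self_module A) = krull_dim A"

definition max_cohen_macaulay_module :: "('a, 'q) ring_scheme \<Rightarrow> ('a, 'm, 'c) module_scheme \<Rightarrow> bool" where
  "max_cohen_macaulay_module A M \<longleftrightarrow> fin_gen_module A M \<and> depth A M = krull_dim A"

definition cm_type :: "('a, 'q) ring_scheme \<Rightarrow> ('a, 'm, 'c) module_scheme \<Rightarrow> enat" where
  "cm_type A M = mod_length A
     (Ext_module A (the_enat (krull_dim A)) (quot_module (self_module A) (max_ideal A)) M)"

definition ring_type :: "('a, 'q) ring_scheme \<Rightarrow> enat" where
  "ring_type A = cm_type A (self_module A)"

definition socle :: "('a, 'q) ring_scheme \<Rightarrow> 'a set" where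
  "socle A = {x \<in> carrier A. \<forall>a\<in>max_ideal A. a \<otimes>\<^bsub>A\<^esub> x = \<zero>\<^bsub>A\<^esub>}"

definition artinian_type :: "('a, 'q) ring_scheme \<Rightarrow> enat" where
  "artinian_type A = mod_length A ((self_module A)\<lparr>carrier := socle A\<rparr>)"

text \<open>Injective dimension at most \<open>n\<close>, for a Noetherian ring \<open>A\<close>: \<open>Ext\<^sup>i(N, M) = 0\<close> for all \<open>i > n\<close>
  and all finitely generated \<open>N\<close>. The type of \<open>N\<close> loses nothing: the cosets of a submodule of
  \<open>free_module A k\<close> are of this type, so every finitely generated module has a copy there.\<close>

definition inj_dim_le :: "('a, 'q) ring_scheme \<Rightarrow> ('a, 'm, 'c) module_scheme \<Rightarrow> nat \<Rightarrow> bool" where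
  "inj_dim_le A M n \<longleftrightarrow> (\<forall>(N :: ('a, (nat \<Rightarrow> 'a) set) module) i. fin_gen_module A N \<longrightarrow> i > n \<longrightarrow>
     carrier (Ext_module A i N M) = {\<zero>\<^bsub>Ext_module A i N M\<^esub>})"

text \<open>The definition of Bruns and Herzog, for \<open>A\<close> a Cohen-Macaulay local ring. It determines the
  module up to isomorphism and is invariant under isomorphism, so ``isomorphic to the canonical
  module'' is the same as satisfying this predicate.\<close>

definition canonical_module :: "('a, 'q) ring_scheme \<Rightarrow> ('a, 'm, 'c) module_scheme \<Rightarrow> bool" where
  "canonical_module A M \<longleftrightarrow>
     max_cohen_macaulay_module A M \<and> cm_type A M = 1 \<and> (\<exists>n. inj_dim_le A M n)"


section \<open>Idealization\<close>

definition idealization :: "('a, 'q) ring_scheme \<Rightarrow> ('a, 'm, 'c) module_scheme \<Rightarrow> ('a \<times> 'm) ring"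
    (infixl \<open>\<ltimes>\<close> 65) where
  "A \<ltimes> M = \<lparr>carrier = carrier A \<times> carrier M,
     mult = (\<lambda>(a, x) (b, y). (a \<otimes>\<^bsub>A\<^esub> b, a \<odot>\<^bsub>M\<^esub> y \<oplus>\<^bsub>M\<^esub> b \<odot>\<^bsub>M\<^esub> x)),
     one = (\<one>\<^bsub>A\<^esub>, \<zero>\<^bsub>M\<^esub>),
     zero = (\<zero>\<^bsub>A\<^esub>, \<zero>\<^bsub>M\<^esub>),
     add = (\<lambda>(a, x) (b, y). (a \<oplus>\<^bsub>A\<^esub> b, x \<oplus>\<^bsub>M\<^esub> y))\<rparr>"


section \<open>Fractional ideals\<close>

text \<open>Here \<open>R\<close> is a subring of its total ring of fractions \<open>Q\<close>: the ring itself is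
  \<open>Q\<lparr>carrier := R\<rparr>\<close>, and an \<open>R\<close>-submodule \<open>J\<close> of \<open>Q\<close> is the module
  \<open>(self_module Q)\<lparr>carrier := J\<rparr>\<close>.\<close>

abbreviation ring_on :: "('a, 'q) ring_scheme \<Rightarrow> 'a set \<Rightarrow> ('a, 'q) ring_scheme" where
  "ring_on Q R \<equiv> Q\<lparr>carrier := R\<rparr>"

abbreviation module_on :: "('a, 'q) ring_scheme \<Rightarrow> 'a set \<Rightarrow> ('a, 'a) module" where
  "module_on Q J \<equiv> (self_module Q)\<lparr>carrier := J\<rparr>"

definition nonzerodivisors :: "('a, 'q) ring_scheme \<Rightarrow> 'a set" where
  "nonzerodivisors A = {s \<in> carrier A. \<forall>a\<in>carrier A. s \<otimes>\<^bsub>A\<^esub> a = \<zero>\<^bsub>A\<^esub> \<longrightarrow> a = \<zero>\<^bsub>A\<^esub>}"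

definition total_ring_of_fractions :: "('a, 'q) ring_scheme \<Rightarrow> 'a set \<Rightarrow> bool" where
  "total_ring_of_fractions Q R \<longleftrightarrow> cring Q \<and> subcring R Q \<and>
     nonzerodivisors (ring_on Q R) \<subseteq> Units Q \<and>
     carrier Q = {a \<otimes>\<^bsub>Q\<^esub> inv\<^bsub>Q\<^esub> s | a s. a \<in> R \<and> s \<in> nonzerodivisors (ring_on Q R)}"

text \<open>Polynomials are lists of coefficients, the leading one first.\<close>

definition integral_closure :: "('a, 'q) ring_scheme \<Rightarrow> 'a set \<Rightarrow> 'a set" where
  "integral_closure Q R = {x \<in> carrier Q. \<exists>p. p \<noteq> [] \<and> set p \<subseteq> R \<and> lead_coeff p = \<one>\<^bsub>Q\<^esub> \<and>
     ring.eval Q p x = \<zero>\<^bsub>Q\<^esub>}"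

definition fractional_canonical_ideal :: "('a, 'q) ring_scheme \<Rightarrow> 'a set \<Rightarrow> 'a set \<Rightarrow> bool" where
  "fractional_canonical_ideal Q R K \<longleftrightarrow> submodule K (ring_on Q R) (self_module Q) \<and>
     R \<subseteq> K \<and> K \<subseteq> integral_closure Q R \<and> canonical_module (ring_on Q R) (module_on Q K)"

text \<open>\<open>Idl\<^bsub>Q\<^esub> I\<close> is \<open>Q \<cdot> I\<close>.\<close>

definition fractional_ideal :: "('a, 'q) ring_scheme \<Rightarrow> 'a set \<Rightarrow> 'a set \<Rightarrow> bool" where
  "fractional_ideal Q R I \<longleftrightarrow> submodule I (ring_on Q R) (self_module Q) \<and>
     fin_gen_module (ring_on Q R) (module_on Q I) \<and> Idl\<^bsub>Q\<^esub> I = carrier Q"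

definition colon :: "('a, 'q) ring_scheme \<Rightarrow> 'a set \<Rightarrow> 'a set \<Rightarrow> 'a set" where
  "colon Q J L = {a \<in> carrier Q. \<forall>y\<in>L. a \<otimes>\<^bsub>Q\<^esub> y \<in> J}"

definition closed_ideal :: "('a, 'q) ring_scheme \<Rightarrow> 'a set \<Rightarrow> 'a set \<Rightarrow> bool" where
  "closed_ideal Q R I \<longleftrightarrow> fractional_ideal Q R I \<and> colon Q I I = R"

end

theory Submission
  imports Defs
begin

text \<open>The argument rests on a formula for the Cohen-Macaulay type. Let \<open>(A, \<nn>)\<close> be a Noetherian
  local ring of dimension one, \<open>M\<close> an \<open>A\<close>-module and \<open>f \<in> \<nn>\<close> regular on \<open>M\<close>. Then
  \<open>Ext\<^sup>1(A/\<nn>, M) \<cong> (fM : \<nn>)/fM\<close> (lemma \<open>Ext_cyclic_length\<close>), so the type is the length of the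
  interval of submodules between \<open>fM\<close> and \<open>fM : \<nn>\<close>.

  Choose a nonzerodivisor \<open>f \<in> \<mm>\<close> of \<open>R\<close> and apply the formula to the \<open>R\<close>-module \<open>I\<close> with \<open>f\<close>, and to
  the ring \<open>A = R \<ltimes> I\<close> with \<open>(f, 0)\<close>. The second interval runs from \<open>fR \<times> fI\<close> to \<open>E \<times> (fI : \<mm>)\<close>,
  where \<open>E = {a \<in> R | a \<mm> \<subseteq> fR, a I \<subseteq> fI}\<close>. Hence \<open>r(A)\<close> is \<open>r\<^sub>R(I)\<close> plus the length of \<open>E/fR\<close>, and
  since \<open>r\<^sub>R(I)\<close> is finite the two types agree exactly when \<open>E = fR\<close> (lemma \<open>type_idealization_iff\<close>).

  Division by \<open>f\<close> turns \<open>E\<close> into \<open>(R : \<mm>) \<inter> (I : I)\<close>, so \<open>E = fR\<close> says that \<open>(I : I)/R\<close> contains no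
  nonzero element killed by \<open>\<mm>\<close>. Every element of \<open>Q/R\<close> is killed by a nonzerodivisor, and in dimension
  one the primes containing a nonzerodivisor are maximal; therefore each nonzero submodule of \<open>Q/R\<close>
  does contain such an element (lemma \<open>torsion_socle_element\<close>). So \<open>E = fR\<close> means \<open>I : I = R\<close>.

  Finally let \<open>I\<close> be closed and properly contained in \<open>R\<close>. Then \<open>I \<subseteq> \<mm>\<close>, whence \<open>(I : \<mm>) I \<subseteq> I\<close> and
  \<open>I : \<mm> \<subseteq> I : I = R\<close>. Multiplication by \<open>f\<close> therefore identifies the socle \<open>(I :\<^sub>R \<mm>)/I\<close> of \<open>R/I\<close>
  with \<open>(fI : \<mm>)/fI\<close>, whose length is \<open>r\<^sub>R(I)\<close>.\<close>


section \<open>Lengths of chains\<close>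

text \<open>Lengths of modules and Krull dimensions are both suprema of this kind, over a family of
  submodules or of primes. They are compared through strictly monotone maps between the families.\<close>

definition chain_length :: "'s set set \<Rightarrow> enat" where
  "chain_length \<S> = Sup {enat n | n. \<exists>C. (\<forall>i\<le>n. C i \<in> \<S>) \<and> (\<forall>i<n. C i \<subset> C (Suc i))}"

lemma chain_length_ge:
  assumes "\<And>i. i \<le> n \<Longrightarrow> C i \<in> \<S>" and "\<And>i. i < n \<Longrightarrow> C i \<subset> C (Suc i)"
  shows "enat n \<le> chain_length \<S>"
  unfolding chain_length_def by (rule Sup_upper) (use assms in auto)

lemma chain_length_le_iff:
  "chain_length \<S> \<le> e \<longleftrightarrow>
    (\<forall>n C. (\<forall>i\<le>n. C i \<in> \<S>) \<longrightarrow> (\<forall>i<n. C i \<subset> C (Suc i)) \<longrightarrow> enat n \<le> e)"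
  unfolding chain_length_def Sup_le_iff by blast

lemma chain_length_mono:
  assumes "\<And>V. V \<in> \<S> \<Longrightarrow> F V \<in> \<T>"
    and "\<And>V Y. V \<in> \<S> \<Longrightarrow> Y \<in> \<S> \<Longrightarrow> V \<subset> Y \<Longrightarrow> F V \<subset> F Y"
  shows "chain_length \<S> \<le> chain_length \<T>"
  unfolding chain_length_le_iff
proof (intro allI impI)
  fix n C assume C: "\<forall>i\<le>n. C i \<in> \<S>" "\<forall>i<n. C i \<subset> C (Suc i)"
  show "enat n \<le> chain_length \<T>"
    by (rule chain_length_ge[where C = "\<lambda>i. F (C i)"]) (use C assms in \<open>auto simp: Suc_le_eq\<close>)
qed

lemma chain_length_le_rank:
  fixes h :: "'s set \<Rightarrow> nat"
  assumes "\<And>V. V \<in> \<S> \<Longrightarrow> h V \<le> k"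
    and "\<And>V Y. V \<in> \<S> \<Longrightarrow> Y \<in> \<S> \<Longrightarrow> V \<subset> Y \<Longrightarrow> h V < h Y"
  shows "chain_length \<S> \<le> enat k"
  unfolding chain_length_le_iff
proof (intro allI impI)
  fix n C assume C: "\<forall>i\<le>n. C i \<in> \<S>" "\<forall>i<n. C i \<subset> C (Suc i)"
  have "i \<le> n \<Longrightarrow> i \<le> h (C i)" for i
  proof (induction i)
    case (Suc i)
    moreover have "h (C i) < h (C (Suc i))"
      using C Suc.prems by (intro assms) auto
    ultimately show ?case by simp
  qed simp
  from this[of n] C(1) assms(1)[of "C n"] show "enat n \<le> enat k" by fastforce
qed

text \<open>A finite supremum is attained, so a member of \<open>\<T>\<close> above the image of \<open>\<S>\<close> extends a longest
  chain by one step.\<close>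

lemma chain_length_less:
  assumes "\<And>V. V \<in> \<S> \<Longrightarrow> F V \<in> \<T>"
    and "\<And>V Y. V \<in> \<S> \<Longrightarrow> Y \<in> \<S> \<Longrightarrow> V \<subset> Y \<Longrightarrow> F V \<subset> F Y"
    and top: "T \<in> \<T>" "\<And>V. V \<in> \<S> \<Longrightarrow> F V \<subset> T"
    and fin: "chain_length \<S> \<noteq> \<infinity>" and ne: "\<S> \<noteq> {}"
  shows "chain_length \<S> < chain_length \<T>"
proof -
  let ?N = "{enat n | n. \<exists>C. (\<forall>i\<le>n. C i \<in> \<S>) \<and> (\<forall>i<n. C i \<subset> C (Suc i))}"
  obtain V where "V \<in> \<S>" using ne by blast
  then have "enat 0 \<in> ?N" by (intro CollectI exI[of _ 0] conjI exI[of _ "\<lambda>_. V"]) auto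
  then have nonempty: "?N \<noteq> {}" by blast
  then have "finite ?N"
    using fin unfolding chain_length_def Sup_enat_def by (metis (no_types, lifting))
  then have "Max ?N \<in> ?N" using nonempty by (rule Max_in)
  moreover have "chain_length \<S> = Max ?N"
    using \<open>finite ?N\<close> nonempty unfolding chain_length_def Sup_enat_def by (simp only: if_False if_True)
  ultimately have "chain_length \<S> \<in> ?N" by simp
  then obtain n C where n: "chain_length \<S> = enat n"
    and C: "\<forall>i\<le>n. C i \<in> \<S>" "\<forall>i<n. C i \<subset> C (Suc i)" by blast
  have "enat (Suc n) \<le> chain_length \<T>"
  proof (rule chain_length_ge[where C = "\<lambda>i. if i \<le> n then F (C i) else T"])
    fix i assume i: "i < Suc n"
    show "(if i \<le> n then F (C i) else T) \<subset> (if Suc i \<le> n then F (C (Suc i)) else T)"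
    proof (cases "i = n")
      case True
      then show ?thesis using top C by auto
    next
      case False
      then have "F (C i) \<subset> F (C (Suc i))" using i C by (intro assms) auto
      then show ?thesis using i False by auto
    qed
  qed (use assms C top in auto)
  moreover have "enat n < enat (Suc n)" by simp
  ultimately show ?thesis using n by (metis less_le_trans)
qed

lemma krull_dim_eq_chain_length: "krull_dim A = chain_length {P. primeideal P A}"
  unfolding krull_dim_def chain_length_def by simp

definition submodules_between ::
  "('a, 'q) ring_scheme \<Rightarrow> ('a, 'm, 'c) module_scheme \<Rightarrow> 'm set \<Rightarrow> 'm set \<Rightarrow> 'm set set" where
  "submodules_between A M L U = {N. submodule N A M \<and> L \<subseteq> N \<and> N \<subseteq> U}"

abbreviation interval_length ::
  "('a, 'q) ring_scheme \<Rightarrow> ('a, 'm, 'c) module_scheme \<Rightarrow> 'm set \<Rightarrow> 'm set \<Rightarrow> enat" where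
  "interval_length A M L U \<equiv> chain_length (submodules_between A M L U)"


section \<open>Submodules, quotients and linear maps\<close>

lemma submodule_iff:
  assumes "module A M"
  shows "submodule N A M \<longleftrightarrow> N \<subseteq> carrier M \<and> \<zero>\<^bsub>M\<^esub> \<in> N \<and>
    (\<forall>x\<in>N. \<forall>y\<in>N. x \<oplus>\<^bsub>M\<^esub> y \<in> N) \<and> (\<forall>a\<in>carrier A. \<forall>x\<in>N. a \<odot>\<^bsub>M\<^esub> x \<in> N)"
proof -
  interpret module A M by fact
  show ?thesis
  proof
    assume "submodule N A M"
    note N = submoduleE[OF this]
    obtain x where "x \<in> N" using N by blast
    then have "\<zero>\<^bsub>M\<^esub> \<in> N"
      by (metis N(1,4) R.zero_closed smult_l_null subsetD)
    with N show "N \<subseteq> carrier M \<and> \<zero>\<^bsub>M\<^esub> \<in> N \<and>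
      (\<forall>x\<in>N. \<forall>y\<in>N. x \<oplus>\<^bsub>M\<^esub> y \<in> N) \<and> (\<forall>a\<in>carrier A. \<forall>x\<in>N. a \<odot>\<^bsub>M\<^esub> x \<in> N)" by blast
  next
    assume N: "N \<subseteq> carrier M \<and> \<zero>\<^bsub>M\<^esub> \<in> N \<and>
      (\<forall>x\<in>N. \<forall>y\<in>N. x \<oplus>\<^bsub>M\<^esub> y \<in> N) \<and> (\<forall>a\<in>carrier A. \<forall>x\<in>N. a \<odot>\<^bsub>M\<^esub> x \<in> N)"
    have "\<ominus>\<^bsub>M\<^esub> x \<in> N" if "x \<in> N" for x
    proof -
      have "(\<ominus>\<^bsub>A\<^esub> \<one>\<^bsub>A\<^esub>) \<odot>\<^bsub>M\<^esub> x = \<ominus>\<^bsub>M\<^esub> x" using that N by (auto simp: smult_l_minus)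
      moreover have "(\<ominus>\<^bsub>A\<^esub> \<one>\<^bsub>A\<^esub>) \<odot>\<^bsub>M\<^esub> x \<in> N" using that N by auto
      ultimately show ?thesis by simp
    qed
    then show "submodule N A M" using N by (intro submoduleI) auto
  qed
qed

lemma submoduleD:
  assumes "module A M" "submodule N A M"
  shows "N \<subseteq> carrier M" "\<zero>\<^bsub>M\<^esub> \<in> N" "\<And>x y. x \<in> N \<Longrightarrow> y \<in> N \<Longrightarrow> x \<oplus>\<^bsub>M\<^esub> y \<in> N"
    "\<And>a x. a \<in> carrier A \<Longrightarrow> x \<in> N \<Longrightarrow> a \<odot>\<^bsub>M\<^esub> x \<in> N"
    "\<And>x. x \<in> N \<Longrightarrow> \<ominus>\<^bsub>M\<^esub> x \<in> N" "\<And>x y. x \<in> N \<Longrightarrow> y \<in> N \<Longrightarrow> x \<ominus>\<^bsub>M\<^esub> y \<in> N"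
  using assms(2) module.submoduleE(3,5)[OF assms] unfolding submodule_iff[OF assms(1)] a_minus_def
  by auto

lemma submodule_restrict_iff:
  assumes "module A M" "submodule U A M"
  shows "submodule N A (M\<lparr>carrier := U\<rparr>) \<longleftrightarrow> submodule N A M \<and> N \<subseteq> U"
  using submodule.submodule_is_module[OF assms(2,1)] submoduleD(1)[OF assms]
  by (auto simp: submodule_iff assms(1))

lemma submodules_between_restrict:
  assumes "module A M" "submodule V A M" "U \<subseteq> V"
  shows "submodules_between A (M\<lparr>carrier := V\<rparr>) L U = submodules_between A M L U"
  unfolding submodules_between_def submodule_restrict_iff[OF assms(1,2)] using assms(3) by auto

lemma mod_length_eq_interval_length:
  assumes "module A M"
  shows "mod_length A M = interval_length A M {\<zero>\<^bsub>M\<^esub>} (carrier M)"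
proof -
  have "submodules_between A M {\<zero>\<^bsub>M\<^esub>} (carrier M) = {N. submodule N A M}"
    using submoduleD(1,2)[OF assms] unfolding submodules_between_def by blast
  then show ?thesis unfolding mod_length_def chain_length_def by simp
qed

text \<open>The correspondence theorem: a linear map to \<open>U/L\<close> that is onto and has kernel \<open>H\<close> matches
  the submodules of the source above \<open>H\<close> with those of \<open>M\<close> between \<open>L\<close> and \<open>U\<close>. The map is given by
  representatives in \<open>U\<close>. The scalars may change along a surjection \<open>\<rho>\<close>, as they do on passing to a
  residue class ring.\<close>

lemma interval_length_transfer:
  assumes V: "module A V" and M: "module B M"
    and \<rho>: "\<rho> ` carrier A = carrier B"
    and L: "submodule L B M" and U: "submodule U B M"  "L \<subseteq> U"
    and add: "\<And>x y. x \<in> carrier V \<Longrightarrow> y \<in> carrier V \<Longrightarrow> \<Phi> (x \<oplus>\<^bsub>V\<^esub> y) = \<Phi> x \<oplus>\<^bsub>M\<^esub> \<Phi> y"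
    and smult: "\<And>a x. a \<in> carrier A \<Longrightarrow> x \<in> carrier V \<Longrightarrow> \<Phi> (a \<odot>\<^bsub>V\<^esub> x) = \<rho> a \<odot>\<^bsub>M\<^esub> \<Phi> x"
    and into: "\<And>x. x \<in> carrier V \<Longrightarrow> \<Phi> x \<in> U"
    and onto: "\<And>u. u \<in> U \<Longrightarrow> \<exists>x\<in>carrier V. u \<ominus>\<^bsub>M\<^esub> \<Phi> x \<in> L"
    and H: "H = {x \<in> carrier V. \<Phi> x \<in> L}"
  shows "interval_length A V H (carrier V) = interval_length B M L U"
proof -
  interpret V: module A V by fact
  interpret M: module B M by fact
  note LD = submoduleD[OF M L] and UD = submoduleD[OF M U(1)]
  have \<Phi>c [simp]: "\<Phi> x \<in> carrier M" if "x \<in> carrier V" for x using into[OF that] UD(1) by blast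
  have \<rho>c: "\<rho> a \<in> carrier B" if "a \<in> carrier A" for a using that \<rho> by blast
  have "\<Phi> \<zero>\<^bsub>V\<^esub> \<oplus>\<^bsub>M\<^esub> \<Phi> \<zero>\<^bsub>V\<^esub> = \<Phi> \<zero>\<^bsub>V\<^esub>" using add[of "\<zero>\<^bsub>V\<^esub>" "\<zero>\<^bsub>V\<^esub>"] by simp
  then have zero: "\<Phi> \<zero>\<^bsub>V\<^esub> = \<zero>\<^bsub>M\<^esub>" by (metis M.add.l_cancel_one' V.zero_closed \<Phi>c)
  have minus: "\<Phi> (x \<ominus>\<^bsub>V\<^esub> y) = \<Phi> x \<ominus>\<^bsub>M\<^esub> \<Phi> y" if "x \<in> carrier V" "y \<in> carrier V" for x y
  proof -
    have "\<Phi> (x \<ominus>\<^bsub>V\<^esub> y) \<oplus>\<^bsub>M\<^esub> \<Phi> y = \<Phi> x"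
      using add[of "x \<ominus>\<^bsub>V\<^esub> y" y] that by (simp add: V.minus_eq V.add.m_assoc V.l_neg)
    then show ?thesis
      by (metis M.add.inv_solve_right M.minus_eq V.minus_closed \<Phi>c that)
  qed
  \<comment> \<open>The two mutually inverse maps: \<open>T\<close> goes to \<open>\<Phi> T + L\<close>, and \<open>N\<close> to its preimage.\<close>
  let ?I = "\<lambda>T. {m \<in> carrier M. \<exists>x\<in>T. m \<ominus>\<^bsub>M\<^esub> \<Phi> x \<in> L}"
  let ?P = "\<lambda>N. {x \<in> carrier V. \<Phi> x \<in> N}"
  have split: "m = \<Phi> x \<oplus>\<^bsub>M\<^esub> (m \<ominus>\<^bsub>M\<^esub> \<Phi> x)" if "m \<in> carrier M" "x \<in> carrier V" for m x
    using that by (simp add: M.minus_eq M.add.m_lcomm M.r_neg)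
  have I: "?I T \<in> submodules_between B M L U" if T: "T \<in> submodules_between A V H (carrier V)" for T
  proof -
    have T': "submodule T A V" "H \<subseteq> T" using T unfolding submodules_between_def by auto
    note TD = submoduleD[OF V T'(1)]
    have "submodule (?I T) B M"
      unfolding submodule_iff[OF M]
    proof (intro conjI ballI)
      show "\<zero>\<^bsub>M\<^esub> \<in> ?I T" using TD(2) LD(2) LD(5)[OF LD(2)] by (auto intro!: bexI[of _ "\<zero>\<^bsub>V\<^esub>"] simp: zero M.minus_eq)
    next
      fix m m' assume "m \<in> ?I T" "m' \<in> ?I T"
      then obtain x x' where x: "x \<in> T" "x' \<in> T" "m \<ominus>\<^bsub>M\<^esub> \<Phi> x \<in> L" "m' \<ominus>\<^bsub>M\<^esub> \<Phi> x' \<in> L"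
        and m: "m \<in> carrier M" "m' \<in> carrier M" by auto
      then have xc: "x \<in> carrier V" "x' \<in> carrier V" using TD(1) by auto
      have "(m \<oplus>\<^bsub>M\<^esub> m') \<ominus>\<^bsub>M\<^esub> \<Phi> (x \<oplus>\<^bsub>V\<^esub> x') = (m \<ominus>\<^bsub>M\<^esub> \<Phi> x) \<oplus>\<^bsub>M\<^esub> (m' \<ominus>\<^bsub>M\<^esub> \<Phi> x')"
        using xc m by (simp add: add M.minus_eq M.minus_add M.a_ac)
      then show "m \<oplus>\<^bsub>M\<^esub> m' \<in> ?I T" using x m TD(3) LD(3) by (auto intro!: bexI[of _ "x \<oplus>\<^bsub>V\<^esub> x'"])
    next
      fix b m assume b: "b \<in> carrier B" and "m \<in> ?I T"
      then obtain x where x: "x \<in> T" "m \<ominus>\<^bsub>M\<^esub> \<Phi> x \<in> L" and m: "m \<in> carrier M" by auto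
      then have xc: "x \<in> carrier V" using TD(1) by auto
      obtain a where a: "a \<in> carrier A" "b = \<rho> a" using b \<rho> by blast
      have "b \<odot>\<^bsub>M\<^esub> m \<ominus>\<^bsub>M\<^esub> \<Phi> (a \<odot>\<^bsub>V\<^esub> x) = b \<odot>\<^bsub>M\<^esub> (m \<ominus>\<^bsub>M\<^esub> \<Phi> x)"
        using xc m a b by (simp add: smult M.minus_eq M.smult_r_distr M.smult_r_minus)
      then show "b \<odot>\<^bsub>M\<^esub> m \<in> ?I T"
        using x m a b TD(4) LD(4) by (auto intro!: bexI[of _ "a \<odot>\<^bsub>V\<^esub> x"])
    qed auto
    moreover have "L \<subseteq> ?I T" using LD(1) TD(2) LD(6)[OF _ LD(2)] by (auto intro!: bexI[of _ "\<zero>\<^bsub>V\<^esub>"] simp: zero)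
    moreover have "?I T \<subseteq> U"
    proof
      fix m assume "m \<in> ?I T"
      then obtain x where x: "x \<in> T" "m \<ominus>\<^bsub>M\<^esub> \<Phi> x \<in> L" and m: "m \<in> carrier M" by auto
      then have "\<Phi> x \<oplus>\<^bsub>M\<^esub> (m \<ominus>\<^bsub>M\<^esub> \<Phi> x) \<in> U" using TD(1) U(2) into by (intro UD(3)) auto
      then show "m \<in> U" using split[OF m, of x] x TD(1) by auto
    qed
    ultimately show ?thesis unfolding submodules_between_def by blast
  qed
  have P: "?P N \<in> submodules_between A V H (carrier V)" if N: "N \<in> submodules_between B M L U" for N
  proof -
    have N': "submodule N B M" "L \<subseteq> N" using N unfolding submodules_between_def by auto
    note ND = submoduleD[OF M N'(1)]
    have "submodule (?P N) A V"
      unfolding submodule_iff[OF V] using ND \<rho>c by (auto simp: zero add smult)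
    then show ?thesis using N'(2) unfolding submodules_between_def H by auto
  qed
  show ?thesis
  proof (rule antisym)
    show "interval_length A V H (carrier V) \<le> interval_length B M L U"
    proof (rule chain_length_mono[where F = ?I, OF I])
      fix S T assume ST: "S \<in> submodules_between A V H (carrier V)"
        "T \<in> submodules_between A V H (carrier V)" "S \<subset> T"
      then have S: "submodule S A V" "H \<subseteq> S" and T: "T \<subseteq> carrier V"
        unfolding submodules_between_def by auto
      note SD = submoduleD[OF V S(1)]
      obtain t where t: "t \<in> T" "t \<notin> S" using ST by blast
      have "\<Phi> t \<notin> ?I S"
      proof
        assume "\<Phi> t \<in> ?I S"
        then obtain s where s: "s \<in> S" "\<Phi> t \<ominus>\<^bsub>M\<^esub> \<Phi> s \<in> L" by auto
        have c: "t \<in> carrier V" "s \<in> carrier V" using s t T SD(1) by auto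
        have "t \<ominus>\<^bsub>V\<^esub> s \<in> H" using s(2) c by (simp add: H minus)
        then have "t \<ominus>\<^bsub>V\<^esub> s \<in> S" using S(2) by blast
        then have "(t \<ominus>\<^bsub>V\<^esub> s) \<oplus>\<^bsub>V\<^esub> s \<in> S" using s SD by blast
        moreover have "(t \<ominus>\<^bsub>V\<^esub> s) \<oplus>\<^bsub>V\<^esub> s = t"
          using t T s SD(1) by (auto simp: V.minus_eq V.add.m_assoc V.l_neg subset_iff)
        ultimately show False using t by simp
      qed
      moreover have "\<Phi> t \<in> ?I T"
        using t T LD(2) by (auto intro!: bexI[of _ t] simp: M.minus_eq M.r_neg)
      ultimately show "?I S \<subset> ?I T" using ST(3) by blast
    qed
    show "interval_length B M L U \<le> interval_length A V H (carrier V)"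
    proof (rule chain_length_mono[where F = ?P, OF P])
      fix N N' assume *: "N \<in> submodules_between B M L U" "N' \<in> submodules_between B M L U" "N \<subset> N'"
      then have N: "submodule N B M" "L \<subseteq> N" and N': "submodule N' B M" "L \<subseteq> N'" "N' \<subseteq> U"
        unfolding submodules_between_def by auto
      obtain u where u: "u \<in> N'" "u \<notin> N" using * by blast
      obtain x where x: "x \<in> carrier V" "u \<ominus>\<^bsub>M\<^esub> \<Phi> x \<in> L" using onto u N' by blast
      have uc: "u \<in> carrier M" using u submoduleD(1)[OF M N'(1)] by blast
      have "\<Phi> x = u \<ominus>\<^bsub>M\<^esub> (u \<ominus>\<^bsub>M\<^esub> \<Phi> x)"
        using uc x by (simp add: M.minus_eq M.minus_add M.add.m_assoc[symmetric] M.r_neg)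
      then have "\<Phi> x \<in> N'" using u x N' by (metis (no_types, lifting) M submoduleD(6) subsetD)
      moreover have "\<Phi> x \<notin> N"
        using split[OF uc x(1)] x u N submoduleD(3)[OF M N(1)] by (metis subsetD)
      ultimately show "?P N \<subset> ?P N'" using x *(3) by blast
    qed
  qed
qed

lemma submodule_zero:
  assumes "module A M" shows "submodule {\<zero>\<^bsub>M\<^esub>} A M"
proof -
  interpret module A M by fact
  show ?thesis by (simp add: submodule_iff[OF assms])
qed

lemma quot_module_simps:
  "carrier (quot_module M H) = a_rcosets\<^bsub>M\<^esub> H" "\<zero>\<^bsub>quot_module M H\<^esub> = H"
  by (simp_all add: quot_module_def)

lemma abelian_subgroup_submodule:
  assumes "module A M" "submodule H A M"
  shows "abelian_subgroup H M"
proof -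
  interpret module A M by fact
  show ?thesis
    by (rule abelian_subgroupI3)
      (use assms(2) in \<open>auto simp: additive_subgroup_def submodule_def M.abelian_group_axioms\<close>)
qed

lemma coset_eq_iff:
  assumes "module A M" "submodule H A M" "x \<in> carrier M" "y \<in> carrier M"
  shows "H +>\<^bsub>M\<^esub> x = H +>\<^bsub>M\<^esub> y \<longleftrightarrow> x \<ominus>\<^bsub>M\<^esub> y \<in> H"
proof -
  interpret abelian_subgroup H M by (rule abelian_subgroup_submodule[OF assms(1,2)])
  have "H +>\<^bsub>M\<^esub> x = H +>\<^bsub>M\<^esub> y \<longleftrightarrow> x \<in> H +>\<^bsub>M\<^esub> y"
    using assms(3,4) a_repr_independence' a_repr_independenceD by metis
  also have "\<dots> \<longleftrightarrow> x \<ominus>\<^bsub>M\<^esub> y \<in> H"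
    using assms(3,4) a_rcos_module[of y x] by (simp add: a_minus_def)
  finally show ?thesis .
qed

lemma coset_eq_self_iff:
  assumes "module A M" "submodule H A M" "x \<in> carrier M"
  shows "H +>\<^bsub>M\<^esub> x = H \<longleftrightarrow> x \<in> H"
proof -
  interpret module A M by fact
  have "H +>\<^bsub>M\<^esub> \<zero>\<^bsub>M\<^esub> = H" using submoduleD(1)[OF assms(1,2)] by (rule M.a_coset_add_zero)
  moreover have "\<ominus>\<^bsub>M\<^esub> \<zero>\<^bsub>M\<^esub> = \<zero>\<^bsub>M\<^esub>" using M.minus_unique by force
  ultimately have "x \<ominus>\<^bsub>M\<^esub> \<zero>\<^bsub>M\<^esub> = x" "H +>\<^bsub>M\<^esub> \<zero>\<^bsub>M\<^esub> = H"
    using assms(3) M.r_zero by (metis M.minus_eq, metis)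
  then show ?thesis using coset_eq_iff[OF assms, of "\<zero>\<^bsub>M\<^esub>"] by simp
qed

lemma quot_module_carrier_iff:
  "C \<in> carrier (quot_module M H) \<longleftrightarrow> (\<exists>x\<in>carrier M. C = H +>\<^bsub>M\<^esub> x)"
  unfolding quot_module_simps A_RCOSETS_def' a_r_coset_def' by auto

lemma quot_module_add:
  assumes "module A M" "submodule H A M" "x \<in> carrier M" "y \<in> carrier M"
  shows "(H +>\<^bsub>M\<^esub> x) \<oplus>\<^bsub>quot_module M H\<^esub> (H +>\<^bsub>M\<^esub> y) = H +>\<^bsub>M\<^esub> (x \<oplus>\<^bsub>M\<^esub> y)"
proof -
  interpret abelian_subgroup H M by (rule abelian_subgroup_submodule[OF assms(1,2)])
  show ?thesis using assms(3,4) by (simp add: quot_module_def a_rcos_sum)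
qed

lemma quot_module_smult:
  assumes "module A M" "submodule H A M" "a \<in> carrier A" "x \<in> carrier M"
  shows "a \<odot>\<^bsub>quot_module M H\<^esub> (H +>\<^bsub>M\<^esub> x) = H +>\<^bsub>M\<^esub> (a \<odot>\<^bsub>M\<^esub> x)"
proof -
  interpret module A M by fact
  interpret abelian_subgroup H M by (rule abelian_subgroup_submodule[OF assms(1,2)])
  have "H +>\<^bsub>M\<^esub> (a \<odot>\<^bsub>M\<^esub> y) = H +>\<^bsub>M\<^esub> (a \<odot>\<^bsub>M\<^esub> x)" if "y \<in> H +>\<^bsub>M\<^esub> x" for y
  proof -
    from that have y: "y \<in> carrier M" using assms(4) a_elemrcos_carrier by blast
    have "H +>\<^bsub>M\<^esub> y = H +>\<^bsub>M\<^esub> x" using that assms(4) a_repr_independence' by blast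
    then have "y \<ominus>\<^bsub>M\<^esub> x \<in> H" using coset_eq_iff[OF assms(1,2) y assms(4)] by simp
    then have "a \<odot>\<^bsub>M\<^esub> (y \<ominus>\<^bsub>M\<^esub> x) \<in> H" using submoduleD(4)[OF assms(1,2,3)] by simp
    moreover have "a \<odot>\<^bsub>M\<^esub> (y \<ominus>\<^bsub>M\<^esub> x) = a \<odot>\<^bsub>M\<^esub> y \<ominus>\<^bsub>M\<^esub> a \<odot>\<^bsub>M\<^esub> x"
      using y assms by (simp add: M.minus_eq smult_r_distr smult_r_minus)
    ultimately show ?thesis using y assms by (subst coset_eq_iff[OF assms(1,2)]) auto
  qed
  moreover have "x \<in> H +>\<^bsub>M\<^esub> x" using assms(4) a_rcos_self by blast
  ultimately have "(\<Union>y\<in>H +>\<^bsub>M\<^esub> x. H +>\<^bsub>M\<^esub> (a \<odot>\<^bsub>M\<^esub> y)) = H +>\<^bsub>M\<^esub> (a \<odot>\<^bsub>M\<^esub> x)" by blast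
  then show ?thesis by (simp add: quot_module_def)
qed

lemma module_quot_module:
  assumes "module A M" "submodule H A M"
  shows "module A (quot_module M H)"
proof -
  interpret module A M by fact
  interpret abelian_subgroup H M by (rule abelian_subgroup_submodule[OF assms(1,2)])
  have "abelian_group (quot_module M H)"
  proof -
    interpret C: comm_group "M A_Mod H" by (rule a_factorgroup_is_comm_group)
    have eq: "carrier (M A_Mod H) = carrier (quot_module M H)"
      "mult (M A_Mod H) = add (quot_module M H)" "one (M A_Mod H) = zero (quot_module M H)"
      by (simp_all add: quot_module_def A_FactGroup_def')
    note facts = C.m_closed C.one_closed C.m_assoc C.m_comm C.l_one C.l_inv_ex
    show ?thesis by (rule abelian_groupI) (fact facts[unfolded eq])+
  qed
  then show ?thesis
  proof (intro moduleI[OF R.cring_axioms])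
    fix a b C D
    assume a: "a \<in> carrier A" and b: "b \<in> carrier A"
      and "C \<in> carrier (quot_module M H)" "D \<in> carrier (quot_module M H)"
    then obtain x y where x: "x \<in> carrier M" "C = H +>\<^bsub>M\<^esub> x" and y: "y \<in> carrier M" "D = H +>\<^bsub>M\<^esub> y"
      unfolding quot_module_carrier_iff by blast
    note simps = a b x y quot_module_add[OF assms] quot_module_smult[OF assms]
    show "(a \<oplus>\<^bsub>A\<^esub> b) \<odot>\<^bsub>quot_module M H\<^esub> C = a \<odot>\<^bsub>quot_module M H\<^esub> C \<oplus>\<^bsub>quot_module M H\<^esub> b \<odot>\<^bsub>quot_module M H\<^esub> C"
      by (simp add: simps smult_l_distr)
    show "a \<odot>\<^bsub>quot_module M H\<^esub> (C \<oplus>\<^bsub>quot_module M H\<^esub> D) = a \<odot>\<^bsub>quot_module M H\<^esub> C \<oplus>\<^bsub>quot_module M H\<^esub> a \<odot>\<^bsub>quot_module M H\<^esub> D"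
      by (simp add: simps smult_r_distr)
    show "(a \<otimes>\<^bsub>A\<^esub> b) \<odot>\<^bsub>quot_module M H\<^esub> C = a \<odot>\<^bsub>quot_module M H\<^esub> (b \<odot>\<^bsub>quot_module M H\<^esub> C)"
      by (simp add: simps smult_assoc1)
  next
    fix a C assume "a \<in> carrier A" "C \<in> carrier (quot_module M H)"
    then show "a \<odot>\<^bsub>quot_module M H\<^esub> C \<in> carrier (quot_module M H)"
      unfolding quot_module_carrier_iff using quot_module_smult[OF assms] by (metis smult_closed)
  next
    fix C assume "C \<in> carrier (quot_module M H)"
    then show "\<one>\<^bsub>A\<^esub> \<odot>\<^bsub>quot_module M H\<^esub> C = C"
      unfolding quot_module_carrier_iff using quot_module_smult[OF assms] by (metis R.one_closed smult_one)
  qed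
qed

lemma mod_length_quot_module:
  assumes "module A M" "submodule H A M"
  shows "mod_length A (quot_module M H) = interval_length A M H (carrier M)"
proof -
  note quot = module_quot_module[OF assms]
  interpret module A M by fact
  interpret Q: module A "quot_module M H" by fact
  have minus: "C \<ominus>\<^bsub>quot_module M H\<^esub> C = H" if "C \<in> carrier (quot_module M H)" for C
    using Q.r_neg[OF that] by (simp add: Q.minus_eq quot_module_simps(2))
  have "interval_length A M H (carrier M)
      = interval_length A (quot_module M H) {H} (carrier (quot_module M H))"
  proof (rule interval_length_transfer[where \<rho> = "\<lambda>a. a" and \<Phi> = "\<lambda>x. H +>\<^bsub>M\<^esub> x"])
    show "submodule {H} A (quot_module M H)"
      using submodule_zero[OF quot] by (simp add: quot_module_simps(2))
    show "submodule (carrier (quot_module M H)) A (quot_module M H)"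
      by (rule Q.carrier_is_submodule)
    show "H = {x \<in> carrier M. H +>\<^bsub>M\<^esub> x \<in> {H}}" using coset_eq_self_iff[OF assms] submoduleD(1)[OF assms] by auto
    show "\<exists>x\<in>carrier M. C \<ominus>\<^bsub>quot_module M H\<^esub> (H +>\<^bsub>M\<^esub> x) \<in> {H}"
      if "C \<in> carrier (quot_module M H)" for C
      using that minus[OF that] unfolding quot_module_carrier_iff by auto
    show "{H} \<subseteq> carrier (quot_module M H)"
      using Q.zero_closed by (simp add: quot_module_simps(2))
    show "H +>\<^bsub>M\<^esub> x \<in> carrier (quot_module M H)" if "x \<in> carrier M" for x
      using that quot_module_carrier_iff by blast
  qed (simp_all add: assms quot quot_module_add[OF assms] quot_module_smult[OF assms])
  then show ?thesis by (simp add: mod_length_eq_interval_length[OF quot] quot_module_simps(2))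
qed


section \<open>Finitely generated modules over Noetherian rings\<close>

lemma submodule_mod_span:
  assumes "module A M" "S \<subseteq> carrier M"
  shows "submodule (mod_span A M S) A M" and "S \<subseteq> mod_span A M S"
proof -
  interpret module A M by fact
  have "carrier M \<in> {N. submodule N A M \<and> S \<subseteq> N}" using carrier_is_submodule assms(2) by blast
  then show "submodule (mod_span A M S) A M" and "S \<subseteq> mod_span A M S"
    unfolding mod_span_def by (auto simp: submodule_iff[OF assms(1)])
qed

lemma mod_span_least: "submodule N A M \<Longrightarrow> S \<subseteq> N \<Longrightarrow> mod_span A M S \<subseteq> N"
  unfolding mod_span_def by blast

lemma mod_span_mono: "S \<subseteq> T \<Longrightarrow> mod_span A M S \<subseteq> mod_span A M T"
  unfolding mod_span_def by blast

lemma mod_span_empty: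
  assumes "module A M" shows "mod_span A M {} = {\<zero>\<^bsub>M\<^esub>}"
  using mod_span_least[OF submodule_zero[OF assms]] submoduleD(2)[OF assms submodule_mod_span(1)[OF assms]]
  by auto

lemma submodule_Int:
  assumes "module A M" "submodule N A M" "submodule N' A M" shows "submodule (N \<inter> N') A M"
  using assms(2,3) unfolding submodule_iff[OF assms(1)] by blast

lemma mod_span_insert:
  assumes "module A M" "v \<in> carrier M" "S \<subseteq> carrier M" "x \<in> mod_span A M (insert v S)"
  shows "\<exists>a\<in>carrier A. x \<ominus>\<^bsub>M\<^esub> a \<odot>\<^bsub>M\<^esub> v \<in> mod_span A M S"
proof -
  interpret module A M by fact
  let ?W = "mod_span A M S"
  note W = submoduleD[OF assms(1) submodule_mod_span(1)[OF assms(1,3)]]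
  have Wc: "w \<in> carrier M" if "w \<in> ?W" for w using that W(1) by blast
  let ?N = "{x \<in> carrier M. \<exists>a\<in>carrier A. x \<ominus>\<^bsub>M\<^esub> a \<odot>\<^bsub>M\<^esub> v \<in> ?W}"
  have "submodule ?N A M"
    unfolding submodule_iff[OF assms(1)]
  proof (intro conjI ballI)
    show "\<zero>\<^bsub>M\<^esub> \<in> ?N" using assms(2) W(6)[OF W(2,2)] by (auto intro!: bexI[of _ "\<zero>\<^bsub>A\<^esub>"])
  next
    fix x y assume "x \<in> ?N" "y \<in> ?N"
    then obtain a b where *: "x \<in> carrier M" "y \<in> carrier M" "a \<in> carrier A" "b \<in> carrier A"
      "x \<ominus>\<^bsub>M\<^esub> a \<odot>\<^bsub>M\<^esub> v \<in> ?W" "y \<ominus>\<^bsub>M\<^esub> b \<odot>\<^bsub>M\<^esub> v \<in> ?W" by auto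
    have "(x \<oplus>\<^bsub>M\<^esub> y) \<ominus>\<^bsub>M\<^esub> (a \<oplus>\<^bsub>A\<^esub> b) \<odot>\<^bsub>M\<^esub> v = (x \<ominus>\<^bsub>M\<^esub> a \<odot>\<^bsub>M\<^esub> v) \<oplus>\<^bsub>M\<^esub> (y \<ominus>\<^bsub>M\<^esub> b \<odot>\<^bsub>M\<^esub> v)"
      using * assms(2) by (simp add: smult_l_distr M.minus_eq M.minus_add M.a_ac)
    then show "x \<oplus>\<^bsub>M\<^esub> y \<in> ?N" using * W(3) by (auto intro!: bexI[of _ "a \<oplus>\<^bsub>A\<^esub> b"])
  next
    fix c x assume c: "c \<in> carrier A" and "x \<in> ?N"
    then obtain a where *: "x \<in> carrier M" "a \<in> carrier A" "x \<ominus>\<^bsub>M\<^esub> a \<odot>\<^bsub>M\<^esub> v \<in> ?W" by auto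
    have "c \<odot>\<^bsub>M\<^esub> x \<ominus>\<^bsub>M\<^esub> (c \<otimes>\<^bsub>A\<^esub> a) \<odot>\<^bsub>M\<^esub> v = c \<odot>\<^bsub>M\<^esub> (x \<ominus>\<^bsub>M\<^esub> a \<odot>\<^bsub>M\<^esub> v)"
      using * c assms(2) by (simp add: smult_assoc1 smult_r_distr smult_r_minus M.minus_eq)
    then show "c \<odot>\<^bsub>M\<^esub> x \<in> ?N" using * c W(4) by (auto intro!: bexI[of _ "c \<otimes>\<^bsub>A\<^esub> a"])
  qed auto
  moreover have "v \<in> ?N" using assms(2) W(2)
    by (auto intro!: bexI[of _ "\<one>\<^bsub>A\<^esub>"] simp: M.minus_eq M.r_neg)
  moreover have "S \<subseteq> ?N"
    using assms(2,3) submodule_mod_span(2)[OF assms(1,3)] W(2) W(6)[OF _ W(2)]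
    by (auto intro!: bexI[of _ "\<zero>\<^bsub>A\<^esub>"])
  ultimately show ?thesis using mod_span_least[of ?N A M "insert v S"] assms(4) by auto
qed

lemma module_self_module:
  assumes "cring A" shows "module A (self_module A)"
proof -
  interpret cring A by fact
  have "abelian_group (self_module A)"
    by (intro abelian_groupI) (simp_all add: self_module_def a_ac add.l_inv_ex)
  then show ?thesis
    by (intro moduleI) (auto simp: self_module_def cring_axioms l_distr r_distr m_assoc)
qed

lemma ideal_iff_submodule:
  assumes "cring A" shows "ideal J A \<longleftrightarrow> submodule J A (self_module A)"
proof -
  interpret cring A by fact
  have "ideal J A \<longleftrightarrow> additive_subgroup J A \<and> (\<forall>a\<in>J. \<forall>x\<in>carrier A. x \<otimes>\<^bsub>A\<^esub> a \<in> J)"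
    using ring_axioms m_comm additive_subgroup.a_Hcarr[of J A] unfolding ideal_def ideal_axioms_def by metis
  also have "additive_subgroup J A \<longleftrightarrow> subgroup J (add_monoid (self_module A))"
    by (simp add: additive_subgroup_def self_module_def subgroup_def m_inv_def)
  finally show ?thesis
    unfolding submodule_def submodule_axioms_def by (auto simp: self_module_def)
qed

text \<open>This ideal measures the gap between \<open>N \<inter> W\<close> and \<open>N\<close> when \<open>N \<subseteq> W + A v\<close>.\<close>

lemma ideal_coefficients:
  assumes "module A M" "submodule N A M" "submodule W A M" "v \<in> carrier M"
  shows "ideal {a \<in> carrier A. \<exists>n\<in>N. n \<ominus>\<^bsub>M\<^esub> a \<odot>\<^bsub>M\<^esub> v \<in> W} A" (is "ideal ?J A")
proof -
  interpret module A M by fact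
  note ND = submoduleD[OF assms(1,2)] and WD = submoduleD[OF assms(1,3)]
  have Nc: "n \<in> carrier M" if "n \<in> N" for n using that ND(1) by blast
  have self: "self_module A = \<lparr>carrier = carrier A, mult = mult A, one = one A,
     zero = zero A, add = add A, smult = mult A\<rparr>" by (simp add: self_module_def)
  show ?thesis
    unfolding ideal_iff_submodule[OF R.cring_axioms] submodule_iff[OF module_self_module[OF R.cring_axioms]] 
    unfolding self module.simps ring.simps partial_object.simps monoid.simps
  proof (intro conjI ballI)
    show "\<zero>\<^bsub>A\<^esub> \<in> ?J" using assms(4) ND(2) WD(6)[OF WD(2,2)] by (auto intro!: bexI[of _ "\<zero>\<^bsub>M\<^esub>"])
  next
    fix a b assume "a \<in> ?J" "b \<in> ?J"
    then obtain m n where *: "m \<in> N" "n \<in> N" "a \<in> carrier A" "b \<in> carrier A"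
      "m \<ominus>\<^bsub>M\<^esub> a \<odot>\<^bsub>M\<^esub> v \<in> W" "n \<ominus>\<^bsub>M\<^esub> b \<odot>\<^bsub>M\<^esub> v \<in> W" by auto
    have "(m \<oplus>\<^bsub>M\<^esub> n) \<ominus>\<^bsub>M\<^esub> (a \<oplus>\<^bsub>A\<^esub> b) \<odot>\<^bsub>M\<^esub> v = (m \<ominus>\<^bsub>M\<^esub> a \<odot>\<^bsub>M\<^esub> v) \<oplus>\<^bsub>M\<^esub> (n \<ominus>\<^bsub>M\<^esub> b \<odot>\<^bsub>M\<^esub> v)"
      using * Nc assms(4) by (simp add: smult_l_distr M.minus_eq M.minus_add M.a_ac)
    then show "a \<oplus>\<^bsub>A\<^esub> b \<in> ?J" using * ND(3) WD(3) by (auto intro!: bexI[of _ "m \<oplus>\<^bsub>M\<^esub> n"])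
  next
    fix c a assume c: "c \<in> carrier A" and "a \<in> ?J"
    then obtain n where *: "n \<in> N" "a \<in> carrier A" "n \<ominus>\<^bsub>M\<^esub> a \<odot>\<^bsub>M\<^esub> v \<in> W" by auto
    have "c \<odot>\<^bsub>M\<^esub> n \<ominus>\<^bsub>M\<^esub> (c \<otimes>\<^bsub>A\<^esub> a) \<odot>\<^bsub>M\<^esub> v = c \<odot>\<^bsub>M\<^esub> (n \<ominus>\<^bsub>M\<^esub> a \<odot>\<^bsub>M\<^esub> v)"
      using * c Nc assms(4) by (simp add: smult_assoc1 smult_r_distr smult_r_minus M.minus_eq)
    then show "c \<otimes>\<^bsub>A\<^esub> a \<in> ?J" using * c ND(4) WD(4) by (auto intro!: bexI[of _ "c \<odot>\<^bsub>M\<^esub> n"])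
  qed auto
qed

text \<open>Induction on the number of generators. Let \<open>W\<close> be spanned by all generators but \<open>v\<close>. Finitely many
  elements of \<open>N\<close> realize generators of the ideal of coefficients of \<open>v\<close>; subtracting a combination of
  them moves an element of \<open>N\<close> into \<open>N \<inter> W\<close>, which is finitely generated by induction.\<close>

lemma noetherian_submodule_fin_gen:
  assumes "module A M" "noetherian_ring A" "finite S" "S \<subseteq> carrier M"
    and "submodule N A M" "N \<subseteq> mod_span A M S"
  shows "\<exists>T. finite T \<and> T \<subseteq> carrier M \<and> N = mod_span A M T"
  using assms(3-)
proof (induction S arbitrary: N rule: finite_induct)
  case empty
  then have "N = {\<zero>\<^bsub>M\<^esub>}" using submoduleD(2)[OF assms(1)] mod_span_empty[OF assms(1)] by blast
  then show ?case using mod_span_empty[OF assms(1)] by blast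
next
  case (insert v S)
  interpret module A M by fact
  interpret noetherian_ring A by fact
  from insert have v: "v \<in> carrier M" and S: "S \<subseteq> carrier M" by auto
  let ?W = "mod_span A M S"
  note W = submodule_mod_span(1)[OF assms(1) S] and N = insert.prems(2)
  note WD = submoduleD[OF assms(1) W] and ND = submoduleD[OF assms(1) N]
  obtain T where T: "finite T" "T \<subseteq> carrier M" "N \<inter> ?W = mod_span A M T"
    using insert.IH[OF S submodule_Int[OF assms(1) N W]] by auto
  let ?J = "\<lambda>N. {a \<in> carrier A. \<exists>n\<in>N. n \<ominus>\<^bsub>M\<^esub> a \<odot>\<^bsub>M\<^esub> v \<in> ?W}"
  obtain B where B: "B \<subseteq> carrier A" "finite B" "?J N = Idl\<^bsub>A\<^esub> B"
    using finetely_gen[OF ideal_coefficients[OF assms(1) N W v]] by auto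
  then have "B \<subseteq> ?J N" using genideal_self by blast
  then have "\<forall>b\<in>B. \<exists>n\<in>N. n \<ominus>\<^bsub>M\<^esub> b \<odot>\<^bsub>M\<^esub> v \<in> ?W" by blast
  then obtain n where n: "\<And>b. b \<in> B \<Longrightarrow> n b \<in> N" "\<And>b. b \<in> B \<Longrightarrow> n b \<ominus>\<^bsub>M\<^esub> b \<odot>\<^bsub>M\<^esub> v \<in> ?W" by metis
  let ?T = "T \<union> n ` B"
  have Tc: "?T \<subseteq> carrier M" using T(2) n(1) ND(1) by blast
  note span = submodule_mod_span[OF assms(1) Tc]
  have "T \<subseteq> N" using T(3) submodule_mod_span(2)[OF assms(1) T(2)] by blast
  then have sub: "mod_span A M ?T \<subseteq> N" using n(1) by (intro mod_span_least[OF N]) auto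
  have "Idl\<^bsub>A\<^esub> B \<subseteq> ?J (mod_span A M ?T)"
    using B(1) n(2) span(2)
    by (intro genideal_minimal ideal_coefficients[OF assms(1) span(1) W v]) blast
  then have J: "?J N \<subseteq> ?J (mod_span A M ?T)" using B(3) by simp
  have "N \<subseteq> mod_span A M ?T"
  proof
    fix x assume x: "x \<in> N"
    then obtain a where a: "a \<in> carrier A" "x \<ominus>\<^bsub>M\<^esub> a \<odot>\<^bsub>M\<^esub> v \<in> ?W"
      using mod_span_insert[OF assms(1) v S] insert.prems(3) by blast
    then obtain y where y: "y \<in> mod_span A M ?T" "y \<ominus>\<^bsub>M\<^esub> a \<odot>\<^bsub>M\<^esub> v \<in> ?W" using J x by blast
    have c: "x \<in> carrier M" "y \<in> carrier M" using x y sub ND(1) by auto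
    have "(x \<ominus>\<^bsub>M\<^esub> a \<odot>\<^bsub>M\<^esub> v) \<ominus>\<^bsub>M\<^esub> (y \<ominus>\<^bsub>M\<^esub> a \<odot>\<^bsub>M\<^esub> v) = x \<ominus>\<^bsub>M\<^esub> y"
    proof -
      have "(x \<ominus>\<^bsub>M\<^esub> w) \<ominus>\<^bsub>M\<^esub> (y \<ominus>\<^bsub>M\<^esub> w) = x \<ominus>\<^bsub>M\<^esub> y" if "w \<in> carrier M" for w
      proof -
        have "(x \<ominus>\<^bsub>M\<^esub> w) \<ominus>\<^bsub>M\<^esub> (y \<ominus>\<^bsub>M\<^esub> w) = (x \<ominus>\<^bsub>M\<^esub> y) \<oplus>\<^bsub>M\<^esub> (w \<ominus>\<^bsub>M\<^esub> w)"
          using c that by (simp add: M.minus_eq M.minus_add M.a_ac)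
        then show ?thesis using c that by (simp add: M.minus_eq M.r_neg)
      qed
      then show ?thesis using a v by simp
    qed
    then have "x \<ominus>\<^bsub>M\<^esub> y \<in> N \<inter> ?W" using WD(6)[OF a(2) y(2)] ND(6)[OF x] y(1) sub by auto
    then have "x \<ominus>\<^bsub>M\<^esub> y \<in> mod_span A M ?T" using T(3) mod_span_mono[of T ?T A M] by auto
    then have "(x \<ominus>\<^bsub>M\<^esub> y) \<oplus>\<^bsub>M\<^esub> y \<in> mod_span A M ?T"
      using y(1) submoduleD(3)[OF assms(1) span(1)] by blast
    moreover have "(x \<ominus>\<^bsub>M\<^esub> y) \<oplus>\<^bsub>M\<^esub> y = x"
      using c by (simp add: M.minus_eq M.a_assoc M.l_neg)
    ultimately show "x \<in> mod_span A M ?T" by simp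
  qed
  then have "N = mod_span A M ?T" using sub by blast
  moreover have "finite ?T" using T(1) B(2) by blast
  ultimately show ?case using Tc by blast
qed

section \<open>Free modules and free resolutions\<close>

lemma free_module_simps:
  "carrier (free_module A n) = {..<n} \<rightarrow>\<^sub>E carrier A"
  "\<zero>\<^bsub>free_module A n\<^esub> = (\<lambda>i\<in>{..<n}. \<zero>\<^bsub>A\<^esub>)"
  "v \<oplus>\<^bsub>free_module A n\<^esub> w = (\<lambda>i\<in>{..<n}. v i \<oplus>\<^bsub>A\<^esub> w i)"
  "a \<odot>\<^bsub>free_module A n\<^esub> v = (\<lambda>i\<in>{..<n}. a \<otimes>\<^bsub>A\<^esub> v i)"
  by (simp_all add: free_module_def)

lemma module_free_module:
  assumes "cring A" shows "module A (free_module A n)"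
proof -
  interpret cring A by fact
  let ?F = "{..<n} \<rightarrow>\<^sub>E carrier A"
  have mem [simp]: "v i \<in> carrier A" if "v \<in> ?F" "i < n" for v i using that by auto
  have restrict [simp]: "restrict f {..<n} \<in> ?F \<longleftrightarrow> (\<forall>i<n. f i \<in> carrier A)" for f
    by (auto simp: PiE_iff)
  have restrict_eq: "restrict f {..<n} = v \<longleftrightarrow> (\<forall>i<n. f i = v i)" if "v \<in> ?F" for f v
    using that by (auto simp: PiE_iff extensional_def fun_eq_iff)
  have restrict_eq': "restrict f {..<n} = restrict g {..<n} \<longleftrightarrow> (\<forall>i<n. f i = g i)" for f g :: "nat \<Rightarrow> 'a"
    by (auto simp: fun_eq_iff restrict_def)
  have "abelian_group (free_module A n)"
  proof (rule abelian_groupI)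
    fix v assume v: "v \<in> carrier (free_module A n)"
    then have "(\<lambda>i\<in>{..<n}. \<ominus>\<^bsub>A\<^esub> v i) \<in> carrier (free_module A n)"
      "(\<lambda>i\<in>{..<n}. \<ominus>\<^bsub>A\<^esub> v i) \<oplus>\<^bsub>free_module A n\<^esub> v = \<zero>\<^bsub>free_module A n\<^esub>"
      by (simp_all add: free_module_simps restrict_eq' l_neg)
    then show "\<exists>w\<in>carrier (free_module A n). w \<oplus>\<^bsub>free_module A n\<^esub> v = \<zero>\<^bsub>free_module A n\<^esub>" by blast
  qed (simp_all add: free_module_simps restrict_eq restrict_eq' a_ac)
  then show ?thesis
    by (intro moduleI)
      (simp_all add: free_module_simps cring_axioms restrict_eq restrict_eq' l_distr r_distr m_assoc)
qed

primrec lincomb :: "('a, 'm, 'c) module_scheme \<Rightarrow> nat \<Rightarrow> (nat \<Rightarrow> 'a) \<Rightarrow> (nat \<Rightarrow> 'm) \<Rightarrow> 'm" where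
  "lincomb M 0 v g = \<zero>\<^bsub>M\<^esub>"
| "lincomb M (Suc n) v g = lincomb M n v g \<oplus>\<^bsub>M\<^esub> v n \<odot>\<^bsub>M\<^esub> g n"

definition basis_vec :: "('a, 'q) ring_scheme \<Rightarrow> nat \<Rightarrow> nat \<Rightarrow> nat \<Rightarrow> 'a" where
  "basis_vec A n i = (\<lambda>j\<in>{..<n}. if j = i then \<one>\<^bsub>A\<^esub> else \<zero>\<^bsub>A\<^esub>)"

lemma basis_vec_closed:
  assumes "cring A" shows "basis_vec A n i \<in> carrier (free_module A n)"
proof -
  interpret cring A by fact
  show ?thesis by (auto simp: basis_vec_def free_module_simps)
qed

lemma lincomb_in_submodule:
  assumes "module A M" "submodule N A M"
    and "\<And>i. i < n \<Longrightarrow> v i \<in> carrier A" "\<And>i. i < n \<Longrightarrow> g i \<in> N"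
  shows "lincomb M n v g \<in> N"
  using assms(3,4) by (induction n) (auto intro: submoduleD[OF assms(1,2)])

lemma lincomb_closed:
  assumes "module A M" "\<And>i. i < n \<Longrightarrow> v i \<in> carrier A" "\<And>i. i < n \<Longrightarrow> g i \<in> carrier M"
  shows "lincomb M n v g \<in> carrier M"
  by (rule lincomb_in_submodule[OF assms(1) module.carrier_is_submodule[OF assms(1)] assms(2,3)])

lemma lincomb_cong:
  assumes "\<And>i. i < n \<Longrightarrow> v i = w i"
  shows "lincomb M n v g = lincomb M n w g"
  using assms by (induction n) auto

lemma lincomb_add:
  assumes "module A M" "\<And>i. i < n \<Longrightarrow> v i \<in> carrier A" "\<And>i. i < n \<Longrightarrow> w i \<in> carrier A"
    "\<And>i. i < n \<Longrightarrow> g i \<in> carrier M"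
  shows "lincomb M n (\<lambda>i. v i \<oplus>\<^bsub>A\<^esub> w i) g = lincomb M n v g \<oplus>\<^bsub>M\<^esub> lincomb M n w g"
  using assms(2-)
proof (induction n)
  case 0
  interpret module A M by fact
  show ?case by simp
next
  case (Suc n)
  interpret module A M by fact
  have "lincomb M n v g \<in> carrier M" "lincomb M n w g \<in> carrier M"
    using Suc.prems by (auto intro!: lincomb_closed[OF assms(1)])
  then show ?case using Suc by (simp add: smult_l_distr M.a_ac)
qed

lemma lincomb_smult:
  assumes "module A M" "a \<in> carrier A" "\<And>i. i < n \<Longrightarrow> v i \<in> carrier A" "\<And>i. i < n \<Longrightarrow> g i \<in> carrier M"
  shows "lincomb M n (\<lambda>i. a \<otimes>\<^bsub>A\<^esub> v i) g = a \<odot>\<^bsub>M\<^esub> lincomb M n v g"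
  using assms(3-)
proof (induction n)
  case 0
  interpret module A M by fact
  show ?case using assms(2) by simp
next
  case (Suc n)
  interpret module A M by fact
  have "lincomb M n v g \<in> carrier M"
    using Suc.prems by (auto intro!: lincomb_closed[OF assms(1)])
  then show ?case using Suc assms(2) by (simp add: smult_assoc1 smult_r_distr)
qed

lemma lincomb_basis_vec:
  assumes "module A M" "\<And>i. i < n \<Longrightarrow> g i \<in> carrier M" "i < n"
  shows "lincomb M n (basis_vec A n i) g = g i"
proof -
  interpret module A M by fact
  have "m \<le> n \<Longrightarrow> lincomb M m (basis_vec A n i) g = (if i < m then g i else \<zero>\<^bsub>M\<^esub>)" for m
    using assms(2,3) by (induction m) (auto simp: basis_vec_def less_Suc_eq)
  from this[of n] assms(3) show ?thesis by simp
qed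

lemma lincomb_free_module:
  assumes "cring A" "v \<in> carrier (free_module A n)"
  shows "lincomb (free_module A n) n v (basis_vec A n) = v"
proof -
  interpret cring A by fact
  have v: "v i \<in> carrier A" if "i < n" for i using that assms(2) by (auto simp: free_module_simps)
  have "m \<le> n \<Longrightarrow> lincomb (free_module A n) m v (basis_vec A n)
      = (\<lambda>i\<in>{..<n}. if i < m then v i else \<zero>\<^bsub>A\<^esub>)" for m
  proof (induction m)
    case (Suc m)
    then show ?case
      using v by (auto simp: free_module_simps basis_vec_def less_Suc_eq intro!: restrict_ext)
  qed (simp add: free_module_simps)
  from this[of n] have "lincomb (free_module A n) n v (basis_vec A n) = restrict v {..<n}"
    by (auto intro!: restrict_ext)
  then show ?thesis using assms(2) by (simp add: free_module_simps PiE_def extensional_restrict)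
qed

lemma mod_homD:
  assumes "f \<in> mod_hom A M N"
  shows "\<And>x. x \<in> carrier M \<Longrightarrow> f x \<in> carrier N"
    "\<And>x y. x \<in> carrier M \<Longrightarrow> y \<in> carrier M \<Longrightarrow> f (x \<oplus>\<^bsub>M\<^esub> y) = f x \<oplus>\<^bsub>N\<^esub> f y"
    "\<And>a x. a \<in> carrier A \<Longrightarrow> x \<in> carrier M \<Longrightarrow> f (a \<odot>\<^bsub>M\<^esub> x) = a \<odot>\<^bsub>N\<^esub> f x"
  using assms unfolding mod_hom_def by auto

lemma mod_hom_zero:
  assumes "module A M" "module A N" "f \<in> mod_hom A M N"
  shows "f \<zero>\<^bsub>M\<^esub> = \<zero>\<^bsub>N\<^esub>"
proof -
  interpret M: module A M by fact
  interpret N: module A N by fact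
  have "f \<zero>\<^bsub>M\<^esub> \<oplus>\<^bsub>N\<^esub> f \<zero>\<^bsub>M\<^esub> = f \<zero>\<^bsub>M\<^esub>" using mod_homD(2)[OF assms(3), of "\<zero>\<^bsub>M\<^esub>" "\<zero>\<^bsub>M\<^esub>"] by simp
  then show ?thesis by (metis N.add.l_cancel_one' M.zero_closed mod_homD(1)[OF assms(3)])
qed

lemma mod_hom_minus:
  assumes "module A M" "module A N" "f \<in> mod_hom A M N" "x \<in> carrier M" "y \<in> carrier M"
  shows "f (x \<ominus>\<^bsub>M\<^esub> y) = f x \<ominus>\<^bsub>N\<^esub> f y"
proof -
  interpret M: module A M by fact
  interpret N: module A N by fact
  note f = mod_homD[OF assms(3)]
  have "f (x \<ominus>\<^bsub>M\<^esub> y) \<oplus>\<^bsub>N\<^esub> f y = f x"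
    using f(2)[of "x \<ominus>\<^bsub>M\<^esub> y" y] assms(4,5) by (simp add: M.minus_eq M.add.m_assoc M.l_neg)
  then show ?thesis
    by (metis N.add.inv_solve_right N.minus_eq M.minus_closed f(1) assms(4,5))
qed

lemma submodule_kernel:
  assumes "module A M" "module A N" "f \<in> mod_hom A M N"
  shows "submodule {x \<in> carrier M. f x = \<zero>\<^bsub>N\<^esub>} A M"
proof -
  interpret M: module A M by fact
  interpret N: module A N by fact
  show ?thesis
    unfolding submodule_iff[OF assms(1)]
    using mod_hom_zero[OF assms] by (auto simp: mod_homD[OF assms(3)])
qed

lemma mod_hom_lincomb:
  assumes "module A M" "module A N" "f \<in> mod_hom A M N"
    and "\<And>i. i < n \<Longrightarrow> v i \<in> carrier A" "\<And>i. i < n \<Longrightarrow> g i \<in> carrier M"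
  shows "f (lincomb M n v g) = lincomb N n v (\<lambda>i. f (g i))"
  using assms(4-)
proof (induction n)
  case (Suc n)
  interpret M: module A M by fact
  have "lincomb M n v g \<in> carrier M" "v n \<odot>\<^bsub>M\<^esub> g n \<in> carrier M"
    using Suc.prems by (auto intro!: lincomb_closed[OF assms(1)])
  then show ?case using Suc by (simp add: mod_homD[OF assms(3)])
qed (simp add: mod_hom_zero[OF assms(1-3)])

lemma mod_hom_free_module_eq:
  assumes "module A N" "f \<in> mod_hom A (free_module A n) N" "v \<in> carrier (free_module A n)"
  shows "f v = lincomb N n v (\<lambda>i. f (basis_vec A n i))"
proof -
  interpret module A N by fact
  have "f v = f (lincomb (free_module A n) n v (basis_vec A n))"
    using lincomb_free_module[OF R.cring_axioms assms(3)] by simp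
  also have "\<dots> = lincomb N n v (\<lambda>i. f (basis_vec A n i))"
    using assms(3) basis_vec_closed[OF R.cring_axioms]
    by (intro mod_hom_lincomb[OF module_free_module[OF R.cring_axioms] assms(1,2)])
      (auto simp: free_module_simps)
  finally show ?thesis .
qed

lemma lincomb_mod_hom:
  assumes "module A M" "\<And>i. i < n \<Longrightarrow> g i \<in> carrier M"
  shows "(\<lambda>v\<in>carrier (free_module A n). lincomb M n v g) \<in> mod_hom A (free_module A n) M"
proof -
  interpret module A M by fact
  interpret F: module A "free_module A n" by (rule module_free_module[OF R.cring_axioms])
  have v: "v i \<in> carrier A" if "v \<in> carrier (free_module A n)" "i < n" for v i
    using that by (auto simp: free_module_simps)
  have add: "lincomb M n (v \<oplus>\<^bsub>free_module A n\<^esub> w) g = lincomb M n v g \<oplus>\<^bsub>M\<^esub> lincomb M n w g"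
    if "v \<in> carrier (free_module A n)" "w \<in> carrier (free_module A n)" for v w
  proof -
    have "lincomb M n (v \<oplus>\<^bsub>free_module A n\<^esub> w) g = lincomb M n (\<lambda>i. v i \<oplus>\<^bsub>A\<^esub> w i) g"
      by (rule lincomb_cong) (simp add: free_module_simps)
    then show ?thesis using lincomb_add[OF assms(1)] v that assms(2) by simp
  qed
  have smult: "lincomb M n (a \<odot>\<^bsub>free_module A n\<^esub> v) g = a \<odot>\<^bsub>M\<^esub> lincomb M n v g"
    if "a \<in> carrier A" "v \<in> carrier (free_module A n)" for a v
  proof -
    have "lincomb M n (a \<odot>\<^bsub>free_module A n\<^esub> v) g = lincomb M n (\<lambda>i. a \<otimes>\<^bsub>A\<^esub> v i) g"
      by (rule lincomb_cong) (simp add: free_module_simps)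
    then show ?thesis using lincomb_smult[OF assms(1)] v that assms(2) by simp
  qed
  have closed: "lincomb M n v g \<in> carrier M" if "v \<in> carrier (free_module A n)" for v
    by (rule lincomb_closed[OF assms(1) v[OF that] assms(2)])
  show ?thesis unfolding mod_hom_def using add smult closed by simp
qed

lemma lincomb_image:
  assumes "module A M" "\<And>i. i < n \<Longrightarrow> g i \<in> carrier M"
  shows "(\<lambda>v. lincomb M n v g) ` carrier (free_module A n) = mod_span A M (g ` {..<n})"
proof -
  interpret module A M by fact
  interpret F: module A "free_module A n" by (rule module_free_module[OF R.cring_axioms])
  let ?f = "\<lambda>v\<in>carrier (free_module A n). lincomb M n v g"
  have g: "g ` {..<n} \<subseteq> carrier M" using assms(2) by auto
  note f = lincomb_mod_hom[OF assms(1), of n g, OF assms(2)]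
  have "lincomb M n v g \<in> mod_span A M (g ` {..<n})" if "v \<in> carrier (free_module A n)" for v
    using that submodule_mod_span(2)[OF assms(1) g]
    by (intro lincomb_in_submodule[OF assms(1) submodule_mod_span(1)[OF assms(1) g]])
      (auto simp: free_module_simps)
  moreover have "submodule (?f ` carrier (free_module A n)) A M"
    unfolding submodule_iff[OF assms(1)]
  proof (intro conjI ballI)
    show "\<zero>\<^bsub>M\<^esub> \<in> ?f ` carrier (free_module A n)"
    proof -
      have "?f \<zero>\<^bsub>free_module A n\<^esub> = \<zero>\<^bsub>M\<^esub>"
        by (rule mod_hom_zero[OF module_free_module[OF R.cring_axioms] assms(1) f])
      then show ?thesis using imageI[OF F.zero_closed, of ?f] by (simp only:)
    qed
  next
    fix x y assume "x \<in> ?f ` carrier (free_module A n)" "y \<in> ?f ` carrier (free_module A n)"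
    then obtain v w where v: "v \<in> carrier (free_module A n)" "x = ?f v"
      and w: "w \<in> carrier (free_module A n)" "y = ?f w" by blast
    show "x \<oplus>\<^bsub>M\<^esub> y \<in> ?f ` carrier (free_module A n)"
      unfolding v(2) w(2)
      using imageI[OF F.a_closed[OF v(1) w(1)], of ?f] by (simp only: mod_homD(2)[OF f v(1) w(1)])
  next
    fix a x assume a: "a \<in> carrier A" and "x \<in> ?f ` carrier (free_module A n)"
    then obtain v where v: "v \<in> carrier (free_module A n)" "x = ?f v" by blast
    show "a \<odot>\<^bsub>M\<^esub> x \<in> ?f ` carrier (free_module A n)"
      unfolding v(2)
      using imageI[OF F.smult_closed[OF a v(1)], of ?f] by (simp only: mod_homD(3)[OF f a v(1)])
  qed (use mod_homD(1)[OF f] in blast)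
  moreover have "g i \<in> ?f ` carrier (free_module A n)" if "i < n" for i
    using lincomb_basis_vec[OF assms(1), of n g, OF assms(2) that] basis_vec_closed[OF R.cring_axioms, of n i]
    by (intro image_eqI[of _ _ "basis_vec A n i"]) auto
  ultimately show ?thesis
    using mod_span_least[of "?f ` carrier (free_module A n)" A M "g ` {..<n}"] by auto
qed

lemma free_module_cover:
  assumes "module A M" "finite T" "T \<subseteq> carrier M"
  shows "\<exists>n d. d \<in> mod_hom A (free_module A n) M \<and> d ` carrier (free_module A n) = mod_span A M T"
proof -
  obtain g n where g: "T = g ` {i::nat. i < n}" using assms(2) finite_imp_nat_seg_image_inj_on by metis
  then have gc: "\<And>i. i < n \<Longrightarrow> g i \<in> carrier M" using assms(3) by auto
  show ?thesis
    using lincomb_mod_hom[OF assms(1), of n g, OF gc] lincomb_image[OF assms(1), of n g, OF gc] g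
    by (intro exI[of _ n] exI[of _ "\<lambda>v\<in>carrier (free_module A n). lincomb M n v g"])
      (auto simp: lessThan_def)
qed

lemma kernel_cover:
  assumes "noetherian_ring A" "module A N" "f \<in> mod_hom A (free_module A n) N"
  shows "\<exists>m d. d \<in> mod_hom A (free_module A m) (free_module A n) \<and>
    d ` carrier (free_module A m) = {v \<in> carrier (free_module A n). f v = \<zero>\<^bsub>N\<^esub>}"
proof -
  interpret module A N by fact
  let ?K = "{v \<in> carrier (free_module A n). f v = \<zero>\<^bsub>N\<^esub>}"
  let ?B = "basis_vec A n ` {..<n}"
  note F = module_free_module[OF R.cring_axioms, of n]
  have B: "?B \<subseteq> carrier (free_module A n)" using basis_vec_closed[OF R.cring_axioms] by blast
  have "v \<in> mod_span A (free_module A n) ?B" if "v \<in> carrier (free_module A n)" for v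
    using lincomb_image[OF F, of n "basis_vec A n", OF basis_vec_closed[OF R.cring_axioms]]
      imageI[OF that, of "\<lambda>v. lincomb (free_module A n) n v (basis_vec A n)"]
    by (simp add: lincomb_free_module[OF R.cring_axioms that])
  then have "?K \<subseteq> mod_span A (free_module A n) ?B" by blast
  then have "\<exists>T. finite T \<and> T \<subseteq> carrier (free_module A n) \<and> ?K = mod_span A (free_module A n) T"
    by (intro noetherian_submodule_fin_gen[OF F assms(1) _ B submodule_kernel[OF F assms(2,3)]]) simp_all
  then obtain T where T: "finite T" "T \<subseteq> carrier (free_module A n)"
    and K: "?K = mod_span A (free_module A n) T" by blast
  show ?thesis unfolding K by (rule free_module_cover[OF F T])
qed

text \<open>Kernels of maps between free modules of finite rank are finitely generated, so each differential
  can be chosen as a free cover of the kernel of the preceding one.\<close>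

lemma free_resolution_exists:
  assumes "noetherian_ring A" "fin_gen_module A N"
  shows "\<exists>F. free_resolution A N F"
proof -
  from assms(2) obtain S where N: "module A N" and S: "finite S" "S \<subseteq> carrier N" "mod_span A N S = carrier N"
    unfolding fin_gen_module_def by blast
  interpret module A N by fact
  obtain n \<epsilon> where \<epsilon>: "\<epsilon> \<in> mod_hom A (free_module A n) N" "\<epsilon> ` carrier (free_module A n) = carrier N"
    using free_module_cover[OF N S(1,2)] S(3) by metis
  \<comment> \<open>Dependent choice over triples of source rank, target rank and differential.\<close>
  define P where "P i x = (case x of (s, t, d) \<Rightarrow> d \<in> mod_hom A (free_module A s) (free_module A t) \<and>
     (i = 0 \<longrightarrow> t = n \<and> d ` carrier (free_module A s) = {v \<in> carrier (free_module A n). \<epsilon> v = \<zero>\<^bsub>N\<^esub>}))"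
    for i :: nat and x :: "nat \<times> nat \<times> ((nat \<Rightarrow> 'a) \<Rightarrow> nat \<Rightarrow> 'a)"
  define Q where "Q x y = (case x of (s, t, d) \<Rightarrow> case y of (s', t', d') \<Rightarrow> t' = s \<and>
     d' ` carrier (free_module A s') = {v \<in> carrier (free_module A s). d v = \<zero>\<^bsub>free_module A t\<^esub>})"
    for x y :: "nat \<times> nat \<times> ((nat \<Rightarrow> 'a) \<Rightarrow> nat \<Rightarrow> 'a)"
  have "\<exists>x. P 0 x"
    using kernel_cover[OF assms(1) N \<epsilon>(1)] unfolding P_def by auto
  moreover have "\<exists>y. P (Suc i) y \<and> Q x y" if "P i x" for x i
  proof -
    obtain s t d where x: "x = (s, t, d)" by (cases x) auto
    with that have "d \<in> mod_hom A (free_module A s) (free_module A t)" unfolding P_def by simp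
    then show ?thesis
      using kernel_cover[OF assms(1) module_free_module[OF R.cring_axioms]] unfolding P_def Q_def x by fastforce
  qed
  ultimately obtain F where F: "\<And>i. P i (F i)" "\<And>i. Q (F i) (F (Suc i))"
    using dependent_nat_choice[of P "\<lambda>_. Q"] by metis
  define b where "b i = (case i of 0 \<Rightarrow> n | Suc j \<Rightarrow> fst (F j))" for i
  define \<delta> where "\<delta> i = snd (snd (F i))" for i
  have b: "b 0 = n" "b (Suc i) = fst (F i)" for i by (simp_all add: b_def)
  have t: "fst (snd (F i)) = b i" for i
    using F(1)[of 0] F(2) by (cases i) (auto simp: b P_def Q_def split_beta)
  have Feq: "F i = (b (Suc i), b i, \<delta> i)" for i using t[of i] by (auto simp: b \<delta>_def prod_eq_iff)
  have "free_resolution A N (b, \<delta>, \<epsilon>)"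
    using \<epsilon> F(1)[of 0] F unfolding free_resolution_def by (auto simp: b(1) Feq P_def Q_def)
  then show ?thesis by blast
qed

section \<open>The first Ext of a cyclic module\<close>

lemma (in abelian_group) eq_if_minus_eq_zero:
  assumes "x \<in> carrier G" "y \<in> carrier G" "x \<ominus> y = \<zero>"
  shows "x = y"
proof -
  have "x = (x \<ominus> y) \<oplus> y" using assms(1,2) by (simp add: minus_eq a_assoc l_neg)
  then show ?thesis using assms by simp
qed

lemma restrict_mod_hom_iff:
  assumes "module A M"
  shows "(\<lambda>x\<in>carrier M. h x) \<in> mod_hom A M N \<longleftrightarrow>
    (\<forall>x\<in>carrier M. h x \<in> carrier N) \<and>
    (\<forall>x\<in>carrier M. \<forall>y\<in>carrier M. h (x \<oplus>\<^bsub>M\<^esub> y) = h x \<oplus>\<^bsub>N\<^esub> h y) \<and>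
    (\<forall>a\<in>carrier A. \<forall>x\<in>carrier M. h (a \<odot>\<^bsub>M\<^esub> x) = a \<odot>\<^bsub>N\<^esub> h x)"
proof -
  interpret module A M by fact
  show ?thesis unfolding mod_hom_def by (auto simp: PiE_iff)
qed

lemma Hom_module_simps:
  "carrier (Hom_module A M N) = mod_hom A M N"
  "\<zero>\<^bsub>Hom_module A M N\<^esub> = (\<lambda>x\<in>carrier M. \<zero>\<^bsub>N\<^esub>)"
  "f \<oplus>\<^bsub>Hom_module A M N\<^esub> g = (\<lambda>x\<in>carrier M. f x \<oplus>\<^bsub>N\<^esub> g x)"
  "a \<odot>\<^bsub>Hom_module A M N\<^esub> f = (\<lambda>x\<in>carrier M. a \<odot>\<^bsub>N\<^esub> f x)"
  by (simp_all add: Hom_module_def)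

lemma module_Hom_module:
  fixes A :: "('a, 'q) ring_scheme" and M :: "('a, 'm, 'c) module_scheme" and N :: "('a, 'n, 'd) module_scheme"
  assumes M: "module A M" and N: "module A N"
  shows "module A (Hom_module A M N)"
proof -
  interpret M: module A M by fact
  interpret N: module A N by fact
  have restrict_eq: "restrict f (carrier M) = g \<longleftrightarrow> (\<forall>x\<in>carrier M. f x = g x)" if "g \<in> mod_hom A M N" for f g
    using that by (auto simp: mod_hom_def PiE_iff extensional_def fun_eq_iff)
  have restrict_eq': "restrict f (carrier M) = restrict g (carrier M) \<longleftrightarrow> (\<forall>x\<in>carrier M. f x = g x)"
    for f g :: "'m \<Rightarrow> 'n" by (auto simp: fun_eq_iff restrict_def)
  have smult_comm: "a \<odot>\<^bsub>N\<^esub> (c \<odot>\<^bsub>N\<^esub> x) = c \<odot>\<^bsub>N\<^esub> (a \<odot>\<^bsub>N\<^esub> x)"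
    if "a \<in> carrier A" "c \<in> carrier A" "x \<in> carrier N" for a c x
    using that by (simp add: N.smult_assoc1[symmetric] M.R.m_comm)
  have add: "f \<oplus>\<^bsub>Hom_module A M N\<^esub> g \<in> mod_hom A M N" if "f \<in> mod_hom A M N" "g \<in> mod_hom A M N" for f g
    using mod_homD[OF that(1)] mod_homD[OF that(2)] unfolding Hom_module_simps restrict_mod_hom_iff[OF M]
    by (simp add: N.smult_r_distr N.M.a_ac)
  have smult: "a \<odot>\<^bsub>Hom_module A M N\<^esub> f \<in> mod_hom A M N" if "a \<in> carrier A" "f \<in> mod_hom A M N" for a f
    using mod_homD[OF that(2)] that(1) unfolding Hom_module_simps restrict_mod_hom_iff[OF M]
    by (simp add: N.smult_r_distr smult_comm)
  have zero: "\<zero>\<^bsub>Hom_module A M N\<^esub> \<in> mod_hom A M N"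
    unfolding Hom_module_simps restrict_mod_hom_iff[OF M] by simp
  have "abelian_group (Hom_module A M N)"
  proof (rule abelian_groupI)
    fix f assume "f \<in> carrier (Hom_module A M N)"
    then have f: "f \<in> mod_hom A M N" by (simp add: Hom_module_simps)
    have "(\<ominus>\<^bsub>A\<^esub> \<one>\<^bsub>A\<^esub>) \<odot>\<^bsub>Hom_module A M N\<^esub> f \<oplus>\<^bsub>Hom_module A M N\<^esub> f = \<zero>\<^bsub>Hom_module A M N\<^esub>"
      using mod_homD(1)[OF f] by (simp add: Hom_module_simps restrict_eq' N.smult_l_minus N.M.l_neg)
    then show "\<exists>g\<in>carrier (Hom_module A M N). g \<oplus>\<^bsub>Hom_module A M N\<^esub> f = \<zero>\<^bsub>Hom_module A M N\<^esub>"
      using smult[OF M.R.a_inv_closed[OF M.R.one_closed] f] by (auto simp: Hom_module_simps(1))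
  qed (use add zero in \<open>simp_all add: Hom_module_simps restrict_eq restrict_eq' N.M.a_ac mod_homD(1)[of _ A M N]\<close>)
  then show ?thesis
    using smult
    by (intro moduleI)
      (simp_all add: M.R.cring_axioms Hom_module_simps restrict_eq restrict_eq'
        N.smult_l_distr N.smult_r_distr N.smult_assoc1 mod_homD(1)[of _ A M N])
qed

lemma submodule_cocycles:
  assumes "cring A" "module A M"
    and \<delta>: "\<delta> i \<in> mod_hom A (free_module A (b (Suc i))) (free_module A (b i))"
  shows "submodule (cocycles A b \<delta> M i) A (Hom_module A (free_module A (b i)) M)"
    (is "submodule ?Z A ?H")
proof -
  interpret M: module A M by fact
  have H: "module A ?H" by (rule module_Hom_module[OF module_free_module[OF assms(1)] assms(2)])
  interpret H: module A ?H by fact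
  note d = mod_homD(1)[OF \<delta>]
  show ?thesis
    unfolding submodule_iff[OF H]
  proof (intro conjI ballI)
    show "\<zero>\<^bsub>?H\<^esub> \<in> ?Z" using H.zero_closed d by (simp add: cocycles_def Hom_module_simps)
  next
    fix f g assume "f \<in> ?Z" "g \<in> ?Z"
    then show "f \<oplus>\<^bsub>?H\<^esub> g \<in> ?Z"
      using H.a_closed[of f g] d by (simp add: cocycles_def Hom_module_simps)
  next
    fix a f assume "a \<in> carrier A" "f \<in> ?Z"
    then show "a \<odot>\<^bsub>?H\<^esub> f \<in> ?Z"
      using H.smult_closed[of a f] d by (simp add: cocycles_def Hom_module_simps)
  qed (simp add: cocycles_def Hom_module_simps)
qed

definition multiples :: "('a, 'm, 'c) module_scheme \<Rightarrow> 'a \<Rightarrow> 'm set" where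
  "multiples M f = {f \<odot>\<^bsub>M\<^esub> y | y. y \<in> carrier M}"

definition module_colon :: "('a, 'm, 'c) module_scheme \<Rightarrow> 'm set \<Rightarrow> 'a set \<Rightarrow> 'm set" where
  "module_colon M N J = {x \<in> carrier M. \<forall>a\<in>J. a \<odot>\<^bsub>M\<^esub> x \<in> N}"

lemma smult_commute:
  assumes "module A M" "a \<in> carrier A" "b \<in> carrier A" "x \<in> carrier M"
  shows "a \<odot>\<^bsub>M\<^esub> (b \<odot>\<^bsub>M\<^esub> x) = b \<odot>\<^bsub>M\<^esub> (a \<odot>\<^bsub>M\<^esub> x)"
proof -
  interpret module A M by fact
  show ?thesis using assms by (simp add: smult_assoc1[symmetric] R.m_comm)
qed

lemma submodule_multiples:
  assumes "module A M" "f \<in> carrier A"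
  shows "submodule (multiples M f) A M"
proof -
  interpret module A M by fact
  show ?thesis
    unfolding submodule_iff[OF assms(1)]
  proof (intro conjI ballI)
    show "multiples M f \<subseteq> carrier M" "\<zero>\<^bsub>M\<^esub> \<in> multiples M f"
      using assms(2) unfolding multiples_def by (auto intro!: exI[of _ "\<zero>\<^bsub>M\<^esub>"])
    fix x y a assume "x \<in> multiples M f"
    then obtain x' where x: "x' \<in> carrier M" "x = f \<odot>\<^bsub>M\<^esub> x'" unfolding multiples_def by blast
    show "a \<odot>\<^bsub>M\<^esub> x \<in> multiples M f" if "a \<in> carrier A"
      using x that smult_commute[OF assms(1), of a f x'] assms(2) unfolding multiples_def by auto
    assume "y \<in> multiples M f"
    then obtain y' where y: "y' \<in> carrier M" "y = f \<odot>\<^bsub>M\<^esub> y'" unfolding multiples_def by blast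
    show "x \<oplus>\<^bsub>M\<^esub> y \<in> multiples M f"
      unfolding multiples_def x(2) y(2)
      by (intro CollectI exI[of _ "x' \<oplus>\<^bsub>M\<^esub> y'"] conjI smult_r_distr[symmetric] assms(2) x(1) y(1) M.a_closed)
  qed
qed

lemma submodule_module_colon:
  assumes "module A M" "submodule N A M" "J \<subseteq> carrier A"
  shows "submodule (module_colon M N J) A M"
proof -
  interpret module A M by fact
  note N = submoduleD[OF assms(1,2)]
  show ?thesis
    unfolding submodule_iff[OF assms(1)]
  proof (intro conjI ballI)
    fix a x assume a: "a \<in> carrier A" and x: "x \<in> module_colon M N J"
    then have "b \<odot>\<^bsub>M\<^esub> (a \<odot>\<^bsub>M\<^esub> x) \<in> N" if "b \<in> J" for b
      using that N(4)[OF a, of "b \<odot>\<^bsub>M\<^esub> x"] smult_commute[OF assms(1), of a b x] assms(3)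
      unfolding module_colon_def by auto
    then show "a \<odot>\<^bsub>M\<^esub> x \<in> module_colon M N J" using a x unfolding module_colon_def by auto
  qed (use assms(3) N(2,3) in \<open>auto simp: module_colon_def smult_r_distr subset_iff\<close>)
qed

lemma multiples_subset_module_colon:
  assumes "module A M" "f \<in> carrier A" "J \<subseteq> carrier A"
  shows "multiples M f \<subseteq> module_colon M (multiples M f) J"
  using submoduleD(1,4)[OF assms(1) submodule_multiples[OF assms(1,2)]] assms(3)
  unfolding module_colon_def by blast

lemma fin_gen_cyclic:
  assumes "cring A" "ideal J A"
  shows "fin_gen_module A (quot_module (self_module A) J)"
proof -
  interpret cring A by fact
  note M = module_self_module[OF assms(1)]
  have J: "submodule J A (self_module A)" using assms by (simp add: ideal_iff_submodule)
  note N = module_quot_module[OF M J]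
  let ?g = "J +>\<^bsub>self_module A\<^esub> \<one>\<^bsub>A\<^esub>"
  have g: "{?g} \<subseteq> carrier (quot_module (self_module A) J)"
    unfolding quot_module_carrier_iff[THEN eqTrueI] by (auto simp: quot_module_carrier_iff self_module_def)
  note span = submodule_mod_span[OF N g]
  have "J +>\<^bsub>self_module A\<^esub> a \<in> mod_span A (quot_module (self_module A) J) {?g}" if "a \<in> carrier A" for a
    using submoduleD(4)[OF N span(1) that, of ?g] span(2) quot_module_smult[OF M J that, of "\<one>\<^bsub>A\<^esub>"] that
    by (simp add: self_module_def)
  then have "carrier (quot_module (self_module A) J) \<subseteq> mod_span A (quot_module (self_module A) J) {?g}"
    by (auto simp: quot_module_carrier_iff self_module_def)
  then show ?thesis
    unfolding fin_gen_module_def using N g submoduleD(1)[OF N span(1)] by blast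
qed

text \<open>This is the isomorphism \<open>Ext\<^sup>1(A/J, M) \<cong> (fM : J)/fM\<close> for \<open>f \<in> J\<close> regular on \<open>M\<close>, computed in an
  arbitrary resolution. Let \<open>Z\<close> be the kernel of the augmentation \<open>F\<^sub>0 \<rightarrow> A/J\<close>. The cocycles are the
  linear maps \<open>\<phi> : Z \<rightarrow> M\<close>, and the coboundaries are those that extend to \<open>F\<^sub>0\<close>. If \<open>e \<in> F\<^sub>0\<close> maps to \<open>1\<close>,
  then \<open>f e \<in> Z\<close>, and the isomorphism is evaluation at \<open>f e\<close>:

  \<^item> \<open>a \<phi>(f e) = f \<phi>(a e)\<close> for \<open>a \<in> J\<close>, so the value lies in \<open>fM : J\<close>;
  \<^item> if \<open>\<phi>(f e) = f y\<close>, then \<open>\<phi>\<close> extends to \<open>F\<^sub>0 = Z + A e\<close> by \<open>e \<mapsto> y\<close>, because \<open>f\<close> is regular;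
  \<^item> with \<open>L : F\<^sub>0 \<rightarrow> A\<close> linear lifting the augmentation, \<open>z \<mapsto> L(z) x / f\<close> is a cocycle for every \<open>x\<close> in
    \<open>fM : J\<close>, and its value at \<open>f e\<close> is \<open>L(e) x \<equiv> x\<close> modulo \<open>fM\<close>.

  In the proof \<open>Z\<close> is the image of the differential \<open>\<delta>\<^sub>0\<close>, and \<open>w\<close> with \<open>\<delta>\<^sub>0 w = f e\<close> stands for \<open>f e\<close>.\<close>

lemma Ext_cyclic_length:
  assumes A: "cring A" "noetherian_ring A" and M: "module A M"
    and J: "ideal J A" and f: "f \<in> J" and reg: "\<And>y. y \<in> carrier M \<Longrightarrow> f \<odot>\<^bsub>M\<^esub> y = \<zero>\<^bsub>M\<^esub> \<Longrightarrow> y = \<zero>\<^bsub>M\<^esub>"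
  shows "mod_length A (Ext_module A 1 (quot_module (self_module A) J) M)
    = interval_length A M (multiples M f) (module_colon M (multiples M f) J)"
proof -
  interpret M: module A M by fact
  define S where "S = self_module A"
  have S_simps: "carrier S = carrier A" "\<zero>\<^bsub>S\<^esub> = \<zero>\<^bsub>A\<^esub>" "\<And>a b. a \<oplus>\<^bsub>S\<^esub> b = a \<oplus>\<^bsub>A\<^esub> b" "\<And>a b. a \<odot>\<^bsub>S\<^esub> b = a \<otimes>\<^bsub>A\<^esub> b"
    "\<And>a b. a \<ominus>\<^bsub>S\<^esub> b = a \<ominus>\<^bsub>A\<^esub> b"
    by (simp_all add: S_def self_module_def a_minus_def a_inv_def m_inv_def)
  have S: "module A S" unfolding S_def by (rule module_self_module[OF A(1)])
  have JS: "submodule J A S" unfolding S_def using A(1) J by (simp add: ideal_iff_submodule)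
  note JD = submoduleD[OF S JS, unfolded S_simps]
  have Jc: "J \<subseteq> carrier A" and fc: "f \<in> carrier A" using JD(1) f by auto
  define N where "N = quot_module S J"
  have N: "module A N" unfolding N_def by (rule module_quot_module[OF S JS])
  have "fin_gen_module A N" unfolding N_def S_def by (rule fin_gen_cyclic[OF A(1) J])
  then obtain F where "free_resolution A N F" using free_resolution_exists[OF A(2)] by blast
  then have "free_resolution A N (SOME F. free_resolution A N F)" by (rule someI)
  then obtain b \<delta> \<epsilon> where some: "(SOME F. free_resolution A N F) = (b, \<delta>, \<epsilon>)"
    and res: "free_resolution A N (b, \<delta>, \<epsilon>)" by (metis prod_cases3)
  define F0 where "F0 = free_module A (b 0)"
  define F1 where "F1 = free_module A (b (Suc 0))"
  have F0: "module A F0" and F1: "module A F1" unfolding F0_def F1_def by (rule module_free_module[OF A(1)])+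
  interpret F0: module A F0 by fact
  interpret F1: module A F1 by fact
  have \<epsilon>: "\<epsilon> \<in> mod_hom A F0 N" and d: "\<And>i. \<delta> i \<in> mod_hom A (free_module A (b (Suc i))) (free_module A (b i))"
    and onto: "\<epsilon> ` carrier F0 = carrier N"
    and exact0: "{v \<in> carrier F0. \<epsilon> v = \<zero>\<^bsub>N\<^esub>} = \<delta> 0 ` carrier F1"
    and exact1: "{v \<in> carrier F1. \<delta> 0 v = \<zero>\<^bsub>F0\<^esub>} = \<delta> (Suc 0) ` carrier (free_module A (b (Suc (Suc 0))))"
    using res unfolding free_resolution_def F0_def F1_def by (auto simp: numeral_2_eq_2)
  have d0: "\<delta> 0 \<in> mod_hom A F1 F0" using d[of 0] unfolding F0_def F1_def .
  note d0D = mod_homD[OF d0] and d0_minus = mod_hom_minus[OF F1 F0 d0]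
  define V where "V = (Hom_module A F1 M)\<lparr>carrier := cocycles A b \<delta> M (Suc 0)\<rparr>"
  have V_simps: "carrier V = cocycles A b \<delta> M (Suc 0)" "\<zero>\<^bsub>V\<^esub> = (\<lambda>x\<in>carrier F1. \<zero>\<^bsub>M\<^esub>)"
    "\<And>g h. g \<oplus>\<^bsub>V\<^esub> h = (\<lambda>x\<in>carrier F1. g x \<oplus>\<^bsub>M\<^esub> h x)" "\<And>a g. a \<odot>\<^bsub>V\<^esub> g = (\<lambda>x\<in>carrier F1. a \<odot>\<^bsub>M\<^esub> g x)"
    by (simp_all add: V_def Hom_module_simps)
  have V: "module A V"
    unfolding V_def
    using submodule.submodule_is_module[OF submodule_cocycles[where b = b and \<delta> = \<delta> and i = "Suc 0", OF A(1) M d] module_Hom_module[OF F1 M, unfolded F1_def]]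
    by (simp add: F1_def)
  interpret V: module A V by fact
  define B where "B = coboundaries A b \<delta> M (Suc 0)"
  have Ext: "Ext_module A 1 (quot_module (self_module A) J) M = quot_module V B"
    using some unfolding Ext_module_def N_def S_def V_def B_def F1_def by simp

  \<comment> \<open>A lift of the augmentation to a linear functional.\<close>
  have "\<exists>a. a \<in> carrier A \<and> \<epsilon> (basis_vec A (b 0) i) = J +>\<^bsub>S\<^esub> a" for i
    using mod_homD(1)[OF \<epsilon>, of "basis_vec A (b 0) i"] basis_vec_closed[OF A(1), of "b 0" i]
    unfolding N_def F0_def quot_module_carrier_iff S_simps by blast
  then obtain c where c: "\<And>i. c i \<in> carrier A" "\<And>i. \<epsilon> (basis_vec A (b 0) i) = J +>\<^bsub>S\<^esub> c i" by metis
  define L where "L = (\<lambda>v\<in>carrier F0. lincomb S (b 0) v c)"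
  have L: "L \<in> mod_hom A F0 S"
    unfolding L_def F0_def by (rule lincomb_mod_hom[OF S]) (simp add: S_simps c)
  note LD = mod_homD[OF L, unfolded S_simps] 
  have proj: "(\<lambda>a\<in>carrier S. J +>\<^bsub>S\<^esub> a) \<in> mod_hom A S N"
    unfolding restrict_mod_hom_iff[OF S] N_def
    using quot_module_add[OF S JS] quot_module_smult[OF S JS] by (auto simp: quot_module_carrier_iff)
  have \<epsilon>_eq: "\<epsilon> v = J +>\<^bsub>S\<^esub> L v" if v: "v \<in> carrier F0" for v
  proof -
    have "\<epsilon> v = lincomb N (b 0) v (\<lambda>i. \<epsilon> (basis_vec A (b 0) i))"
      using mod_hom_free_module_eq[OF N] \<epsilon> v unfolding F0_def by blast
    also have "\<dots> = lincomb N (b 0) v (\<lambda>i. (\<lambda>a\<in>carrier S. J +>\<^bsub>S\<^esub> a) (c i))"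
      using c by (simp add: S_simps)
    also have "\<dots> = (\<lambda>a\<in>carrier S. J +>\<^bsub>S\<^esub> a) (lincomb S (b 0) v c)"
      using v c by (intro mod_hom_lincomb[OF S N proj, symmetric]) (auto simp: S_simps F0_def free_module_simps)
    also have "\<dots> = J +>\<^bsub>S\<^esub> L v" using v LD(1)[OF v] by (simp add: L_def S_simps)
    finally show ?thesis .
  qed
  have kernel: "L v \<in> J \<longleftrightarrow> v \<in> \<delta> 0 ` carrier F1" if v: "v \<in> carrier F0" for v
  proof -
    have "v \<in> \<delta> 0 ` carrier F1 \<longleftrightarrow> \<epsilon> v = \<zero>\<^bsub>N\<^esub>" using exact0 v by blast
    also have "\<dots> \<longleftrightarrow> L v \<in> J"
      using coset_eq_self_iff[OF S JS] LD(1)[OF v] by (simp add: \<epsilon>_eq[OF v] N_def quot_module_simps S_simps)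
    finally show ?thesis by simp
  qed
  obtain e where e: "e \<in> carrier F0" "\<epsilon> e = J +>\<^bsub>S\<^esub> \<one>\<^bsub>A\<^esub>"
    using onto unfolding N_def by (metis M.R.one_closed S_simps(1) imageE quot_module_carrier_iff)
  have Le: "L e \<in> carrier A" "\<one>\<^bsub>A\<^esub> \<ominus>\<^bsub>A\<^esub> L e \<in> J"
  proof -
    show "L e \<in> carrier A" by (rule LD(1)[OF e(1)])
    then show "\<one>\<^bsub>A\<^esub> \<ominus>\<^bsub>A\<^esub> L e \<in> J"
      using coset_eq_iff[OF S JS, of "\<one>\<^bsub>A\<^esub>" "L e"] \<epsilon>_eq[OF e(1)] e(2) by (simp add: S_simps)
  qed
  have "L (f \<odot>\<^bsub>F0\<^esub> e) \<in> J"
    using LD(3)[OF fc e(1)] JD(4)[OF Le(1) f] Le(1) fc by (simp add: M.R.m_comm)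
  then obtain w where w: "w \<in> carrier F1" "\<delta> 0 w = f \<odot>\<^bsub>F0\<^esub> e"
    using kernel[OF F0.smult_closed[OF fc e(1)]] by auto

  let ?fM = "multiples M f" and ?U = "module_colon M (multiples M f) J"
  have fM: "submodule ?fM A M" by (rule submodule_multiples[OF M fc])
  note fMD = submoduleD[OF M fM]
  have cancel: "x = y" if "x \<in> carrier M" "y \<in> carrier M" "f \<odot>\<^bsub>M\<^esub> x = f \<odot>\<^bsub>M\<^esub> y" for x y
  proof -
    have "f \<odot>\<^bsub>M\<^esub> (x \<ominus>\<^bsub>M\<^esub> y) = f \<odot>\<^bsub>M\<^esub> y \<ominus>\<^bsub>M\<^esub> f \<odot>\<^bsub>M\<^esub> y"
      using that fc by (simp add: M.M.minus_eq M.smult_r_distr M.smult_r_minus)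
    also have "\<dots> = \<zero>\<^bsub>M\<^esub>" using that fc by (simp add: M.M.minus_eq M.M.r_neg)
    finally have "x \<ominus>\<^bsub>M\<^esub> y = \<zero>\<^bsub>M\<^esub>" by (rule reg[OF M.M.minus_closed[OF that(1,2)]])
    then show ?thesis by (rule M.M.eq_if_minus_eq_zero[OF that(1,2)])
  qed
  have Z: "\<phi> \<in> mod_hom A F1 M" "\<And>v. v \<in> carrier F1 \<Longrightarrow> \<delta> 0 v = \<zero>\<^bsub>F0\<^esub> \<Longrightarrow> \<phi> v = \<zero>\<^bsub>M\<^esub>"
    if "\<phi> \<in> carrier V" for \<phi>
  proof -
    from that show "\<phi> \<in> mod_hom A F1 M" unfolding V_simps cocycles_def F1_def by blast
    fix v assume "v \<in> carrier F1" "\<delta> 0 v = \<zero>\<^bsub>F0\<^esub>"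
    then have "v \<in> \<delta> (Suc 0) ` carrier (free_module A (b (Suc (Suc 0))))" using exact1 by blast
    then show "\<phi> v = \<zero>\<^bsub>M\<^esub>" using that unfolding V_simps cocycles_def by blast
  qed
  have Z_eq: "\<phi> u = \<phi> v" if "\<phi> \<in> carrier V" "u \<in> carrier F1" "v \<in> carrier F1" "\<delta> 0 u = \<delta> 0 v" for \<phi> u v
  proof -
    have "\<delta> 0 (u \<ominus>\<^bsub>F1\<^esub> v) = \<zero>\<^bsub>F0\<^esub>"
      using d0_minus[OF that(2,3)] that d0D(1) by (simp add: F0.M.minus_eq F0.M.r_neg)
    then have *: "\<phi> u \<ominus>\<^bsub>M\<^esub> \<phi> v = \<zero>\<^bsub>M\<^esub>"
      using Z(2)[OF that(1), of "u \<ominus>\<^bsub>F1\<^esub> v"] mod_hom_minus[OF F1 M Z(1)] that by simp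
    note D = mod_homD(1)[OF Z(1)[OF that(1)]]
    show ?thesis by (rule M.M.eq_if_minus_eq_zero[OF D[OF that(2)] D[OF that(3)] *])
  qed
  \<comment> \<open>The decomposition of \<open>F\<^sub>0\<close> as the sum of the kernel and \<open>A e\<close>; \<open>L\<close> makes it linear in \<open>v\<close>.\<close>
  have lift: "\<exists>u\<in>carrier F1. \<delta> 0 u = v \<ominus>\<^bsub>F0\<^esub> L v \<odot>\<^bsub>F0\<^esub> e" if v: "v \<in> carrier F0" for v
  proof -
    note Lv = LD(1)[OF v]
    have "L (v \<ominus>\<^bsub>F0\<^esub> L v \<odot>\<^bsub>F0\<^esub> e) = L v \<ominus>\<^bsub>A\<^esub> L v \<otimes>\<^bsub>A\<^esub> L e"
      using mod_hom_minus[OF F0 S L v, unfolded S_simps] LD(3)[OF Lv e(1)] Lv e(1) by simp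
    also have "\<dots> = L v \<otimes>\<^bsub>A\<^esub> (\<one>\<^bsub>A\<^esub> \<ominus>\<^bsub>A\<^esub> L e)"
      using Lv Le(1) by (simp add: M.R.minus_eq M.R.r_distr M.R.r_minus)
    finally have "L (v \<ominus>\<^bsub>F0\<^esub> L v \<odot>\<^bsub>F0\<^esub> e) \<in> J" using JD(4)[OF Lv Le(2)] by simp
    then show ?thesis using kernel[of "v \<ominus>\<^bsub>F0\<^esub> L v \<odot>\<^bsub>F0\<^esub> e"] v Lv e(1) by auto
  qed
  have into: "\<phi> w \<in> ?U" if \<phi>: "\<phi> \<in> carrier V" for \<phi>
  proof -
    note D = mod_homD[OF Z(1)[OF \<phi>]]
    have "a \<odot>\<^bsub>M\<^esub> \<phi> w \<in> ?fM" if a: "a \<in> J" for a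
    proof -
      have ac: "a \<in> carrier A" using a Jc by blast
      have "L (a \<odot>\<^bsub>F0\<^esub> e) \<in> J"
        using LD(3)[OF ac e(1)] JD(4)[OF Le(1) a] Le(1) ac by (simp add: M.R.m_comm)
      then obtain u where u: "u \<in> carrier F1" "a \<odot>\<^bsub>F0\<^esub> e = \<delta> 0 u"
        using kernel[OF F0.smult_closed[OF ac e(1)]] by auto
      have "\<delta> 0 (a \<odot>\<^bsub>F1\<^esub> w) = a \<odot>\<^bsub>F0\<^esub> (f \<odot>\<^bsub>F0\<^esub> e)" using d0D(3)[OF ac w(1)] w(2) by simp
      also have "\<dots> = f \<odot>\<^bsub>F0\<^esub> (a \<odot>\<^bsub>F0\<^esub> e)" by (rule smult_commute[OF F0 ac fc e(1)])
      also have "\<dots> = \<delta> 0 (f \<odot>\<^bsub>F1\<^esub> u)" using d0D(3)[OF fc u(1)] u(2) by simp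
      finally have "\<phi> (a \<odot>\<^bsub>F1\<^esub> w) = \<phi> (f \<odot>\<^bsub>F1\<^esub> u)"
        using ac fc w(1) u(1) by (intro Z_eq[OF \<phi>]) auto
      then have "a \<odot>\<^bsub>M\<^esub> \<phi> w = f \<odot>\<^bsub>M\<^esub> \<phi> u" using D(3)[OF ac w(1)] D(3)[OF fc u(1)] by simp
      then show ?thesis unfolding multiples_def using D(1)[OF u(1)] by blast
    qed
    then show ?thesis unfolding module_colon_def using D(1)[OF w(1)] by blast
  qed
  have onto': "\<exists>\<phi>\<in>carrier V. x \<ominus>\<^bsub>M\<^esub> \<phi> w \<in> ?fM" if x: "x \<in> ?U" for x
  proof -
    have xc: "x \<in> carrier M" and xJ: "\<And>a. a \<in> J \<Longrightarrow> a \<odot>\<^bsub>M\<^esub> x \<in> ?fM"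
      using x unfolding module_colon_def by auto
    have "L (\<delta> 0 t) \<in> J" if "t \<in> carrier F1" for t using kernel[OF d0D(1)[OF that]] that by blast
    then have "\<exists>y\<in>carrier M. f \<odot>\<^bsub>M\<^esub> y = L (\<delta> 0 t) \<odot>\<^bsub>M\<^esub> x" if "t \<in> carrier F1" for t
      using xJ[of "L (\<delta> 0 t)"] that unfolding multiples_def by force
    \<comment> \<open>\<open>h t\<close> is \<open>L(\<delta>\<^sub>0 t) x / f\<close>; regularity of \<open>f\<close> makes it linear.\<close>
    then obtain h where h: "\<And>t. t \<in> carrier F1 \<Longrightarrow> h t \<in> carrier M"
      "\<And>t. t \<in> carrier F1 \<Longrightarrow> f \<odot>\<^bsub>M\<^esub> h t = L (\<delta> 0 t) \<odot>\<^bsub>M\<^esub> x" by metis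
    have Lc: "L (\<delta> 0 t) \<in> carrier A" if "t \<in> carrier F1" for t using LD(1) d0D(1) that by blast
    let ?\<phi> = "\<lambda>t\<in>carrier F1. h t"
    have "?\<phi> \<in> mod_hom A F1 M"
      unfolding restrict_mod_hom_iff[OF F1]
    proof (intro conjI ballI)
      fix s t assume st: "s \<in> carrier F1" "t \<in> carrier F1"
      show "h (s \<oplus>\<^bsub>F1\<^esub> t) = h s \<oplus>\<^bsub>M\<^esub> h t"
        by (rule cancel) (use st h Lc xc fc d0D LD in \<open>simp_all add: M.smult_l_distr M.smult_r_distr\<close>)
    next
      fix a t assume at: "a \<in> carrier A" "t \<in> carrier F1"
      show "h (a \<odot>\<^bsub>F1\<^esub> t) = a \<odot>\<^bsub>M\<^esub> h t"
        by (rule cancel)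
          (use at h Lc xc fc d0D LD in \<open>simp_all add: M.smult_assoc1 smult_commute[OF M fc]\<close>)
    qed (use h in auto)
    moreover have "h t = \<zero>\<^bsub>M\<^esub>" if "t \<in> carrier F1" "\<delta> 0 t = \<zero>\<^bsub>F0\<^esub>" for t
      using reg[OF h(1)[OF that(1)]] h(2)[OF that(1)] that(2) mod_hom_zero[OF F0 S L, unfolded S_simps] xc by simp
    then have "\<forall>v\<in>carrier (free_module A (b (Suc (Suc 0)))). ?\<phi> (\<delta> (Suc 0) v) = \<zero>\<^bsub>M\<^esub>"
      using exact1 by auto
    ultimately have \<phi>: "?\<phi> \<in> carrier V" unfolding V_simps cocycles_def F1_def by auto
    have "h w = L e \<odot>\<^bsub>M\<^esub> x"
      by (rule cancel) (use h w LD(3)[OF fc e(1)] Le(1) xc fc in \<open>simp_all add: M.smult_assoc1\<close>)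
    then have "x \<ominus>\<^bsub>M\<^esub> ?\<phi> w = (\<one>\<^bsub>A\<^esub> \<ominus>\<^bsub>A\<^esub> L e) \<odot>\<^bsub>M\<^esub> x"
      using w(1) xc Le(1) by (simp add: M.R.minus_eq M.M.minus_eq M.smult_l_distr M.smult_l_minus)
    then show ?thesis using xJ[OF Le(2)] \<phi> by (metis (no_types, lifting))
  qed
  have B: "B = {\<phi> \<in> carrier V. \<phi> w \<in> ?fM}"
  proof (intro subset_antisym subsetI)
    fix \<phi> assume "\<phi> \<in> B"
    then obtain g where g: "g \<in> mod_hom A F0 M" and \<phi>: "\<phi> = compose (carrier F1) g (\<delta> 0)"
      unfolding B_def F0_def F1_def by auto
    note gD = mod_homD[OF g]
    have "\<phi> \<in> mod_hom A F1 M"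
      unfolding \<phi> compose_def restrict_mod_hom_iff[OF F1] using d0D gD by simp
    moreover have "\<phi> (\<delta> (Suc 0) v) = \<zero>\<^bsub>M\<^esub>" if "v \<in> carrier (free_module A (b (Suc (Suc 0))))" for v
    proof -
      have "\<delta> (Suc 0) v \<in> carrier F1" "\<delta> 0 (\<delta> (Suc 0) v) = \<zero>\<^bsub>F0\<^esub>" using exact1 that by auto
      then show ?thesis using mod_hom_zero[OF F0 M g] by (simp add: \<phi> compose_def)
    qed
    ultimately have "\<phi> \<in> carrier V" unfolding V_simps cocycles_def F1_def by auto
    moreover have "\<phi> w = f \<odot>\<^bsub>M\<^esub> g e" using w gD(3)[OF fc e(1)] by (simp add: \<phi> compose_def)
    then have "\<phi> w \<in> ?fM" using gD(1)[OF e(1)] unfolding multiples_def by blast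
    ultimately show "\<phi> \<in> {\<phi> \<in> carrier V. \<phi> w \<in> ?fM}" by blast
  next
    fix \<phi> assume "\<phi> \<in> {\<phi> \<in> carrier V. \<phi> w \<in> ?fM}"
    then obtain y where \<phi>: "\<phi> \<in> carrier V" and y: "y \<in> carrier M" "\<phi> w = f \<odot>\<^bsub>M\<^esub> y"
      unfolding multiples_def by blast
    note D = mod_homD[OF Z(1)[OF \<phi>]]
    obtain u where u: "\<And>v. v \<in> carrier F0 \<Longrightarrow> u v \<in> carrier F1"
      "\<And>v. v \<in> carrier F0 \<Longrightarrow> \<delta> 0 (u v) = v \<ominus>\<^bsub>F0\<^esub> L v \<odot>\<^bsub>F0\<^esub> e" using lift by metis
    \<comment> \<open>The extension with \<open>e \<mapsto> y\<close>.\<close>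
    let ?g = "\<lambda>v\<in>carrier F0. \<phi> (u v) \<oplus>\<^bsub>M\<^esub> L v \<odot>\<^bsub>M\<^esub> y"
    have g: "?g \<in> mod_hom A F0 M"
      unfolding restrict_mod_hom_iff[OF F0]
    proof (intro conjI ballI)
      fix v v' assume v: "v \<in> carrier F0" "v' \<in> carrier F0"
      have "\<phi> (u (v \<oplus>\<^bsub>F0\<^esub> v')) = \<phi> (u v \<oplus>\<^bsub>F1\<^esub> u v')"
        by (rule Z_eq[OF \<phi>]) (use v u LD e(1) d0D in \<open>simp_all add: F0.M.minus_eq F0.smult_l_distr F0.M.minus_add F0.M.a_ac\<close>)
      then show "\<phi> (u (v \<oplus>\<^bsub>F0\<^esub> v')) \<oplus>\<^bsub>M\<^esub> L (v \<oplus>\<^bsub>F0\<^esub> v') \<odot>\<^bsub>M\<^esub> y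
          = (\<phi> (u v) \<oplus>\<^bsub>M\<^esub> L v \<odot>\<^bsub>M\<^esub> y) \<oplus>\<^bsub>M\<^esub> (\<phi> (u v') \<oplus>\<^bsub>M\<^esub> L v' \<odot>\<^bsub>M\<^esub> y)"
        using v u LD D y by (simp add: M.smult_l_distr M.M.a_ac)
    next
      fix a v assume v: "a \<in> carrier A" "v \<in> carrier F0"
      have "\<phi> (u (a \<odot>\<^bsub>F0\<^esub> v)) = \<phi> (a \<odot>\<^bsub>F1\<^esub> u v)"
        by (rule Z_eq[OF \<phi>]) (use v u LD e(1) d0D in \<open>simp_all add: F0.M.minus_eq F0.smult_assoc1 F0.smult_r_distr F0.smult_r_minus\<close>)
      then show "\<phi> (u (a \<odot>\<^bsub>F0\<^esub> v)) \<oplus>\<^bsub>M\<^esub> L (a \<odot>\<^bsub>F0\<^esub> v) \<odot>\<^bsub>M\<^esub> y = a \<odot>\<^bsub>M\<^esub> (\<phi> (u v) \<oplus>\<^bsub>M\<^esub> L v \<odot>\<^bsub>M\<^esub> y)"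
        using v u LD D y by (simp add: M.smult_assoc1 M.smult_r_distr)
    qed (use u LD D y in auto)
    have "\<phi> t = ?g (\<delta> 0 t)" if t: "t \<in> carrier F1" for t
    proof -
      let ?v = "\<delta> 0 t"
      have v: "?v \<in> carrier F0" "u ?v \<in> carrier F1" "L ?v \<in> carrier A" using d0D(1)[OF t] u(1) LD(1) by auto
      have split: "L ?v \<odot>\<^bsub>F0\<^esub> e \<oplus>\<^bsub>F0\<^esub> (?v \<ominus>\<^bsub>F0\<^esub> L ?v \<odot>\<^bsub>F0\<^esub> e) = ?v"
        using v e(1) by (simp add: F0.M.minus_eq F0.M.a_lcomm F0.M.r_neg)
      have "\<delta> 0 (L ?v \<odot>\<^bsub>F1\<^esub> w \<oplus>\<^bsub>F1\<^esub> f \<odot>\<^bsub>F1\<^esub> u ?v)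
          = f \<odot>\<^bsub>F0\<^esub> (L ?v \<odot>\<^bsub>F0\<^esub> e \<oplus>\<^bsub>F0\<^esub> (?v \<ominus>\<^bsub>F0\<^esub> L ?v \<odot>\<^bsub>F0\<^esub> e))"
        using v w fc e(1) u(2)[OF v(1)] d0D(2,3) smult_commute[OF F0 v(3) fc e(1)]
        by (simp add: F0.smult_r_distr)
      then have "\<phi> (f \<odot>\<^bsub>F1\<^esub> t) = \<phi> (L ?v \<odot>\<^bsub>F1\<^esub> w \<oplus>\<^bsub>F1\<^esub> f \<odot>\<^bsub>F1\<^esub> u ?v)"
        using v w(1) fc t d0D(3)[OF fc t] split by (intro Z_eq[OF \<phi>]) simp_all
      then have "f \<odot>\<^bsub>M\<^esub> \<phi> t = L ?v \<odot>\<^bsub>M\<^esub> (f \<odot>\<^bsub>M\<^esub> y) \<oplus>\<^bsub>M\<^esub> f \<odot>\<^bsub>M\<^esub> \<phi> (u ?v)"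
        using D v w(1) fc t y(2) by simp
      also have "\<dots> = f \<odot>\<^bsub>M\<^esub> (\<phi> (u ?v) \<oplus>\<^bsub>M\<^esub> L ?v \<odot>\<^bsub>M\<^esub> y)"
        using v fc y(1) D(1)[OF v(2)] smult_commute[OF M fc v(3) y(1)] by (simp add: M.smult_r_distr M.M.a_comm)
      finally have "\<phi> t = \<phi> (u ?v) \<oplus>\<^bsub>M\<^esub> L ?v \<odot>\<^bsub>M\<^esub> y"
        using D(1)[OF t] D(1)[OF v(2)] v(3) y(1) by (intro cancel[OF D(1)[OF t]]) auto
      then show ?thesis using v(1) by simp
    qed
    moreover have "\<phi> \<in> extensional (carrier F1)" using Z(1)[OF \<phi>] by (simp add: mod_hom_def PiE_iff)
    ultimately have "\<phi> = compose (carrier F1) ?g (\<delta> 0)"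
      by (intro extensionalityI[of _ "carrier F1"]) (simp_all add: compose_def)
    then show "\<phi> \<in> B" using g unfolding B_def F0_def F1_def by auto
  qed
  have "submodule B A V"
    unfolding submodule_iff[OF V]
  proof (intro conjI ballI)
    show "\<zero>\<^bsub>V\<^esub> \<in> B" using V.M.zero_closed w(1) fMD(2) unfolding B by (simp add: V_simps(2))
  next
    fix g h assume "g \<in> B" "h \<in> B"
    then show "g \<oplus>\<^bsub>V\<^esub> h \<in> B"
      using V.M.a_closed[of g h] w(1) fMD(3) unfolding B by (simp add: V_simps(3))
  next
    fix a g assume "a \<in> carrier A" "g \<in> B"
    then show "a \<odot>\<^bsub>V\<^esub> g \<in> B"
      using V.smult_closed[of a g] w(1) fMD(4) unfolding B by (simp add: V_simps(4))
  qed (auto simp: B)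
  then have "mod_length A (quot_module V B) = interval_length A V B (carrier V)"
    by (rule mod_length_quot_module[OF V])
  also have "\<dots> = interval_length A M ?fM ?U"
  proof (rule interval_length_transfer[OF V M, where \<rho> = "\<lambda>a. a" and \<Phi> = "\<lambda>\<phi>. \<phi> w"])
  qed (use w B into onto' fM submodule_module_colon[OF M fM Jc] multiples_subset_module_colon[OF M fc Jc]
      in \<open>simp_all add: V_simps\<close>)
  finally show ?thesis unfolding Ext .
qed

section \<open>Finiteness of length\<close>

lemma (in cring) adjoin_to_ideal:
  assumes "ideal J R" "a \<in> carrier R"
  obtains E where "ideal E R" "J \<subseteq> E" "a \<in> E" "\<And>x. x \<in> E \<Longrightarrow> \<exists>j\<in>J. \<exists>r\<in>carrier R. x = j \<oplus> r \<otimes> a"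
proof
  interpret J: ideal J R by fact
  interpret P: ideal "PIdl a" R by (rule cgenideal_ideal[OF assms(2)])
  show "ideal (set_add R J (PIdl a)) R" by (rule add_ideals[OF assms(1) P.ideal_axioms])
  have "j = j \<oplus> \<zero>" if "j \<in> J" for j using that J.a_Hcarr by simp
  then show "J \<subseteq> set_add R J (PIdl a)" unfolding set_add_def' using P.zero_closed by fast
  have "a = \<zero> \<oplus> a" using assms(2) by simp
  then show "a \<in> set_add R J (PIdl a)" unfolding set_add_def' using J.zero_closed cgenideal_self[OF assms(2)] by fast
  show "\<exists>j\<in>J. \<exists>r\<in>carrier R. x = j \<oplus> r \<otimes> a" if "x \<in> set_add R J (PIdl a)" for x
    using that unfolding set_add_def' cgenideal_def by blast
qed

lemma maximalideal_inverse:
  assumes "cring A" "maximalideal \<nn> A" "a \<in> carrier A" "a \<notin> \<nn>"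
  shows "\<exists>m\<in>\<nn>. \<exists>b\<in>carrier A. \<one>\<^bsub>A\<^esub> = m \<oplus>\<^bsub>A\<^esub> b \<otimes>\<^bsub>A\<^esub> a"
proof -
  interpret cring A by fact
  interpret maximalideal \<nn> A by fact
  obtain E where E: "ideal E A" "\<nn> \<subseteq> E" "a \<in> E"
    "\<And>x. x \<in> E \<Longrightarrow> \<exists>j\<in>\<nn>. \<exists>r\<in>carrier A. x = j \<oplus>\<^bsub>A\<^esub> r \<otimes>\<^bsub>A\<^esub> a"
    using adjoin_to_ideal[OF ideal_axioms assms(3)] by metis
  have "E \<subseteq> carrier A" using additive_subgroup.a_subset[OF ideal.axioms(1)[OF E(1)]] .
  then have "E = carrier A" using I_maximal[OF E(1,2)] E(3) assms(4) by blast
  then show ?thesis using E(4)[of "\<one>\<^bsub>A\<^esub>"] by blast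
qed

text \<open>The dimension bound for vector spaces over the residue field, as a rank function on submodules. One
  more generator \<open>v\<close> adds one to the rank of the submodules not contained in the span \<open>W\<close> of the others.
  Strict monotonicity amounts to this: if \<open>C \<subseteq> D\<close> have the same intersection with \<open>W\<close> and \<open>C\<close> is not
  contained in \<open>W\<close>, then \<open>C = D\<close>. Indeed \<open>C\<close> then contains an element congruent to \<open>v\<close> modulo \<open>W\<close>, by which
  each element of \<open>D\<close> can be moved into \<open>D \<inter> W = C \<inter> W\<close>.\<close>

lemma residue_rank_function:
  fixes A :: "('a, 'q) ring_scheme" and M :: "('a, 'm, 'c) module_scheme"
  assumes M: "module A M" and \<nn>: "maximalideal \<nn> A" and L: "submodule L A M"
    and "finite S" "S \<subseteq> carrier M" "\<forall>a\<in>\<nn>. \<forall>s\<in>S. a \<odot>\<^bsub>M\<^esub> s \<in> L"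
  shows "\<exists>h :: 'm set \<Rightarrow> nat. (\<forall>C \<in> submodules_between A M L (mod_span A M (L \<union> S)). h C \<le> card S) \<and>
    (\<forall>C \<in> submodules_between A M L (mod_span A M (L \<union> S)).
      \<forall>D \<in> submodules_between A M L (mod_span A M (L \<union> S)). C \<subset> D \<longrightarrow> h C < h D)"
  using assms(4-)
proof (induction S rule: finite_induct)
  case empty
  have "mod_span A M (L \<union> {}) \<subseteq> L" by (rule mod_span_least[OF L]) simp
  then have "C = L" if "C \<in> submodules_between A M L (mod_span A M (L \<union> {}))" for C
    using that unfolding submodules_between_def by blast
  then have "\<not> C \<subset> D" if "C \<in> submodules_between A M L (mod_span A M (L \<union> {}))"
    "D \<in> submodules_between A M L (mod_span A M (L \<union> {}))" for C D
    using that by blast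
  then show ?case by (intro exI[of _ "\<lambda>_. 0"]) blast
next
  case (insert v S)
  interpret module A M by fact
  interpret n: maximalideal \<nn> A by fact
  have v: "v \<in> carrier M" and S: "S \<subseteq> carrier M" and nv: "\<And>a. a \<in> \<nn> \<Longrightarrow> a \<odot>\<^bsub>M\<^esub> v \<in> L"
    using insert.prems by auto
  have LS: "L \<union> S \<subseteq> carrier M" using S submoduleD(1)[OF M L] by blast
  define W where "W = mod_span A M (L \<union> S)"
  define W' where "W' = mod_span A M (L \<union> insert v S)"
  have W: "submodule W A M" "L \<subseteq> W" using submodule_mod_span[OF M LS] unfolding W_def by auto
  note WD = submoduleD[OF M W(1)]
  have "\<exists>h :: 'm set \<Rightarrow> nat. (\<forall>C \<in> submodules_between A M L W. h C \<le> card S) \<and>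
    (\<forall>C \<in> submodules_between A M L W. \<forall>D \<in> submodules_between A M L W. C \<subset> D \<longrightarrow> h C < h D)"
    unfolding W_def using insert.prems by (intro insert.IH[OF S]) blast
  then obtain h :: "'m set \<Rightarrow> nat" where "\<forall>C \<in> submodules_between A M L W. h C \<le> card S"
    "\<forall>C \<in> submodules_between A M L W. \<forall>D \<in> submodules_between A M L W. C \<subset> D \<longrightarrow> h C < h D"
    by (elim exE conjE) (rule that)
  note h = this[rule_format]
  let ?h = "\<lambda>C. h (C \<inter> W) + (if C \<subseteq> W then 0 else 1 :: nat)"
  have Int: "C \<inter> W \<in> submodules_between A M L W" if "C \<in> submodules_between A M L W'" for C
    using that submodule_Int[OF M _ W(1)] W(2) unfolding submodules_between_def by auto
  have coeff: "\<exists>a\<in>carrier A. x \<ominus>\<^bsub>M\<^esub> a \<odot>\<^bsub>M\<^esub> v \<in> W" if "x \<in> W'" for x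
    using mod_span_insert[OF M v LS] that unfolding W_def W'_def by simp
  have "?h C < ?h D"
    if C: "C \<in> submodules_between A M L W'" and D: "D \<in> submodules_between A M L W'" and CD: "C \<subset> D" for C D
  proof (cases "C \<inter> W \<subset> D \<inter> W")
    case True
    then show ?thesis using h(2)[OF Int[OF C] Int[OF D]] CD by auto
  next
    case False
    then have eq: "C \<inter> W = D \<inter> W" using CD by blast
    have C': "submodule C A M" "L \<subseteq> C" "C \<subseteq> W'" and D': "submodule D A M" "D \<subseteq> W'"
      using C D unfolding submodules_between_def by auto
    note CC = submoduleD[OF M C'(1)] and DD = submoduleD[OF M D'(1)]
    have "C \<subseteq> W"
    proof (rule ccontr)
      assume "\<not> C \<subseteq> W"
      then obtain x where x: "x \<in> C" "x \<notin> W" by blast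
      then obtain a where a: "a \<in> carrier A" "x \<ominus>\<^bsub>M\<^esub> a \<odot>\<^bsub>M\<^esub> v \<in> W" using coeff C' by blast
      have xc: "x \<in> carrier M" using x CC(1) by blast
      have add_back: "(y \<ominus>\<^bsub>M\<^esub> z) \<oplus>\<^bsub>M\<^esub> z = y" if "y \<in> carrier M" "z \<in> carrier M" for y z
        using that by (simp add: M.minus_eq M.a_assoc M.l_neg)
      have "a \<notin> \<nn>"
      proof
        assume "a \<in> \<nn>"
        then have "(x \<ominus>\<^bsub>M\<^esub> a \<odot>\<^bsub>M\<^esub> v) \<oplus>\<^bsub>M\<^esub> a \<odot>\<^bsub>M\<^esub> v \<in> W" using a nv W(2) WD(3) by blast
        then show False using add_back[OF xc] a v x by simp
      qed
      then obtain m b where mb: "m \<in> \<nn>" "b \<in> carrier A" "\<one>\<^bsub>A\<^esub> = m \<oplus>\<^bsub>A\<^esub> b \<otimes>\<^bsub>A\<^esub> a"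
        using maximalideal_inverse[OF R.cring_axioms \<nn> a(1)] by blast
      have mc: "m \<in> carrier A" using mb n.a_Hcarr by blast
      have vx: "v \<ominus>\<^bsub>M\<^esub> b \<odot>\<^bsub>M\<^esub> x \<in> W"
      proof -
        have "v = m \<odot>\<^bsub>M\<^esub> v \<oplus>\<^bsub>M\<^esub> b \<odot>\<^bsub>M\<^esub> (a \<odot>\<^bsub>M\<^esub> v)"
          using smult_l_distr[OF mc _ v, of "b \<otimes>\<^bsub>A\<^esub> a"] mb v a smult_one[OF v]
          by (simp add: smult_assoc1)
        then have "v \<ominus>\<^bsub>M\<^esub> b \<odot>\<^bsub>M\<^esub> x = (m \<odot>\<^bsub>M\<^esub> v \<oplus>\<^bsub>M\<^esub> b \<odot>\<^bsub>M\<^esub> (a \<odot>\<^bsub>M\<^esub> v)) \<ominus>\<^bsub>M\<^esub> b \<odot>\<^bsub>M\<^esub> x" by simp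
        also have "\<dots> = m \<odot>\<^bsub>M\<^esub> v \<ominus>\<^bsub>M\<^esub> b \<odot>\<^bsub>M\<^esub> (x \<ominus>\<^bsub>M\<^esub> a \<odot>\<^bsub>M\<^esub> v)"
          using xc v a(1) mc mb(2)
          by (simp add: M.minus_eq smult_r_distr smult_r_minus M.minus_add M.a_ac)
        also have "\<dots> \<in> W" using nv[OF mb(1)] W(2) a(2) mb(2) WD(4,6) by blast
        finally show ?thesis .
      qed
      have "D \<subseteq> C"
      proof
        fix d assume d: "d \<in> D"
        then obtain c where c: "c \<in> carrier A" "d \<ominus>\<^bsub>M\<^esub> c \<odot>\<^bsub>M\<^esub> v \<in> W" using coeff D' by blast
        have dc: "d \<in> carrier M" using d DD(1) by blast
        have cbx: "c \<odot>\<^bsub>M\<^esub> (b \<odot>\<^bsub>M\<^esub> x) \<in> C" using c mb x CC(4) by blast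
        have "d \<ominus>\<^bsub>M\<^esub> c \<odot>\<^bsub>M\<^esub> (b \<odot>\<^bsub>M\<^esub> x)
          = ((d \<ominus>\<^bsub>M\<^esub> c \<odot>\<^bsub>M\<^esub> v) \<oplus>\<^bsub>M\<^esub> c \<odot>\<^bsub>M\<^esub> v) \<ominus>\<^bsub>M\<^esub> c \<odot>\<^bsub>M\<^esub> (b \<odot>\<^bsub>M\<^esub> x)"
          using add_back[OF dc] c(1) v by simp
        also have "\<dots> = (d \<ominus>\<^bsub>M\<^esub> c \<odot>\<^bsub>M\<^esub> v) \<oplus>\<^bsub>M\<^esub> c \<odot>\<^bsub>M\<^esub> (v \<ominus>\<^bsub>M\<^esub> b \<odot>\<^bsub>M\<^esub> x)"
          using dc c(1) v xc mb(2) by (simp add: M.minus_eq smult_r_distr smult_r_minus M.a_assoc)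
        also have "\<dots> \<in> W" using c vx WD(3,4) by blast
        finally have "d \<ominus>\<^bsub>M\<^esub> c \<odot>\<^bsub>M\<^esub> (b \<odot>\<^bsub>M\<^esub> x) \<in> D \<inter> W" using DD(6)[OF d] cbx CD by blast
        then have "(d \<ominus>\<^bsub>M\<^esub> c \<odot>\<^bsub>M\<^esub> (b \<odot>\<^bsub>M\<^esub> x)) \<oplus>\<^bsub>M\<^esub> c \<odot>\<^bsub>M\<^esub> (b \<odot>\<^bsub>M\<^esub> x) \<in> C"
          using eq cbx CC(3) by blast
        then show "d \<in> C" using add_back[OF dc] cbx CC(1) by (metis subsetD)
      qed
      then show False using CD by blast
    qed
    then have "\<not> D \<subseteq> W" using eq CD by blast
    then show ?thesis using \<open>C \<subseteq> W\<close> eq by simp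
  qed
  moreover have "?h C \<le> card (insert v S)" if "C \<in> submodules_between A M L W'" for C
    using h(1)[OF Int[OF that]] insert.hyps by simp
  ultimately show ?case unfolding W'_def[symmetric] by (intro exI[of _ ?h]) blast
qed

lemma residue_length_finite:
  assumes "noetherian_ring A" "fin_gen_module A M" "maximalideal \<nn> A" "submodule L A M"
  shows "interval_length A M L (module_colon M L \<nn>) \<noteq> \<infinity>"
proof -
  let ?U = "module_colon M L \<nn>"
  obtain G where M: "module A M" and G: "finite G" "G \<subseteq> carrier M" "mod_span A M G = carrier M"
    using assms(2) unfolding fin_gen_module_def by blast
  interpret n: maximalideal \<nn> A by fact
  have U: "submodule ?U A M" by (rule submodule_module_colon[OF M assms(4)]) (rule n.a_subset)
  note UD = submoduleD[OF M U]
  obtain S where S: "finite S" "S \<subseteq> carrier M" "?U = mod_span A M S"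
    using noetherian_submodule_fin_gen[OF M assms(1) G(1,2) U] UD(1) G(3) by auto
  have sub: "submodules_between A M L ?U \<subseteq> submodules_between A M L (mod_span A M (L \<union> S))"
    using mod_span_mono[of S "L \<union> S" A M] S(3) unfolding submodules_between_def by auto
  have kills: "\<forall>a\<in>\<nn>. \<forall>s\<in>S. a \<odot>\<^bsub>M\<^esub> s \<in> L"
    using submodule_mod_span(2)[OF M S(2)] S(3) unfolding module_colon_def by blast
  obtain h :: "_ set \<Rightarrow> nat" where
    "\<forall>C \<in> submodules_between A M L (mod_span A M (L \<union> S)). h C \<le> card S"
    "\<forall>C \<in> submodules_between A M L (mod_span A M (L \<union> S)).
      \<forall>D \<in> submodules_between A M L (mod_span A M (L \<union> S)). C \<subset> D \<longrightarrow> h C < h D"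
    using residue_rank_function[OF M assms(3,4) S(1,2) kills] by (elim exE conjE) (rule that)
  note h = this[rule_format]
  have "interval_length A M L ?U \<le> enat (card S)"
  proof (rule chain_length_le_rank[of _ h])
    show "h C \<le> card S" if "C \<in> submodules_between A M L ?U" for C
      using that sub by (intro h(1)) blast
    show "h C < h D" if "C \<in> submodules_between A M L ?U" "D \<in> submodules_between A M L ?U" "C \<subset> D" for C D
      using that sub by (intro h(2)[OF _ _ that(3)]) blast+
  qed
  then show ?thesis by (simp only: not_infinity_eq) (rule enat_ile)
qed


section \<open>Dimension one\<close>

lemma (in noetherian_ring) maximal_in_ideal_family:
  assumes "J\<^sub>0 \<in> \<F>" "\<And>J. J \<in> \<F> \<Longrightarrow> ideal J R"
  obtains P where "P \<in> \<F>" "\<And>J. J \<in> \<F> \<Longrightarrow> P \<subseteq> J \<Longrightarrow> J = P"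
proof -
  have "\<exists>P\<in>\<F>. \<forall>J\<in>\<F>. P \<subseteq> J \<longrightarrow> J = P"
  proof (rule subset_Zorn_nonempty)
    show "\<F> \<noteq> {}" using assms(1) by auto
    fix C assume C: "C \<noteq> {}" "subset.chain \<F> C"
    then have sub: "C \<subseteq> \<F>" and chain: "subset.chain {J. ideal J R} C"
      using assms(2) unfolding subset_chain_def by auto
    show "\<Union>C \<in> \<F>" by (rule subsetD[OF sub ideal_chain_is_trivial[OF C(1) chain]])
  qed
  then obtain P where P: "P \<in> \<F>" "\<forall>J\<in>\<F>. P \<subseteq> J \<longrightarrow> J = P" by (rule bexE)
  show thesis by (rule that[OF P(1)]) (use P(2) in auto)
qed

text \<open>An ideal maximal among those disjoint from the multiplicative set \<open>T = {g\<^sup>n s | s \<notin> P}\<close> is prime. It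
  lies in \<open>P\<close> because \<open>T\<close> contains the complement of \<open>P\<close>, and strictly so because \<open>g \<in> T\<close>. Such an ideal
  exists because \<open>0 \<notin> T\<close>, which is where \<open>g\<close> being a nonzerodivisor enters.\<close>

lemma prime_below:
  assumes A: "cring A" "noetherian_ring A" and P: "primeideal P A"
    and g: "g \<in> P" "g \<in> nonzerodivisors A"
  shows "\<exists>P'. primeideal P' A \<and> P' \<subset> P"
proof -
  interpret noetherian_ring A by fact
  interpret cring A by fact
  interpret P: primeideal P A by fact
  have gc: "g \<in> carrier A" using P.a_Hcarr g(1) .
  define T where "T = {g [^]\<^bsub>A\<^esub> n \<otimes>\<^bsub>A\<^esub> s | (n::nat) s. s \<in> carrier A - P}"
  have T_I: "g [^]\<^bsub>A\<^esub> n \<otimes>\<^bsub>A\<^esub> s \<in> T" if "s \<in> carrier A - P" for n :: nat and s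
    using that unfolding T_def by blast
  have T_mult: "x \<otimes>\<^bsub>A\<^esub> y \<in> T" if "x \<in> T" "y \<in> T" for x y
  proof -
    from that(1) obtain n s where x: "x = g [^]\<^bsub>A\<^esub> (n::nat) \<otimes>\<^bsub>A\<^esub> s" "s \<in> carrier A - P"
      unfolding T_def by blast
    from that(2) obtain n' s' where y: "y = g [^]\<^bsub>A\<^esub> (n'::nat) \<otimes>\<^bsub>A\<^esub> s'" "s' \<in> carrier A - P"
      unfolding T_def by blast
    have "x \<otimes>\<^bsub>A\<^esub> y = g [^]\<^bsub>A\<^esub> (n + n') \<otimes>\<^bsub>A\<^esub> (s \<otimes>\<^bsub>A\<^esub> s')"
      using x y gc by (simp add: nat_pow_mult[symmetric] m_ac)
    moreover have "s \<otimes>\<^bsub>A\<^esub> s' \<in> carrier A - P" using x y P.I_prime by blast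
    ultimately show ?thesis using T_I by simp
  qed
  have one: "\<one>\<^bsub>A\<^esub> \<in> carrier A - P" using P.one_imp_carrier P.I_notcarr by auto
  have T_compl: "s \<in> T" if "s \<in> carrier A - P" for s
    using T_I[OF that, of 0] that by simp
  have gT: "g \<in> T" using T_I[OF one, of 1] gc by simp
  have cancel: "s = \<zero>\<^bsub>A\<^esub>" if "s \<in> carrier A" "g [^]\<^bsub>A\<^esub> n \<otimes>\<^bsub>A\<^esub> s = \<zero>\<^bsub>A\<^esub>" for n :: nat and s
    using that
  proof (induction n arbitrary: s)
    case (Suc n)
    have "g [^]\<^bsub>A\<^esub> n \<otimes>\<^bsub>A\<^esub> (g \<otimes>\<^bsub>A\<^esub> s) = \<zero>\<^bsub>A\<^esub>" using gc Suc.prems by (simp add: m_assoc)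
    then have "g \<otimes>\<^bsub>A\<^esub> s = \<zero>\<^bsub>A\<^esub>" by (rule Suc.IH[OF m_closed[OF gc Suc.prems(1)]])
    then show ?case using g(2) Suc.prems(1) unfolding nonzerodivisors_def by blast
  qed simp
  let ?F = "{J. ideal J A \<and> J \<inter> T = {}}"
  have "\<zero>\<^bsub>A\<^esub> \<notin> T"
  proof
    assume "\<zero>\<^bsub>A\<^esub> \<in> T"
    then obtain n s where s: "s \<in> carrier A - P" "\<zero>\<^bsub>A\<^esub> = g [^]\<^bsub>A\<^esub> (n::nat) \<otimes>\<^bsub>A\<^esub> s"
      unfolding T_def by blast
    have "s = \<zero>\<^bsub>A\<^esub>" using s(1) by (intro cancel[OF _ s(2)[symmetric]]) blast
    then show False using s(1) P.zero_closed by blast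
  qed
  then have "{\<zero>\<^bsub>A\<^esub>} \<in> ?F" using zeroideal by simp
  then obtain P' where P': "P' \<in> ?F" and max: "\<And>J. J \<in> ?F \<Longrightarrow> P' \<subseteq> J \<Longrightarrow> J = P'"
    using maximal_in_ideal_family[of "{\<zero>\<^bsub>A\<^esub>}" ?F] by blast
  then interpret P': ideal P' A by simp
  have meets: "\<exists>j\<in>P'. \<exists>r\<in>carrier A. j \<oplus>\<^bsub>A\<^esub> r \<otimes>\<^bsub>A\<^esub> a \<in> T" if a: "a \<in> carrier A" "a \<notin> P'" for a
  proof -
    obtain E where E: "ideal E A" "P' \<subseteq> E" "a \<in> E"
      "\<And>x. x \<in> E \<Longrightarrow> \<exists>j\<in>P'. \<exists>r\<in>carrier A. x = j \<oplus>\<^bsub>A\<^esub> r \<otimes>\<^bsub>A\<^esub> a"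
      using adjoin_to_ideal[OF P'.ideal_axioms a(1)] by metis
    then have "E \<inter> T \<noteq> {}" using max[of E] a(2) by blast
    then show ?thesis using E(4) by blast
  qed
  have sub: "P' \<subseteq> P" using P' T_compl P'.a_subset by blast
  have "primeideal P' A"
  proof (rule primeidealI[OF P'.ideal_axioms A(1)])
    show "carrier A \<noteq> P'" using sub P.I_notcarr P.a_subset by blast
    fix a b assume a: "a \<in> carrier A" and b: "b \<in> carrier A" and ab: "a \<otimes>\<^bsub>A\<^esub> b \<in> P'"
    show "a \<in> P' \<or> b \<in> P'"
    proof (rule ccontr)
      assume "\<not> (a \<in> P' \<or> b \<in> P')"
      then obtain i r j s where i: "i \<in> P'" "r \<in> carrier A" "i \<oplus>\<^bsub>A\<^esub> r \<otimes>\<^bsub>A\<^esub> a \<in> T"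
        and j: "j \<in> P'" "s \<in> carrier A" "j \<oplus>\<^bsub>A\<^esub> s \<otimes>\<^bsub>A\<^esub> b \<in> T"
        using meets a b by metis
      have c: "i \<in> carrier A" "j \<in> carrier A" using i j P'.a_Hcarr by auto
      have "(i \<oplus>\<^bsub>A\<^esub> r \<otimes>\<^bsub>A\<^esub> a) \<otimes>\<^bsub>A\<^esub> (j \<oplus>\<^bsub>A\<^esub> s \<otimes>\<^bsub>A\<^esub> b)
        = (j \<oplus>\<^bsub>A\<^esub> s \<otimes>\<^bsub>A\<^esub> b) \<otimes>\<^bsub>A\<^esub> i \<oplus>\<^bsub>A\<^esub> ((r \<otimes>\<^bsub>A\<^esub> a) \<otimes>\<^bsub>A\<^esub> j \<oplus>\<^bsub>A\<^esub> (r \<otimes>\<^bsub>A\<^esub> s) \<otimes>\<^bsub>A\<^esub> (a \<otimes>\<^bsub>A\<^esub> b))"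
        using a b c i(2) j(2) by (simp add: l_distr r_distr m_ac a_ac)
      also have "\<dots> \<in> P'"
        using a b i(2) j(2) c
        by (intro P'.a_closed P'.I_l_closed[OF i(1)] P'.I_l_closed[OF j(1)] P'.I_l_closed[OF ab]) auto
      finally show False using T_mult[OF i(3) j(3)] P' by blast
    qed
  qed
  moreover have "g \<notin> P'" using gT P' by blast
  ultimately show ?thesis using sub g(1) by blast
qed

lemma local_proper_ideal:
  assumes "noetherian_local_ring A \<mm>" "ideal J A" "J \<noteq> carrier A"
  shows "J \<subseteq> \<mm>"
proof -
  interpret noetherian_ring A using assms(1) unfolding noetherian_local_ring_def by blast
  let ?F = "{I. ideal I A \<and> J \<subseteq> I \<and> I \<noteq> carrier A}"
  obtain P where P: "P \<in> ?F" and max: "\<And>I. I \<in> ?F \<Longrightarrow> P \<subseteq> I \<Longrightarrow> I = P"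
    using maximal_in_ideal_family[of J ?F] assms(2,3) by blast
  have "maximalideal P A"
  proof (rule maximalidealI)
    fix I assume "ideal I A" "P \<subseteq> I" "I \<subseteq> carrier A"
    then show "I = P \<or> I = carrier A" using max[of I] P by blast
  qed (use P in auto)
  then have "P = \<mm>" using assms(1) unfolding noetherian_local_ring_def by blast
  then show ?thesis using P by blast
qed

lemma dim_one_prime_eq_max:
  assumes A: "noetherian_local_ring A \<mm>" "krull_dim A = 1" and P: "primeideal P A"
    and g: "g \<in> P" "g \<in> nonzerodivisors A"
  shows "P = \<mm>"
proof (rule ccontr)
  assume ne: "P \<noteq> \<mm>"
  have cr: "cring A" "noetherian_ring A" and max: "maximalideal \<mm> A"
    using A(1) unfolding noetherian_local_ring_def by auto
  interpret P: primeideal P A by fact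
  have "P \<subset> \<mm>" using local_proper_ideal[OF A(1) P.ideal_axioms] P.I_notcarr ne by blast
  moreover have "primeideal \<mm> A" using cring.maximalideal_prime[OF cr(1) max] .
  moreover obtain P' where P': "primeideal P' A" "P' \<subset> P" using prime_below[OF cr P g] by blast
  ultimately have "enat 2 \<le> krull_dim A"
    unfolding krull_dim_eq_chain_length using P
    by (intro chain_length_ge[where C = "\<lambda>i. if i = 0 then P' else if i = 1 then P else \<mm>"]) auto
  then show False using A(2) by (simp add: one_enat_def)
qed

text \<open>The ideals \<open>N : r t\<close> for multiples \<open>r t\<close> outside \<open>N\<close> have a maximal member, and such a member is prime.
  It contains the nonzerodivisor \<open>g\<close>, so in dimension one it is the maximal ideal.\<close>

lemma torsion_socle_element:
  assumes A: "noetherian_local_ring A \<mm>" "krull_dim A = 1" and M: "module A M" and N: "submodule N A M"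
    and t: "t \<in> carrier M" "t \<notin> N" and g: "g \<in> nonzerodivisors A" "g \<odot>\<^bsub>M\<^esub> t \<in> N"
  shows "\<exists>r\<in>carrier A. r \<odot>\<^bsub>M\<^esub> t \<notin> N \<and> (\<forall>a\<in>\<mm>. a \<odot>\<^bsub>M\<^esub> (r \<odot>\<^bsub>M\<^esub> t) \<in> N)"
proof -
  interpret module A M by fact
  interpret noetherian_ring A using A(1) unfolding noetherian_local_ring_def by blast
  note ND = submoduleD[OF M N]
  have gc: "g \<in> carrier A" using g(1) unfolding nonzerodivisors_def by blast
  let ?ann = "\<lambda>r. {a \<in> carrier A. a \<odot>\<^bsub>M\<^esub> (r \<odot>\<^bsub>M\<^esub> t) \<in> N}"
  have ann: "ideal (?ann r) A" if "r \<in> carrier A" for r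
    unfolding ideal_iff_submodule[OF R.cring_axioms] submodule_iff[OF module_self_module[OF R.cring_axioms]]
    using that t(1) ND by (auto simp: self_module_def smult_l_distr smult_assoc1)
  let ?F = "{?ann r | r. r \<in> carrier A \<and> r \<odot>\<^bsub>M\<^esub> t \<notin> N}"
  have "\<one>\<^bsub>A\<^esub> \<odot>\<^bsub>M\<^esub> t \<notin> N" using t by simp
  then have "?ann \<one>\<^bsub>A\<^esub> \<in> ?F" using R.one_closed by blast
  then obtain P where P: "P \<in> ?F" and max: "\<And>J. J \<in> ?F \<Longrightarrow> P \<subseteq> J \<Longrightarrow> J = P"
    using maximal_in_ideal_family[of "?ann \<one>\<^bsub>A\<^esub>" ?F] ann by blast
  then obtain r where r: "r \<in> carrier A" "r \<odot>\<^bsub>M\<^esub> t \<notin> N" and Pr: "P = ?ann r" by blast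
  have "primeideal P A"
  proof (rule primeidealI[OF _ R.cring_axioms])
    show "ideal P A" using ann r Pr by simp
    have "\<one>\<^bsub>A\<^esub> \<notin> P" using r t by (simp add: Pr)
    then show "carrier A \<noteq> P" using R.one_closed by blast
    fix a b assume a: "a \<in> carrier A" and b: "b \<in> carrier A" and ab: "a \<otimes>\<^bsub>A\<^esub> b \<in> P"
    show "a \<in> P \<or> b \<in> P"
    proof (rule disjCI)
      assume "b \<notin> P"
      then have br: "(b \<otimes>\<^bsub>A\<^esub> r) \<odot>\<^bsub>M\<^esub> t \<notin> N" using b r t by (simp add: Pr smult_assoc1)
      have "P \<subseteq> ?ann (b \<otimes>\<^bsub>A\<^esub> r)"
      proof
        fix c assume "c \<in> P"
        then have c: "c \<in> carrier A" "c \<odot>\<^bsub>M\<^esub> (r \<odot>\<^bsub>M\<^esub> t) \<in> N" by (simp_all add: Pr)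
        have "c \<odot>\<^bsub>M\<^esub> ((b \<otimes>\<^bsub>A\<^esub> r) \<odot>\<^bsub>M\<^esub> t) = b \<odot>\<^bsub>M\<^esub> (c \<odot>\<^bsub>M\<^esub> (r \<odot>\<^bsub>M\<^esub> t))"
          using b c r t smult_commute[OF M c(1) b, of "r \<odot>\<^bsub>M\<^esub> t"] by (simp add: smult_assoc1)
        then show "c \<in> ?ann (b \<otimes>\<^bsub>A\<^esub> r)" using c ND(4)[OF b c(2)] by simp
      qed
      then have eq: "?ann (b \<otimes>\<^bsub>A\<^esub> r) = P" using br b r by (intro max) auto
      have "a \<odot>\<^bsub>M\<^esub> ((b \<otimes>\<^bsub>A\<^esub> r) \<odot>\<^bsub>M\<^esub> t) = (a \<otimes>\<^bsub>A\<^esub> b) \<odot>\<^bsub>M\<^esub> (r \<odot>\<^bsub>M\<^esub> t)"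
        using a b r t by (simp add: smult_assoc1)
      then have "a \<in> ?ann (b \<otimes>\<^bsub>A\<^esub> r)" using a ab by (simp add: Pr)
      then show "a \<in> P" using eq by blast
    qed
  qed
  moreover have "g \<in> P"
  proof -
    have "g \<odot>\<^bsub>M\<^esub> (r \<odot>\<^bsub>M\<^esub> t) = r \<odot>\<^bsub>M\<^esub> (g \<odot>\<^bsub>M\<^esub> t)" by (rule smult_commute[OF M gc r(1) t(1)])
    then show ?thesis using gc ND(4)[OF r(1) g(2)] by (simp add: Pr)
  qed
  ultimately have "P = \<mm>" using dim_one_prime_eq_max[OF A] g(1) by blast
  then show ?thesis using r Pr by auto
qed

section \<open>The idealization\<close>

lemma idealization_simps:
  "carrier (A \<ltimes> M) = carrier A \<times> carrier M"
  "\<one>\<^bsub>A \<ltimes> M\<^esub> = (\<one>\<^bsub>A\<^esub>, \<zero>\<^bsub>M\<^esub>)" "\<zero>\<^bsub>A \<ltimes> M\<^esub> = (\<zero>\<^bsub>A\<^esub>, \<zero>\<^bsub>M\<^esub>)"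
  "(a, x) \<oplus>\<^bsub>A \<ltimes> M\<^esub> (b, y) = (a \<oplus>\<^bsub>A\<^esub> b, x \<oplus>\<^bsub>M\<^esub> y)"
  "(a, x) \<otimes>\<^bsub>A \<ltimes> M\<^esub> (b, y) = (a \<otimes>\<^bsub>A\<^esub> b, a \<odot>\<^bsub>M\<^esub> y \<oplus>\<^bsub>M\<^esub> b \<odot>\<^bsub>M\<^esub> x)"
  by (simp_all add: idealization_def)

lemma cring_idealization:
  assumes "module A M" shows "cring (A \<ltimes> M)"
proof -
  interpret module A M by fact
  show ?thesis
  proof (rule cringI)
    show "abelian_group (A \<ltimes> M)"
    proof (rule abelian_groupI)
      fix p assume "p \<in> carrier (A \<ltimes> M)"
      then obtain a x where p: "p = (a, x)" "a \<in> carrier A" "x \<in> carrier M"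
        by (auto simp: idealization_simps)
      show "\<exists>q\<in>carrier (A \<ltimes> M). q \<oplus>\<^bsub>A \<ltimes> M\<^esub> p = \<zero>\<^bsub>A \<ltimes> M\<^esub>"
        by (rule bexI[of _ "(\<ominus>\<^bsub>A\<^esub> a, \<ominus>\<^bsub>M\<^esub> x)"])
          (use p in \<open>simp_all add: idealization_simps R.l_neg M.l_neg\<close>)
    qed (auto simp: idealization_simps R.a_ac M.a_ac)
    show "Group.comm_monoid (A \<ltimes> M)"
      by (rule comm_monoidI)
        (auto simp: idealization_simps R.m_ac smult_r_distr smult_assoc1[symmetric] M.a_ac)
  qed (auto simp: idealization_simps R.l_distr smult_l_distr smult_r_distr M.a_ac)
qed

lemma idealization_ideal_iff:
  assumes "module A M"
  shows "ideal T (A \<ltimes> M) \<longleftrightarrow> T \<subseteq> carrier A \<times> carrier M \<and> (\<zero>\<^bsub>A\<^esub>, \<zero>\<^bsub>M\<^esub>) \<in> T \<and>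
    (\<forall>a x b y. (a, x) \<in> T \<longrightarrow> (b, y) \<in> T \<longrightarrow> (a \<oplus>\<^bsub>A\<^esub> b, x \<oplus>\<^bsub>M\<^esub> y) \<in> T) \<and>
    (\<forall>c z a x. c \<in> carrier A \<longrightarrow> z \<in> carrier M \<longrightarrow> (a, x) \<in> T \<longrightarrow>
      (c \<otimes>\<^bsub>A\<^esub> a, c \<odot>\<^bsub>M\<^esub> x \<oplus>\<^bsub>M\<^esub> a \<odot>\<^bsub>M\<^esub> z) \<in> T)"
proof -
  have simps: "carrier (self_module (A \<ltimes> M)) = carrier A \<times> carrier M" "zero (self_module (A \<ltimes> M)) = (\<zero>\<^bsub>A\<^esub>, \<zero>\<^bsub>M\<^esub>)"
    "add (self_module (A \<ltimes> M)) = add (A \<ltimes> M)" "smult (self_module (A \<ltimes> M)) = mult (A \<ltimes> M)"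
    by (simp_all add: self_module_def idealization_simps)
  show ?thesis
    unfolding ideal_iff_submodule[OF cring_idealization[OF assms]]
      submodule_iff[OF module_self_module[OF cring_idealization[OF assms]]] simps idealization_simps(1)
      Ball_def split_paired_All mem_Times_iff fst_conv snd_conv idealization_simps(4,5)
    by (intro conj_cong refl) blast+
qed

lemma idealization_idealD:
  assumes "module A M" "ideal T (A \<ltimes> M)"
  shows "T \<subseteq> carrier A \<times> carrier M" "(\<zero>\<^bsub>A\<^esub>, \<zero>\<^bsub>M\<^esub>) \<in> T"
    "\<And>a x b y. (a, x) \<in> T \<Longrightarrow> (b, y) \<in> T \<Longrightarrow> (a \<oplus>\<^bsub>A\<^esub> b, x \<oplus>\<^bsub>M\<^esub> y) \<in> T"
    "\<And>c z a x. c \<in> carrier A \<Longrightarrow> z \<in> carrier M \<Longrightarrow> (a, x) \<in> T \<Longrightarrow>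
      (c \<otimes>\<^bsub>A\<^esub> a, c \<odot>\<^bsub>M\<^esub> x \<oplus>\<^bsub>M\<^esub> a \<odot>\<^bsub>M\<^esub> z) \<in> T"
  using assms(2) unfolding idealization_ideal_iff[OF assms(1)] by blast+

lemma idealization_scalar:
  assumes "module A M" "ideal T (A \<ltimes> M)" "c \<in> carrier A" "(a, x) \<in> T"
  shows "(c \<otimes>\<^bsub>A\<^esub> a, c \<odot>\<^bsub>M\<^esub> x) \<in> T"
proof -
  interpret module A M by fact
  have "a \<in> carrier A" "x \<in> carrier M" using idealization_idealD(1)[OF assms(1,2)] assms(4) by auto
  then show ?thesis
    using idealization_idealD(4)[OF assms(1,2,3) M.zero_closed assms(4)] assms(3) by simp
qed

text \<open>The idealization is a finitely generated \<open>A\<close>-module whose ideals are \<open>A\<close>-submodules. Finitely many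
  generators of an ideal as an \<open>A\<close>-module also generate it as an ideal.\<close>

lemma noetherian_idealization:
  assumes A: "noetherian_ring A" and M: "fin_gen_module A M"
  shows "noetherian_ring (A \<ltimes> M)"
proof -
  obtain S where mod: "module A M" and S: "finite S" "S \<subseteq> carrier M" "mod_span A M S = carrier M"
    using M unfolding fin_gen_module_def by blast
  interpret module A M by fact
  interpret B: cring "A \<ltimes> M" by (rule cring_idealization[OF mod])
  define D :: "('a, 'a \<times> 'c) module" where "D = \<lparr>carrier = carrier A \<times> carrier M, mult = undefined,
    one = undefined, zero = (\<zero>\<^bsub>A\<^esub>, \<zero>\<^bsub>M\<^esub>), add = add (A \<ltimes> M), smult = (\<lambda>c (a, x). (c \<otimes>\<^bsub>A\<^esub> a, c \<odot>\<^bsub>M\<^esub> x))\<rparr>"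
  have D_simps: "carrier D = carrier A \<times> carrier M" "\<zero>\<^bsub>D\<^esub> = (\<zero>\<^bsub>A\<^esub>, \<zero>\<^bsub>M\<^esub>)"
    "\<And>a b x y. (a, x) \<oplus>\<^bsub>D\<^esub> (b, y) = (a \<oplus>\<^bsub>A\<^esub> b, x \<oplus>\<^bsub>M\<^esub> y)"
    "\<And>c a x. c \<odot>\<^bsub>D\<^esub> (a, x) = (c \<otimes>\<^bsub>A\<^esub> a, c \<odot>\<^bsub>M\<^esub> x)"
    by (simp_all add: D_def idealization_simps)
  have "abelian_group D"
  proof (rule abelian_groupI)
    fix p assume "p \<in> carrier D"
    then obtain a x where p: "p = (a, x)" "a \<in> carrier A" "x \<in> carrier M"
      by (auto simp: D_simps)
    show "\<exists>q\<in>carrier D. q \<oplus>\<^bsub>D\<^esub> p = \<zero>\<^bsub>D\<^esub>"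
      by (rule bexI[of _ "(\<ominus>\<^bsub>A\<^esub> a, \<ominus>\<^bsub>M\<^esub> x)"])
        (use p in \<open>simp_all add: D_simps R.l_neg M.l_neg\<close>)
  qed (auto simp: D_simps R.a_ac M.a_ac)
  then have D: "module A D"
    by (intro moduleI R.cring_axioms)
      (auto simp: D_simps R.l_distr R.r_distr R.m_assoc smult_l_distr smult_r_distr smult_assoc1)
  let ?G = "insert (\<one>\<^bsub>A\<^esub>, \<zero>\<^bsub>M\<^esub>) ((\<lambda>s. (\<zero>\<^bsub>A\<^esub>, s)) ` S)"
  have G: "finite ?G" "?G \<subseteq> carrier D" using S by (auto simp: D_simps)
  note GG = submodule_mod_span[OF D G(2)]
  note GD = submoduleD[OF D GG(1)]
  have "submodule {x \<in> carrier M. (\<zero>\<^bsub>A\<^esub>, x) \<in> mod_span A D ?G} A M"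
    unfolding submodule_iff[OF mod]
  proof (intro conjI ballI)
    fix x y assume "x \<in> {x \<in> carrier M. (\<zero>\<^bsub>A\<^esub>, x) \<in> mod_span A D ?G}"
      "y \<in> {x \<in> carrier M. (\<zero>\<^bsub>A\<^esub>, x) \<in> mod_span A D ?G}"
    then show "x \<oplus>\<^bsub>M\<^esub> y \<in> {x \<in> carrier M. (\<zero>\<^bsub>A\<^esub>, x) \<in> mod_span A D ?G}"
      using GD(3)[of "(\<zero>\<^bsub>A\<^esub>, x)" "(\<zero>\<^bsub>A\<^esub>, y)"] by (simp add: D_simps)
  next
    fix c x assume "c \<in> carrier A" "x \<in> {x \<in> carrier M. (\<zero>\<^bsub>A\<^esub>, x) \<in> mod_span A D ?G}"
    then show "c \<odot>\<^bsub>M\<^esub> x \<in> {x \<in> carrier M. (\<zero>\<^bsub>A\<^esub>, x) \<in> mod_span A D ?G}"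
      using GD(4)[of c "(\<zero>\<^bsub>A\<^esub>, x)"] by (simp add: D_simps)
  qed (use GD(2) in \<open>auto simp: D_simps\<close>)
  then have "mod_span A M S \<subseteq> {x \<in> carrier M. (\<zero>\<^bsub>A\<^esub>, x) \<in> mod_span A D ?G}"
    using GG(2) S(2) by (intro mod_span_least) auto
  then have zero_part: "(\<zero>\<^bsub>A\<^esub>, x) \<in> mod_span A D ?G" if "x \<in> carrier M" for x
    using S(3) that by blast
  have span: "p \<in> mod_span A D ?G" if "p \<in> carrier D" for p
  proof -
    from that obtain a x where p: "p = (a, x)" "a \<in> carrier A" "x \<in> carrier M" by (auto simp: D_simps)
    have "(\<one>\<^bsub>A\<^esub>, \<zero>\<^bsub>M\<^esub>) \<in> mod_span A D ?G" using GG(2) by blast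
    then have "a \<odot>\<^bsub>D\<^esub> (\<one>\<^bsub>A\<^esub>, \<zero>\<^bsub>M\<^esub>) \<oplus>\<^bsub>D\<^esub> (\<zero>\<^bsub>A\<^esub>, x) \<in> mod_span A D ?G"
      using GD(3,4) p zero_part by blast
    then show ?thesis using p by (simp add: D_simps)
  qed
  have ideal_submodule: "submodule T A D" if "ideal T (A \<ltimes> M)" for T
    using idealization_idealD[OF mod that] idealization_scalar[OF mod that]
    unfolding submodule_iff[OF D] by (auto simp: D_simps)
  show ?thesis
  proof (rule B.noetherian_ringI)
    fix T assume T: "ideal T (A \<ltimes> M)"
    have "T \<subseteq> mod_span A D ?G" using span submoduleD(1)[OF D ideal_submodule[OF T]] by blast
    then obtain Z where Z: "finite Z" "Z \<subseteq> carrier D" "T = mod_span A D Z"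
      using noetherian_submodule_fin_gen[OF D A G ideal_submodule[OF T]] by auto
    then have Zc: "Z \<subseteq> carrier (A \<ltimes> M)" by (simp add: D_simps idealization_simps)
    have "T = Idl\<^bsub>A \<ltimes> M\<^esub> Z"
    proof
      show "T \<subseteq> Idl\<^bsub>A \<ltimes> M\<^esub> Z"
        unfolding Z(3)
        by (rule mod_span_least[OF ideal_submodule[OF B.genideal_ideal[OF Zc]] B.genideal_self[OF Zc]])
      show "Idl\<^bsub>A \<ltimes> M\<^esub> Z \<subseteq> T"
        using submodule_mod_span(2)[OF D Z(2)] Z(3) by (intro B.genideal_minimal[OF T]) simp
    qed
    then show "\<exists>Z\<subseteq>carrier (A \<ltimes> M). finite Z \<and> T = Idl\<^bsub>A \<ltimes> M\<^esub> Z" using Z(1) Zc by blast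
  qed
qed

lemma idealization_ideal_Times:
  assumes "module A M" "ideal J A"
  shows "ideal (J \<times> carrier M) (A \<ltimes> M)"
proof -
  interpret module A M by fact
  interpret J: ideal J A by fact
  show ?thesis
    unfolding idealization_ideal_iff[OF assms(1)]
    using J.a_subset J.zero_closed J.a_closed J.I_l_closed J.a_Hcarr by auto
qed

lemma idealization_ideal_fst:
  assumes "module A M" "ideal T (A \<ltimes> M)" "\<And>x. x \<in> carrier M \<Longrightarrow> (\<zero>\<^bsub>A\<^esub>, x) \<in> T"
  shows "ideal {a \<in> carrier A. (a, \<zero>\<^bsub>M\<^esub>) \<in> T} A"
    and "T = {a \<in> carrier A. (a, \<zero>\<^bsub>M\<^esub>) \<in> T} \<times> carrier M"
proof -
  interpret module A M by fact
  note T = idealization_idealD[OF assms(1,2)]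
  show "ideal {a \<in> carrier A. (a, \<zero>\<^bsub>M\<^esub>) \<in> T} A"
    unfolding ideal_iff_submodule[OF R.cring_axioms] submodule_iff[OF module_self_module[OF R.cring_axioms]]
    using T(2) T(3)[of _ "\<zero>\<^bsub>M\<^esub>" _ "\<zero>\<^bsub>M\<^esub>"] idealization_scalar[OF assms(1,2), of _ _ "\<zero>\<^bsub>M\<^esub>"]
    by (auto simp: self_module_def)
  show "T = {a \<in> carrier A. (a, \<zero>\<^bsub>M\<^esub>) \<in> T} \<times> carrier M"
  proof (intro subset_antisym subsetI)
    fix p assume p: "p \<in> T"
    then obtain a x where ax: "p = (a, x)" "a \<in> carrier A" "x \<in> carrier M" using T(1) by blast
    then have "(a \<oplus>\<^bsub>A\<^esub> \<zero>\<^bsub>A\<^esub>, x \<oplus>\<^bsub>M\<^esub> \<ominus>\<^bsub>M\<^esub> x) \<in> T"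
      using p assms(3) by (intro T(3)) auto
    then show "p \<in> {a \<in> carrier A. (a, \<zero>\<^bsub>M\<^esub>) \<in> T} \<times> carrier M" using ax by (simp add: M.r_neg)
  next
    fix p assume "p \<in> {a \<in> carrier A. (a, \<zero>\<^bsub>M\<^esub>) \<in> T} \<times> carrier M"
    then obtain a x where ax: "p = (a, x)" "a \<in> carrier A" "x \<in> carrier M" "(a, \<zero>\<^bsub>M\<^esub>) \<in> T" by blast
    then have "(a \<oplus>\<^bsub>A\<^esub> \<zero>\<^bsub>A\<^esub>, \<zero>\<^bsub>M\<^esub> \<oplus>\<^bsub>M\<^esub> x) \<in> T" using assms(3) by (intro T(3)) auto
    then show "p \<in> T" using ax by simp
  qed
qed

text \<open>The ideal \<open>0 \<times> M\<close> squares to zero, so it lies in every prime.\<close>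

lemma idealization_prime:
  assumes "module A M" "primeideal T (A \<ltimes> M)"
  shows "primeideal {a \<in> carrier A. (a, \<zero>\<^bsub>M\<^esub>) \<in> T} A" (is "primeideal ?P A")
    and "T = {a \<in> carrier A. (a, \<zero>\<^bsub>M\<^esub>) \<in> T} \<times> carrier M"
proof -
  interpret module A M by fact
  interpret T: primeideal T "A \<ltimes> M" by fact
  have "(\<zero>\<^bsub>A\<^esub>, x) \<in> T" if x: "x \<in> carrier M" for x
  proof -
    have "(\<zero>\<^bsub>A\<^esub>, x) \<otimes>\<^bsub>A \<ltimes> M\<^esub> (\<zero>\<^bsub>A\<^esub>, x) = \<zero>\<^bsub>A \<ltimes> M\<^esub>" using x by (simp add: idealization_simps)
    then have "(\<zero>\<^bsub>A\<^esub>, x) \<otimes>\<^bsub>A \<ltimes> M\<^esub> (\<zero>\<^bsub>A\<^esub>, x) \<in> T"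
      using additive_subgroup.zero_closed[OF T.additive_subgroup_axioms] by (simp only:)
    moreover have "(\<zero>\<^bsub>A\<^esub>, x) \<in> carrier (A \<ltimes> M)" using x by (simp add: idealization_simps)
    ultimately show ?thesis using T.I_prime by blast
  qed
  note fst = idealization_ideal_fst[OF assms(1) T.ideal_axioms this]
  show "T = ?P \<times> carrier M" by (rule fst(2))
  show "primeideal ?P A"
  proof (rule primeidealI[OF fst(1) R.cring_axioms])
    have "\<one>\<^bsub>A \<ltimes> M\<^esub> \<notin> T" using T.one_imp_carrier T.I_notcarr by auto
    then have "\<one>\<^bsub>A\<^esub> \<notin> ?P" by (simp add: idealization_simps)
    then show "carrier A \<noteq> ?P" using R.one_closed by blast
    fix a b assume "a \<in> carrier A" "b \<in> carrier A" "a \<otimes>\<^bsub>A\<^esub> b \<in> ?P"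
    then show "a \<in> ?P \<or> b \<in> ?P"
      using T.I_prime[of "(a, \<zero>\<^bsub>M\<^esub>)" "(b, \<zero>\<^bsub>M\<^esub>)"] by (simp add: idealization_simps)
  qed
qed

lemma idealization_prime_Times:
  assumes "module A M" "primeideal P A"
  shows "primeideal (P \<times> carrier M) (A \<ltimes> M)"
proof -
  interpret module A M by fact
  interpret P: primeideal P A by fact
  show ?thesis
  proof (rule primeidealI[OF idealization_ideal_Times[OF assms(1) P.ideal_axioms] cring_idealization[OF assms(1)]])
    show "carrier (A \<ltimes> M) \<noteq> P \<times> carrier M"
      using P.I_notcarr M.zero_closed by (auto simp: idealization_simps times_eq_iff)
    fix p q assume "p \<in> carrier (A \<ltimes> M)" "q \<in> carrier (A \<ltimes> M)" "p \<otimes>\<^bsub>A \<ltimes> M\<^esub> q \<in> P \<times> carrier M"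
    then show "p \<in> P \<times> carrier M \<or> q \<in> P \<times> carrier M"
      using P.I_prime by (cases p; cases q) (auto simp: idealization_simps)
  qed
qed

lemma krull_dim_idealization:
  assumes "module A M" shows "krull_dim (A \<ltimes> M) = krull_dim A"
  unfolding krull_dim_eq_chain_length
proof (rule antisym)
  interpret module A M by fact
  let ?fst = "\<lambda>T. {a \<in> carrier A. (a, \<zero>\<^bsub>M\<^esub>) \<in> T}"
  show "chain_length {P. primeideal P (A \<ltimes> M)} \<le> chain_length {P. primeideal P A}"
  proof (rule chain_length_mono[where F = ?fst])
    fix T T' assume *: "T \<in> {P. primeideal P (A \<ltimes> M)}" "T' \<in> {P. primeideal P (A \<ltimes> M)}" "T \<subset> T'"
    then have T: "primeideal T (A \<ltimes> M)" "primeideal T' (A \<ltimes> M)" by auto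
    have "?fst T \<noteq> ?fst T'"
      using *(3) idealization_prime(2)[OF assms T(1)] idealization_prime(2)[OF assms T(2)]
      by (metis (no_types, lifting) psubset_eq)
    then show "?fst T \<subset> ?fst T'" using *(3) by blast
  qed (use idealization_prime(1)[OF assms] in blast)
  show "chain_length {P. primeideal P A} \<le> chain_length {P. primeideal P (A \<ltimes> M)}"
  proof (rule chain_length_mono[where F = "\<lambda>P. P \<times> carrier M"])
    fix P P' assume "P \<subset> P'"
    then show "P \<times> carrier M \<subset> P' \<times> carrier M" using M.zero_closed by blast
  qed (use idealization_prime_Times[OF assms] in blast)
qed

lemma local_idealization:
  assumes A: "noetherian_local_ring A \<mm>" and M: "fin_gen_module A M"
  shows "noetherian_local_ring (A \<ltimes> M) (\<mm> \<times> carrier M)"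
proof -
  have cr: "cring A" "noetherian_ring A" and max: "{J. maximalideal J A} = {\<mm>}"
    using A unfolding noetherian_local_ring_def by auto
  have mod: "module A M" using M unfolding fin_gen_module_def by blast
  interpret module A M by fact
  interpret B: cring "A \<ltimes> M" by (rule cring_idealization[OF mod])
  interpret m: maximalideal \<mm> A using max by blast
  have "maximalideal (\<mm> \<times> carrier M) (A \<ltimes> M)"
  proof (rule maximalidealI[OF idealization_ideal_Times[OF mod m.ideal_axioms]])
    show "carrier (A \<ltimes> M) \<noteq> \<mm> \<times> carrier M"
      using m.I_notcarr M.zero_closed by (auto simp: idealization_simps times_eq_iff)
    fix T assume T: "ideal T (A \<ltimes> M)" "\<mm> \<times> carrier M \<subseteq> T"
    then have "(\<zero>\<^bsub>A\<^esub>, x) \<in> T" if "x \<in> carrier M" for x using that m.zero_closed by blast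
    note fst = idealization_ideal_fst[OF mod T(1) this]
    have "\<mm> \<subseteq> {a \<in> carrier A. (a, \<zero>\<^bsub>M\<^esub>) \<in> T}" using T(2) m.a_subset M.zero_closed by blast
    then obtain P where P: "T = P \<times> carrier M" "P = \<mm> \<or> P = carrier A"
      using m.I_maximal[OF fst(1)] fst(2) by (metis (no_types, lifting) mem_Collect_eq subsetI)
    then show "T = \<mm> \<times> carrier M \<or> T = carrier (A \<ltimes> M)"
      unfolding idealization_simps(1) by blast
  qed
  moreover have "T = \<mm> \<times> carrier M" if "maximalideal T (A \<ltimes> M)" for T
  proof -
    interpret T: maximalideal T "A \<ltimes> M" by fact
    obtain P where P: "primeideal P A" and T: "T = P \<times> carrier M"
      by (rule that[OF idealization_prime[OF mod B.maximalideal_prime[OF \<open>maximalideal T (A \<ltimes> M)\<close>]]])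
    have "P \<subseteq> \<mm>"
      using primeideal.I_notcarr[OF P] primeideal.axioms(1)[OF P] by (intro local_proper_ideal[OF A]) auto
    then have "T \<subseteq> \<mm> \<times> carrier M" using T by blast
    moreover have "\<mm> \<times> carrier M \<noteq> carrier (A \<ltimes> M)"
      using m.I_notcarr M.zero_closed by (auto simp: idealization_simps times_eq_iff)
    ultimately show ?thesis
      using T.I_maximal[OF idealization_ideal_Times[OF mod m.ideal_axioms]] m.a_subset
      by (auto simp: idealization_simps)
  qed
  ultimately show ?thesis
    unfolding noetherian_local_ring_def using B.cring_axioms noetherian_idealization[OF cr(2) M] by blast
qed


section \<open>The Cohen-Macaulay type\<close>

lemma max_ideal_eq: "noetherian_local_ring A \<mm> \<Longrightarrow> max_ideal A = \<mm>"
  unfolding noetherian_local_ring_def max_ideal_def by (rule the_equality) auto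

lemma cm_type_eq_interval_length:
  assumes A: "noetherian_local_ring A \<mm>" "krull_dim A = 1" and M: "module A M"
    and f: "f \<in> \<mm>" "\<And>y. y \<in> carrier M \<Longrightarrow> f \<odot>\<^bsub>M\<^esub> y = \<zero>\<^bsub>M\<^esub> \<Longrightarrow> y = \<zero>\<^bsub>M\<^esub>"
  shows "cm_type A M = interval_length A M (multiples M f) (module_colon M (multiples M f) \<mm>)"
proof -
  have cr: "cring A" "noetherian_ring A" and max: "maximalideal \<mm> A"
    using A(1) unfolding noetherian_local_ring_def by auto
  have "the_enat (krull_dim A) = 1" using A(2) by (simp add: one_enat_def)
  then show ?thesis
    unfolding cm_type_def max_ideal_eq[OF A(1)]
    by (simp only: Ext_cyclic_length[OF cr M maximalideal.axioms(1)[OF max] f])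
qed

text \<open>By the formula for the type, the left-hand type is the length of the interval from \<open>fA \<times> fM\<close> to
  \<open>E \<times> (fM : \<mm>)\<close>, where \<open>E\<close> consists of the \<open>a\<close> that satisfy both premises on the right. The map \<open>N \<mapsto> fA \<times> N\<close> embeds
  the interval from \<open>fM\<close> to \<open>fM : \<mm>\<close>, whose length is \<open>r\<^sub>A(M)\<close>. If \<open>E = fA\<close>, every submodule in the larger
  interval has this form. Otherwise its top lies strictly above the image, and the lengths differ
  because \<open>r\<^sub>A(M)\<close> is finite.\<close>

lemma type_idealization_iff:
  assumes A: "noetherian_local_ring A \<mm>" "krull_dim A = 1" and M: "fin_gen_module A M"
    and f: "f \<in> \<mm>" "f \<in> nonzerodivisors A" and reg: "\<And>y. y \<in> carrier M \<Longrightarrow> f \<odot>\<^bsub>M\<^esub> y = \<zero>\<^bsub>M\<^esub> \<Longrightarrow> y = \<zero>\<^bsub>M\<^esub>"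
  shows "ring_type (A \<ltimes> M) = cm_type A M \<longleftrightarrow>
    (\<forall>a \<in> carrier A. (\<forall>b\<in>\<mm>. \<exists>c\<in>carrier A. b \<otimes>\<^bsub>A\<^esub> a = f \<otimes>\<^bsub>A\<^esub> c) \<longrightarrow>
      (\<forall>y\<in>carrier M. a \<odot>\<^bsub>M\<^esub> y \<in> multiples M f) \<longrightarrow> (\<exists>c\<in>carrier A. a = f \<otimes>\<^bsub>A\<^esub> c))"
proof -
  have cr: "noetherian_ring A" and max: "maximalideal \<mm> A"
    using A(1) unfolding noetherian_local_ring_def by auto
  have mod: "module A M" using M unfolding fin_gen_module_def by blast
  interpret module A M by fact
  interpret m: maximalideal \<mm> A by fact
  have fc: "f \<in> carrier A" using f(1) m.a_Hcarr by blast
  let ?B = "A \<ltimes> M"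
  let ?S = "self_module ?B"
  have B: "noetherian_local_ring ?B (\<mm> \<times> carrier M)" "krull_dim ?B = 1"
    using local_idealization[OF A(1) M] krull_dim_idealization[OF mod] A(2) by simp_all
  interpret B: cring ?B by (rule cring_idealization[OF mod])
  have S: "module ?B ?S" by (rule module_self_module[OF B.cring_axioms])
  have S_simps: "carrier ?S = carrier ?B" "\<zero>\<^bsub>?S\<^esub> = \<zero>\<^bsub>?B\<^esub>" "\<And>p q. p \<odot>\<^bsub>?S\<^esub> q = p \<otimes>\<^bsub>?B\<^esub> q"
    by (simp_all add: self_module_def)
  let ?F = "(f, \<zero>\<^bsub>M\<^esub>)"
  let ?fM = "multiples M f" and ?U = "module_colon M (multiples M f) \<mm>"
  let ?fA = "(\<lambda>c. f \<otimes>\<^bsub>A\<^esub> c) ` carrier A"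
  note fM = submodule_multiples[OF mod fc]
  note fMD = submoduleD[OF mod fM]
  have fA: "ideal ?fA A"
  proof -
    have "multiples (self_module A) f = ?fA" unfolding multiples_def by (auto simp: self_module_def)
    then show ?thesis
      using submodule_multiples[OF module_self_module[OF R.cring_axioms] fc] ideal_iff_submodule[OF R.cring_axioms] by simp
  qed
  interpret fA: ideal ?fA A by fact
  have fA_M: "c \<odot>\<^bsub>M\<^esub> y \<in> ?fM" if "c \<in> ?fA" "y \<in> carrier M" for c y
    using that fc unfolding multiples_def by (auto simp: smult_assoc1)
  have FB: "multiples ?S ?F = ?fA \<times> ?fM"
  proof -
    have eq: "?F \<otimes>\<^bsub>?B\<^esub> (c, y) = (f \<otimes>\<^bsub>A\<^esub> c, f \<odot>\<^bsub>M\<^esub> y)" if "c \<in> carrier A" "y \<in> carrier M" for c y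
      using that fc by (simp add: idealization_simps)
    show ?thesis
    proof (intro subset_antisym subsetI)
      fix p assume "p \<in> multiples ?S ?F"
      then obtain c y where "c \<in> carrier A" "y \<in> carrier M" "p = ?F \<otimes>\<^bsub>?B\<^esub> (c, y)"
        unfolding multiples_def S_simps idealization_simps(1) by blast
      then show "p \<in> ?fA \<times> ?fM" unfolding multiples_def using eq by auto
    next
      fix p assume "p \<in> ?fA \<times> ?fM"
      then obtain c y where "c \<in> carrier A" "y \<in> carrier M" "p = (f \<otimes>\<^bsub>A\<^esub> c, f \<odot>\<^bsub>M\<^esub> y)"
        unfolding multiples_def by blast
      then have "p = ?F \<otimes>\<^bsub>?B\<^esub> (c, y)" "(c, y) \<in> carrier A \<times> carrier M" using eq by auto
      then show "p \<in> multiples ?S ?F" unfolding multiples_def S_simps idealization_simps(1) by blast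
    qed
  qed
  define E where "E = {a \<in> carrier A. (\<forall>b\<in>\<mm>. b \<otimes>\<^bsub>A\<^esub> a \<in> ?fA) \<and> (\<forall>y\<in>carrier M. a \<odot>\<^bsub>M\<^esub> y \<in> ?fM)}"
  have fA_E: "?fA \<subseteq> E"
  proof
    fix c assume c: "c \<in> ?fA"
    show "c \<in> E"
      unfolding E_def using fA.a_Hcarr[OF c] fA.I_l_closed[OF c m.a_Hcarr] fA_M[OF c] by auto
  qed
  have UB: "module_colon ?S (multiples ?S ?F) (\<mm> \<times> carrier M) = E \<times> ?U"
  proof (intro subset_antisym subsetI)
    fix p assume p_colon: "p \<in> module_colon ?S (multiples ?S ?F) (\<mm> \<times> carrier M)"
    then have "p \<in> carrier A \<times> carrier M" unfolding module_colon_def S_simps idealization_simps(1) by (simp only: mem_Collect_eq)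
    then obtain a x where p: "p = (a, x)" and a: "a \<in> carrier A" and x: "x \<in> carrier M" by (rule SigmaE)
    have colon: "(b \<otimes>\<^bsub>A\<^esub> a, b \<odot>\<^bsub>M\<^esub> x \<oplus>\<^bsub>M\<^esub> a \<odot>\<^bsub>M\<^esub> y) \<in> ?fA \<times> ?fM" if "b \<in> \<mm>" "y \<in> carrier M" for b y
    proof -
      have "(b, y) \<otimes>\<^bsub>?B\<^esub> p \<in> ?fA \<times> ?fM"
        using p_colon SigmaI[OF that] unfolding module_colon_def FB S_simps by (auto simp only: mem_Collect_eq)
      then show ?thesis unfolding p idealization_simps .
    qed
    have "b \<otimes>\<^bsub>A\<^esub> a \<in> ?fA" "b \<odot>\<^bsub>M\<^esub> x \<in> ?fM" if "b \<in> \<mm>" for b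
      using colon[OF that M.zero_closed] a x that m.a_Hcarr by auto
    moreover have "a \<odot>\<^bsub>M\<^esub> y \<in> ?fM" if "y \<in> carrier M" for y
      using colon[OF m.zero_closed that] a x that by simp
    ultimately show "p \<in> E \<times> ?U" using p a x unfolding E_def module_colon_def by simp
  next
    fix p assume "p \<in> E \<times> ?U"
    then obtain a x where p: "p = (a, x)" and a: "a \<in> E" and x: "x \<in> ?U" by (rule SigmaE)
    have "q \<otimes>\<^bsub>?B\<^esub> p \<in> ?fA \<times> ?fM" if "q \<in> \<mm> \<times> carrier M" for q
    proof -
      from that obtain b y where q: "q = (b, y)" "b \<in> \<mm>" "y \<in> carrier M" by (rule SigmaE)
      then have "b \<otimes>\<^bsub>A\<^esub> a \<in> ?fA" "a \<odot>\<^bsub>M\<^esub> y \<in> ?fM" "b \<odot>\<^bsub>M\<^esub> x \<in> ?fM"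
        using a x unfolding E_def module_colon_def by blast+
      then show ?thesis unfolding p q(1) idealization_simps using fMD(3) by blast
    qed
    moreover have "p \<in> carrier ?B"
      using a x unfolding p E_def module_colon_def idealization_simps(1) by blast
    ultimately show "p \<in> module_colon ?S (multiples ?S ?F) (\<mm> \<times> carrier M)"
      unfolding module_colon_def FB S_simps by blast
  qed
  have reg_B: "\<And>p. p \<in> carrier ?S \<Longrightarrow> ?F \<odot>\<^bsub>?S\<^esub> p = \<zero>\<^bsub>?S\<^esub> \<Longrightarrow> p = \<zero>\<^bsub>?S\<^esub>"
    using fc f(2) reg unfolding S_simps nonzerodivisors_def by (auto simp: idealization_simps)
  have type_B: "ring_type ?B = interval_length ?B ?S (?fA \<times> ?fM) (E \<times> ?U)"
  proof -
    have "cm_type ?B ?S = interval_length ?B ?S (multiples ?S ?F) (module_colon ?S (multiples ?S ?F) (\<mm> \<times> carrier M))"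
      by (rule cm_type_eq_interval_length[OF B S SigmaI[OF f(1) M.zero_closed]]) (rule reg_B)
    then show ?thesis unfolding ring_type_def UB unfolding FB .
  qed
  have type_A: "cm_type A M = interval_length A M ?fM ?U"
    by (rule cm_type_eq_interval_length[OF A mod f(1) reg])
  let ?\<S> = "submodules_between A M ?fM ?U" and ?\<T> = "submodules_between ?B ?S (?fA \<times> ?fM) (E \<times> ?U)"
  have F_in: "?fA \<times> N \<in> ?\<T>" if "N \<in> ?\<S>" for N
  proof -
    have N: "submodule N A M" "?fM \<subseteq> N" "N \<subseteq> ?U" using that unfolding submodules_between_def by auto
    note ND = submoduleD[OF mod N(1)]
    have "ideal (?fA \<times> N) ?B"
      unfolding idealization_ideal_iff[OF mod]
    proof (intro conjI allI impI)
      show "?fA \<times> N \<subseteq> carrier A \<times> carrier M" by (rule Sigma_mono[OF fA.a_subset ND(1)])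
      show "(\<zero>\<^bsub>A\<^esub>, \<zero>\<^bsub>M\<^esub>) \<in> ?fA \<times> N" by (rule SigmaI[OF fA.zero_closed ND(2)])
    next
      fix a x b y assume "(a, x) \<in> ?fA \<times> N" "(b, y) \<in> ?fA \<times> N"
      then show "(a \<oplus>\<^bsub>A\<^esub> b, x \<oplus>\<^bsub>M\<^esub> y) \<in> ?fA \<times> N"
        unfolding mem_Times_iff fst_conv snd_conv using fA.a_closed[of a b] ND(3)[of x y] by simp
    next
      fix c z a x assume c: "c \<in> carrier A" "z \<in> carrier M" and ax: "(a, x) \<in> ?fA \<times> N"
      then have a: "a \<in> ?fA" and x: "x \<in> N" unfolding mem_Times_iff by simp_all
      show "(c \<otimes>\<^bsub>A\<^esub> a, c \<odot>\<^bsub>M\<^esub> x \<oplus>\<^bsub>M\<^esub> a \<odot>\<^bsub>M\<^esub> z) \<in> ?fA \<times> N"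
        by (rule SigmaI[OF fA.I_l_closed[OF a c(1)] ND(3)[OF ND(4)[OF c(1) x] subsetD[OF N(2) fA_M[OF a c(2)]]]])
    qed
    then show ?thesis
      using Sigma_mono[OF subset_refl N(2)] Sigma_mono[OF fA_E N(3)]
      unfolding submodules_between_def ideal_iff_submodule[OF B.cring_axioms] by simp
  qed
  have F_mono: "?fA \<times> N \<subset> ?fA \<times> N'" if "N \<subset> N'" for N N' :: "'c set"
    using that fA.zero_closed by blast
  have U: "submodule ?U A M" by (rule submodule_module_colon[OF mod fM m.a_subset])
  show ?thesis
  proof (cases "E \<subseteq> ?fA")
    case True
    then have EU: "E = ?fA" using fA_E by blast
    have "chain_length ?\<T> \<le> chain_length ?\<S>"
    proof (rule chain_length_mono[where F = "\<lambda>T. {x \<in> carrier M. (\<zero>\<^bsub>A\<^esub>, x) \<in> T}"])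
      fix T assume "T \<in> ?\<T>"
      then have T: "ideal T ?B" "?fA \<times> ?fM \<subseteq> T" "T \<subseteq> ?fA \<times> ?U"
        unfolding submodules_between_def EU ideal_iff_submodule[OF B.cring_axioms] by simp_all
      note TD = idealization_idealD[OF mod T(1)]
      show "{x \<in> carrier M. (\<zero>\<^bsub>A\<^esub>, x) \<in> T} \<in> ?\<S>"
      proof -
        have "submodule {x \<in> carrier M. (\<zero>\<^bsub>A\<^esub>, x) \<in> T} A M"
          unfolding submodule_iff[OF mod]
        proof (intro conjI ballI)
          fix x y assume "x \<in> {x \<in> carrier M. (\<zero>\<^bsub>A\<^esub>, x) \<in> T}" "y \<in> {x \<in> carrier M. (\<zero>\<^bsub>A\<^esub>, x) \<in> T}"
          then show "x \<oplus>\<^bsub>M\<^esub> y \<in> {x \<in> carrier M. (\<zero>\<^bsub>A\<^esub>, x) \<in> T}"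
            using TD(3)[of "\<zero>\<^bsub>A\<^esub>" x "\<zero>\<^bsub>A\<^esub>" y] by simp
        next
          fix c x assume "c \<in> carrier A" "x \<in> {x \<in> carrier M. (\<zero>\<^bsub>A\<^esub>, x) \<in> T}"
          then show "c \<odot>\<^bsub>M\<^esub> x \<in> {x \<in> carrier M. (\<zero>\<^bsub>A\<^esub>, x) \<in> T}"
            using idealization_scalar[OF mod T(1), of c "\<zero>\<^bsub>A\<^esub>" x] by simp
        qed (use TD(2) in simp_all)
        moreover have "?fM \<subseteq> {x \<in> carrier M. (\<zero>\<^bsub>A\<^esub>, x) \<in> T}"
          using subsetD[OF T(2) SigmaI[OF fA.zero_closed]] fMD(1) by blast
        moreover have "{x \<in> carrier M. (\<zero>\<^bsub>A\<^esub>, x) \<in> T} \<subseteq> ?U" using T(3) by blast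
        ultimately show ?thesis unfolding submodules_between_def by simp
      qed
    next
      fix T T' assume TT: "T \<in> ?\<T>" "T' \<in> ?\<T>" "T \<subset> T'"
      then have T: "ideal T ?B" "?fA \<times> ?fM \<subseteq> T" and T': "ideal T' ?B" "?fA \<times> ?fM \<subseteq> T'" "T' \<subseteq> ?fA \<times> ?U"
        unfolding submodules_between_def EU ideal_iff_submodule[OF B.cring_axioms] by simp_all
      obtain a x where ax: "(a, x) \<in> T'" "(a, x) \<notin> T" using psubset_imp_ex_mem[OF TT(3)] by auto
      have a: "a \<in> ?fA" and c: "a \<in> carrier A" "x \<in> carrier M"
        using subsetD[OF T'(3) ax(1)] subsetD[OF idealization_idealD(1)[OF mod T'(1)] ax(1)] unfolding mem_Times_iff by simp_all
      have "(\<ominus>\<^bsub>A\<^esub> a, \<zero>\<^bsub>M\<^esub>) \<in> T'" "(a, \<zero>\<^bsub>M\<^esub>) \<in> T"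
        using subsetD[OF T(2) SigmaI[OF a fMD(2)]] subsetD[OF T'(2) SigmaI[OF fA.a_inv_closed[OF a] fMD(2)]] by simp_all
      then have "(a \<oplus>\<^bsub>A\<^esub> \<ominus>\<^bsub>A\<^esub> a, x \<oplus>\<^bsub>M\<^esub> \<zero>\<^bsub>M\<^esub>) \<in> T'" and "(\<zero>\<^bsub>A\<^esub>, x) \<in> T \<Longrightarrow> (a \<oplus>\<^bsub>A\<^esub> \<zero>\<^bsub>A\<^esub>, \<zero>\<^bsub>M\<^esub> \<oplus>\<^bsub>M\<^esub> x) \<in> T"
        using idealization_idealD(3)[OF mod T'(1) ax(1)] idealization_idealD(3)[OF mod T(1)] by simp_all
      then have "(\<zero>\<^bsub>A\<^esub>, x) \<in> T'" "(\<zero>\<^bsub>A\<^esub>, x) \<notin> T" using ax c by (auto simp: R.r_neg)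
      then show "{x \<in> carrier M. (\<zero>\<^bsub>A\<^esub>, x) \<in> T} \<subset> {x \<in> carrier M. (\<zero>\<^bsub>A\<^esub>, x) \<in> T'}"
        using TT(3) c by blast
    qed
    moreover have "chain_length ?\<S> \<le> chain_length ?\<T>"
      by (rule chain_length_mono[of _ "\<lambda>N. ?fA \<times> N", OF F_in F_mono])
    ultimately have "ring_type ?B = cm_type A M" using type_A type_B by simp
    then show ?thesis using True unfolding E_def by blast
  next
    case False
    have "chain_length ?\<S> < chain_length ?\<T>"
    proof (rule chain_length_less[where F = "\<lambda>N. ?fA \<times> N" and T = "E \<times> ?U", OF F_in F_mono])
      have "submodule (E \<times> ?U) ?B ?S"
        using submodule_module_colon[OF S submodule_multiples[OF S]] fc m.a_subset unfolding UB[symmetric]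
        by (simp add: idealization_simps subset_iff)
      then show "E \<times> ?U \<in> ?\<T>"
        using fA_E multiples_subset_module_colon[OF mod fc m.a_subset] unfolding submodules_between_def by blast
      show "?fA \<times> N \<subset> E \<times> ?U" if "N \<in> ?\<S>" for N
        using that False fA_E submoduleD(2)[OF mod U] unfolding submodules_between_def by blast
      show "chain_length ?\<S> \<noteq> \<infinity>" by (rule residue_length_finite[OF cr M max fM])
      have "?fM \<in> ?\<S>"
        using fM multiples_subset_module_colon[OF mod fc m.a_subset] unfolding submodules_between_def by blast
      then show "?\<S> \<noteq> {}" by blast
    qed
    then have "ring_type ?B \<noteq> cm_type A M" using type_A type_B by simp
    then show ?thesis using False unfolding E_def by blast
  qed
qed

lemma maximalideal_quotient:
  assumes A: "noetherian_local_ring A \<mm>" and I: "ideal I A" "I \<noteq> carrier A"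
  shows "{J. maximalideal J (A Quot I)} = {(+>\<^bsub>A\<^esub>) I ` \<mm>}"
proof -
  have "cring A" and max: "maximalideal \<mm> A" using A unfolding noetherian_local_ring_def by auto
  interpret cring A by fact
  interpret I: ideal I A by fact
  interpret m: maximalideal \<mm> A by fact
  interpret h: ring_hom_ring A "A Quot I" "(+>\<^bsub>A\<^esub>) I" by (rule I.rcos_ring_hom_ring)
  have Im: "I \<subseteq> \<mm>" by (rule local_proper_ideal[OF A I])
  have carr: "carrier (A Quot I) = (+>\<^bsub>A\<^esub>) I ` carrier A"
    unfolding FactRing_def A_RCOSETS_def' by auto
  have mem: "I +>\<^bsub>A\<^esub> x \<in> (+>\<^bsub>A\<^esub>) I ` \<mm> \<Longrightarrow> x \<in> \<mm>" if x: "x \<in> carrier A" for x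
  proof -
    assume "I +>\<^bsub>A\<^esub> x \<in> (+>\<^bsub>A\<^esub>) I ` \<mm>"
    then obtain y where y: "y \<in> \<mm>" "I +>\<^bsub>A\<^esub> x = I +>\<^bsub>A\<^esub> y" by blast
    then have "x \<in> I +>\<^bsub>A\<^esub> y" using I.a_rcos_self[OF x] by simp
    then obtain i where "i \<in> I" "x = i \<oplus>\<^bsub>A\<^esub> y" unfolding a_r_coset_def' by blast
    then show "x \<in> \<mm>" using y(1) Im m.a_closed by blast
  qed
  have ne: "(+>\<^bsub>A\<^esub>) I ` \<mm> \<noteq> carrier (A Quot I)"
    using mem m.one_imp_carrier m.I_notcarr unfolding carr by (metis imageI one_closed)
  let ?pre = "\<lambda>J. {r \<in> carrier A. I +>\<^bsub>A\<^esub> r \<in> J}"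
  have pre: "ideal (?pre J) A" and image_pre: "J = (+>\<^bsub>A\<^esub>) I ` ?pre J" if J: "ideal J (A Quot I)" for J
  proof -
    show "ideal (?pre J) A" by (rule h.ideal_vimage[OF J])
    have "J \<subseteq> carrier (A Quot I)" by (rule additive_subgroup.a_subset[OF ideal.axioms(1)[OF J]])
    then show "J = (+>\<^bsub>A\<^esub>) I ` ?pre J" unfolding carr by blast
  qed
  note image = ring_ideal_imp_quot_ideal[OF I(1) m.ideal_axioms]
  have proper: "J \<subseteq> (+>\<^bsub>A\<^esub>) I ` \<mm>" if J: "ideal J (A Quot I)" "J \<noteq> carrier (A Quot I)" for J
  proof -
    have "?pre J \<noteq> carrier A"
    proof
      assume "?pre J = carrier A"
      then have "J = carrier (A Quot I)" using image_pre[OF J(1)] unfolding carr by simp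
      then show False using J(2) by simp
    qed
    then have "?pre J \<subseteq> \<mm>" by (rule local_proper_ideal[OF A pre[OF J(1)]])
    then have "(+>\<^bsub>A\<^esub>) I ` ?pre J \<subseteq> (+>\<^bsub>A\<^esub>) I ` \<mm>" by (rule image_mono)
    then show ?thesis using image_pre[OF J(1)] by simp
  qed
  have "maximalideal ((+>\<^bsub>A\<^esub>) I ` \<mm>) (A Quot I)"
  proof (rule maximalidealI[OF image])
    show "carrier (A Quot I) \<noteq> (+>\<^bsub>A\<^esub>) I ` \<mm>" using ne by simp
    fix J assume "ideal J (A Quot I)" "(+>\<^bsub>A\<^esub>) I ` \<mm> \<subseteq> J"
    then show "J = (+>\<^bsub>A\<^esub>) I ` \<mm> \<or> J = carrier (A Quot I)" using proper by blast
  qed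
  moreover have "J = (+>\<^bsub>A\<^esub>) I ` \<mm>" if "maximalideal J (A Quot I)" for J
  proof -
    interpret J: maximalideal J "A Quot I" by fact
    have "J \<subseteq> (+>\<^bsub>A\<^esub>) I ` \<mm>" using proper[OF J.ideal_axioms] J.I_notcarr by simp
    moreover have "(+>\<^bsub>A\<^esub>) I ` \<mm> \<subseteq> carrier (A Quot I)"
      by (rule additive_subgroup.a_subset[OF ideal.axioms(1)[OF image]])
    ultimately show ?thesis using J.I_maximal[OF image] ne by simp
  qed
  ultimately show ?thesis by blast
qed

text \<open>The coset map sends \<open>I : \<mm>\<close> onto the socle of \<open>A/I\<close>, with kernel \<open>I\<close>.\<close>

lemma artinian_type_quotient:
  assumes A: "noetherian_local_ring A \<mm>" and I: "ideal I A" "I \<noteq> carrier A"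
  shows "artinian_type (A Quot I)
    = interval_length A (self_module A) I (module_colon (self_module A) I \<mm>)"
proof -
  have "cring A" and max: "maximalideal \<mm> A" using A unfolding noetherian_local_ring_def by auto
  have zeroB: "\<zero>\<^bsub>A Quot I\<^esub> = I" by (simp add: FactRing_def)
  interpret cring A by fact
  interpret I: ideal I A by fact
  interpret m: maximalideal \<mm> A by fact
  interpret B: cring "A Quot I" by (rule I.quotient_is_cring[OF \<open>cring A\<close>])
  interpret h: ring_hom_ring A "A Quot I" "(+>\<^bsub>A\<^esub>) I" by (rule I.rcos_ring_hom_ring)
  have carr: "carrier (A Quot I) = (+>\<^bsub>A\<^esub>) I ` carrier A"
    unfolding FactRing_def A_RCOSETS_def' by auto
  let ?S = "self_module A" and ?T = "self_module (A Quot I)"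
  let ?W = "module_colon ?S I \<mm>"
  note S = module_self_module[OF \<open>cring A\<close>] and T = module_self_module[OF B.cring_axioms]
  have S_simps: "carrier ?S = carrier A" "add ?S = add A" "smult ?S = mult A"
    and T_simps: "carrier ?T = carrier (A Quot I)" "add ?T = add (A Quot I)" "smult ?T = mult (A Quot I)" "\<zero>\<^bsub>?T\<^esub> = I"
    by (simp_all add: self_module_def zeroB)
  have IS: "submodule I A ?S" using I(1) ideal_iff_submodule[OF \<open>cring A\<close>] by blast
  have W: "submodule ?W A ?S" by (rule submodule_module_colon[OF S IS m.a_subset])
  have IW: "I \<subseteq> ?W"
    unfolding module_colon_def S_simps using I.a_Hcarr I.I_l_closed m.a_Hcarr by auto
  have zero_iff: "I +>\<^bsub>A\<^esub> x = I \<longleftrightarrow> x \<in> I" if "x \<in> carrier A" for x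
    using that I.a_rcos_self[OF that] I.a_rcos_const by blast
  have soc: "socle (A Quot I) = (+>\<^bsub>A\<^esub>) I ` ?W"
  proof -
    have "max_ideal (A Quot I) = (+>\<^bsub>A\<^esub>) I ` \<mm>"
      unfolding max_ideal_def by (rule the_equality) (use maximalideal_quotient[OF A I] in auto)
    moreover have mult_iff: "(I +>\<^bsub>A\<^esub> b) \<otimes>\<^bsub>A Quot I\<^esub> (I +>\<^bsub>A\<^esub> x) = I \<longleftrightarrow> b \<otimes>\<^bsub>A\<^esub> x \<in> I"
      if "b \<in> \<mm>" "x \<in> carrier A" for b x
      using that m.a_Hcarr zero_iff[of "b \<otimes>\<^bsub>A\<^esub> x"] h.hom_mult[of b x] by simp
    ultimately have "I +>\<^bsub>A\<^esub> x \<in> socle (A Quot I) \<longleftrightarrow> x \<in> ?W" if "x \<in> carrier A" for x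
      using that unfolding socle_def module_colon_def zeroB S_simps carr
      by (simp only: mem_Collect_eq ball_simps(9) mult_iff imageI simp_thms cong: ball_cong)
    moreover have "socle (A Quot I) \<subseteq> (+>\<^bsub>A\<^esub>) I ` carrier A" "?W \<subseteq> carrier A"
      unfolding socle_def carr module_colon_def S_simps by auto
    ultimately show ?thesis by blast
  qed
  have socle_eq: "socle (A Quot I) = module_colon ?T {I} (max_ideal (A Quot I))"
    unfolding socle_def module_colon_def T_simps zeroB by simp
  have "max_ideal (A Quot I) \<subseteq> carrier (A Quot I)"
    unfolding max_ideal_def
    using maximalideal_quotient[OF A I] carr m.a_subset by (subst the_equality[of _ "(+>\<^bsub>A\<^esub>) I ` \<mm>"]) auto
  then have soc_sub: "submodule (socle (A Quot I)) (A Quot I) ?T"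
    unfolding socle_eq using submodule_zero[OF T] T_simps by (intro submodule_module_colon[OF T]) simp_all
  let ?V = "?S\<lparr>carrier := ?W\<rparr>" and ?M = "?T\<lparr>carrier := socle (A Quot I)\<rparr>"
  have V: "module A ?V" by (rule submodule.submodule_is_module[OF W S])
  have M: "module (A Quot I) ?M" by (rule submodule.submodule_is_module[OF soc_sub T])
  interpret M: module "A Quot I" ?M by fact
  have W_carr: "x \<in> carrier A" if "x \<in> ?W" for x using that submoduleD(1)[OF S W] S_simps by auto
  have zeroM: "\<zero>\<^bsub>?M\<^esub> = I" using T_simps by simp
  have "interval_length A ?V I (carrier ?V) = interval_length (A Quot I) ?M {\<zero>\<^bsub>?M\<^esub>} (carrier ?M)"
  proof (rule interval_length_transfer[OF V M, where \<rho> = "(+>\<^bsub>A\<^esub>) I" and \<Phi> = "(+>\<^bsub>A\<^esub>) I"])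
    show "submodule {\<zero>\<^bsub>?M\<^esub>} (A Quot I) ?M" by (rule submodule_zero[OF M])
    show "submodule (carrier ?M) (A Quot I) ?M" by (rule M.carrier_is_submodule)
    show "\<exists>x\<in>carrier ?V. u \<ominus>\<^bsub>?M\<^esub> (I +>\<^bsub>A\<^esub> x) \<in> {\<zero>\<^bsub>?M\<^esub>}" if u: "u \<in> carrier ?M" for u
    proof -
      obtain x where x: "x \<in> ?W" "u = I +>\<^bsub>A\<^esub> x" using u soc by auto
      have "u \<ominus>\<^bsub>?M\<^esub> u = \<zero>\<^bsub>?M\<^esub>" unfolding M.M.minus_eq by (rule M.M.r_neg[OF u])
      then show ?thesis using x by auto
    qed
    show "I = {x \<in> carrier ?V. I +>\<^bsub>A\<^esub> x \<in> {\<zero>\<^bsub>?M\<^esub>}}"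
      unfolding zeroM using zero_iff W_carr IW by auto
  qed (use carr soc M.M.zero_closed W_carr h.hom_add h.hom_mult in \<open>auto simp: S_simps T_simps\<close>)
  then show ?thesis
    unfolding artinian_type_def mod_length_eq_interval_length[OF M]
    using submodules_between_restrict[OF S W subset_refl, of I] by simp
qed

lemma depth_ge_one_nonzerodivisor:
  assumes A: "noetherian_local_ring A \<mm>" and d: "depth A (self_module A) = 1"
  shows "\<exists>f\<in>\<mm>. f \<in> nonzerodivisors A"
proof -
  have "cring A" using A unfolding noetherian_local_ring_def by auto
  interpret cring A by fact
  have "\<exists>xs. set xs \<subseteq> \<mm> \<and> regular_sequence A (self_module A) xs \<and> xs \<noteq> []"
  proof (rule ccontr)
    assume "\<not> ?thesis"
    then have "depth A (self_module A) \<le> 0"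
      unfolding depth_def max_ideal_eq[OF A] by (intro Sup_least) (auto simp: zero_enat_def)
    then show False using d by simp
  qed
  then obtain xs where xs: "set xs \<subseteq> \<mm>" "regular_sequence A (self_module A) xs" "xs \<noteq> []" by blast
  have "list_times_module A (self_module A) [] = {\<zero>\<^bsub>A\<^esub>}"
    using mod_span_empty[OF module_self_module[OF \<open>cring A\<close>]]
    unfolding list_times_module_def by (simp add: self_module_def)
  then have "\<forall>y\<in>carrier A. xs ! 0 \<otimes>\<^bsub>A\<^esub> y = \<zero>\<^bsub>A\<^esub> \<longrightarrow> y = \<zero>\<^bsub>A\<^esub>"
    using xs(2,3) unfolding regular_sequence_def by (auto simp: self_module_def dest: spec[of _ 0])
  moreover have "xs ! 0 \<in> \<mm>" "xs ! 0 \<in> carrier A"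
    using xs(1,2) nth_mem[of 0 xs] xs(3) unfolding regular_sequence_def by (simp_all add: subset_iff)
  ultimately show ?thesis unfolding nonzerodivisors_def by blast
qed

section \<open>Closed fractional ideals\<close>

theorem corollary6p10:
  fixes Q :: "('a, 'q) ring_scheme" and R \<mm> I :: "'a set"
  assumes "total_ring_of_fractions Q R"
    and "cohen_macaulay_local_ring (ring_on Q R) \<mm>"
    and "krull_dim (ring_on Q R) = 1"
    and "\<exists>K. fractional_canonical_ideal Q R K"
    and "fractional_ideal Q R I"
  shows "(ring_type (ring_on Q R \<ltimes> module_on Q I) = cm_type (ring_on Q R) (module_on Q I)
            \<longleftrightarrow> closed_ideal Q R I) \<and>
         (closed_ideal Q R I \<longrightarrow> I \<subset> R \<longrightarrow>
            ring_type (ring_on Q R \<ltimes> module_on Q I) = artinian_type (ring_on Q R Quot I))"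
proof -
  let ?A = "ring_on Q R" and ?M = "module_on Q I" and ?S = "self_module Q"
  have Q: "cring Q" "subcring R Q" and units: "nonzerodivisors ?A \<subseteq> Units Q"
    and frac: "carrier Q = {a \<otimes>\<^bsub>Q\<^esub> inv\<^bsub>Q\<^esub> s | a s. a \<in> R \<and> s \<in> nonzerodivisors ?A}"
    using assms(1) unfolding total_ring_of_fractions_def by auto
  interpret Q: cring Q by fact
  interpret R: subcring R Q by fact
  have RQ: "R \<subseteq> carrier Q" by (rule R.subset)
  have A: "noetherian_local_ring ?A \<mm>" and depth: "depth ?A (self_module ?A) = 1"
    using assms(2,3) unfolding cohen_macaulay_local_ring_def by auto
  have crA: "cring ?A" and max: "maximalideal \<mm> ?A" using A unfolding noetherian_local_ring_def by auto
  interpret A: cring ?A by fact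
  interpret m: maximalideal \<mm> ?A by fact
  have IS: "submodule I ?A ?S" and M_fg: "fin_gen_module ?A ?M"
    using assms(5) unfolding fractional_ideal_def by auto
  have M: "module ?A ?M" using M_fg unfolding fin_gen_module_def by blast
  interpret M: module ?A ?M by fact
  have S_simps: "carrier ?S = carrier Q" "add ?S = add Q" "smult ?S = mult Q" "\<zero>\<^bsub>?S\<^esub> = \<zero>\<^bsub>Q\<^esub>"
    by (simp_all add: self_module_def)
  have S: "module ?A ?S"
  proof (rule moduleI[OF crA])
    show "abelian_group ?S"
      using module_self_module[OF Q(1)] unfolding module_def by blast
  qed (use RQ in \<open>auto simp: S_simps Q.l_distr Q.r_distr Q.m_assoc subset_iff self_module_def\<close>)
  have IQ: "I \<subseteq> carrier Q" using submoduleD(1)[OF S IS] S_simps by simp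
  have I_smult: "r \<otimes>\<^bsub>Q\<^esub> y \<in> I" if "r \<in> R" "y \<in> I" for r y
    using submoduleD(4)[OF S IS, of r y] that S_simps by simp

  obtain f where f: "f \<in> \<mm>" "f \<in> nonzerodivisors ?A"
    using depth_ge_one_nonzerodivisor[OF A depth] by blast
  have mR: "b \<in> R" if "b \<in> \<mm>" for b using m.a_Hcarr[OF that] by simp
  have fR: "f \<in> R" and fU: "f \<in> Units Q" using mR f units by auto
  have fQ: "f \<in> carrier Q" and finv: "inv\<^bsub>Q\<^esub> f \<in> carrier Q" using fU by auto
  have cancel: "x = y" if "x \<in> carrier Q" "y \<in> carrier Q" "f \<otimes>\<^bsub>Q\<^esub> x = f \<otimes>\<^bsub>Q\<^esub> y" for x y
    using Q.Units_l_cancel[OF fU that(1,2)] that(3) by simp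
  have div: "f \<otimes>\<^bsub>Q\<^esub> (inv\<^bsub>Q\<^esub> f \<otimes>\<^bsub>Q\<^esub> a) = a" if "a \<in> carrier Q" for a
    using that fU fQ finv by (simp add: Q.m_assoc[symmetric])
  have reg: "y = \<zero>\<^bsub>?M\<^esub>" if "y \<in> carrier ?M" "f \<odot>\<^bsub>?M\<^esub> y = \<zero>\<^bsub>?M\<^esub>" for y
    using cancel[of y "\<zero>\<^bsub>Q\<^esub>"] that IQ fQ by (auto simp: self_module_def)
  have multiples: "multiples ?M f = {f \<otimes>\<^bsub>Q\<^esub> y | y. y \<in> I}"
    unfolding multiples_def by (simp add: self_module_def)
  have R_colon: "R \<subseteq> colon Q I I" using I_smult RQ unfolding colon_def by blast
  have closed: "closed_ideal Q R I \<longleftrightarrow> colon Q I I \<subseteq> R"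
    using R_colon assms(5) unfolding closed_ideal_def by blast

  have type_iff: "ring_type (?A \<ltimes> ?M) = cm_type ?A ?M \<longleftrightarrow>
    (\<forall>a \<in> R. (\<forall>b\<in>\<mm>. \<exists>c\<in>R. b \<otimes>\<^bsub>Q\<^esub> a = f \<otimes>\<^bsub>Q\<^esub> c) \<longrightarrow>
      (\<forall>y\<in>I. \<exists>z\<in>I. a \<otimes>\<^bsub>Q\<^esub> y = f \<otimes>\<^bsub>Q\<^esub> z) \<longrightarrow> (\<exists>c\<in>R. a = f \<otimes>\<^bsub>Q\<^esub> c))" (is "_ \<longleftrightarrow> ?E")
    using type_idealization_iff[OF A assms(3) M_fg f reg]
    unfolding multiples by (simp add: self_module_def Bex_def conj_commute)
  have first: "ring_type (?A \<ltimes> ?M) = cm_type ?A ?M \<longleftrightarrow> closed_ideal Q R I"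
    unfolding type_iff closed
  proof
    assume "colon Q I I \<subseteq> R"
    show ?E
    proof (intro ballI impI)
      fix a assume a: "a \<in> R" and aI: "\<forall>y\<in>I. \<exists>z\<in>I. a \<otimes>\<^bsub>Q\<^esub> y = f \<otimes>\<^bsub>Q\<^esub> z"
      let ?t = "inv\<^bsub>Q\<^esub> f \<otimes>\<^bsub>Q\<^esub> a"
      have aQ: "a \<in> carrier Q" using a RQ by blast
      have "?t \<otimes>\<^bsub>Q\<^esub> y \<in> I" if y: "y \<in> I" for y
      proof -
        obtain z where z: "z \<in> I" "a \<otimes>\<^bsub>Q\<^esub> y = f \<otimes>\<^bsub>Q\<^esub> z" using aI y by blast
        have yz: "y \<in> carrier Q" "z \<in> carrier Q" using y z(1) IQ by auto
        have "f \<otimes>\<^bsub>Q\<^esub> (?t \<otimes>\<^bsub>Q\<^esub> y) = f \<otimes>\<^bsub>Q\<^esub> z"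
          using yz aQ finv fQ div[OF aQ] z(2) by (simp add: Q.m_assoc[symmetric])
        then have "?t \<otimes>\<^bsub>Q\<^esub> y = z" by (rule cancel[rotated 2]) (use yz aQ finv in auto)
        then show ?thesis using z(1) by simp
      qed
      then have "?t \<in> colon Q I I" unfolding colon_def using aQ finv by simp
      then show "\<exists>c\<in>R. a = f \<otimes>\<^bsub>Q\<^esub> c" using \<open>colon Q I I \<subseteq> R\<close> div[OF aQ] by (metis subsetD)
    qed
  next
    assume E: ?E
    show "colon Q I I \<subseteq> R"
    proof (rule ccontr)
      assume "\<not> colon Q I I \<subseteq> R"
      then obtain t where t: "t \<in> carrier Q" "t \<notin> R" and tI: "\<And>y. y \<in> I \<Longrightarrow> t \<otimes>\<^bsub>Q\<^esub> y \<in> I"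
        unfolding colon_def by blast
      obtain a s where as: "a \<in> R" "s \<in> nonzerodivisors ?A" "t = a \<otimes>\<^bsub>Q\<^esub> inv\<^bsub>Q\<^esub> s"
        using t(1) unfolding frac by blast
      have sU: "s \<in> Units Q" using as(2) units by blast
      have "s \<otimes>\<^bsub>Q\<^esub> t = a"
        using Q.m_lcomm[of s a "inv\<^bsub>Q\<^esub> s"] subsetD[OF RQ as(1)] sU by (simp add: as(3) Q.Units_closed)
      then have st: "s \<odot>\<^bsub>?S\<^esub> t \<in> R" using as(1) S_simps by simp
      have RS: "submodule R ?A ?S"
        unfolding submodule_iff[OF S] S_simps using RQ A.zero_closed A.a_closed A.m_closed by simp
      \<comment> \<open>A multiple of \<open>t\<close> lies in \<open>R : \<mm>\<close> but not in \<open>R\<close>; times \<open>f\<close> it violates the condition.\<close>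
      obtain r where r: "r \<in> R" "r \<otimes>\<^bsub>Q\<^esub> t \<notin> R" "\<And>b. b \<in> \<mm> \<Longrightarrow> b \<otimes>\<^bsub>Q\<^esub> (r \<otimes>\<^bsub>Q\<^esub> t) \<in> R"
        using torsion_socle_element[OF A assms(3) S RS _ _ as(2) st] t S_simps by auto
      let ?s = "r \<otimes>\<^bsub>Q\<^esub> t"
      have rQ: "r \<in> carrier Q" and sQ: "?s \<in> carrier Q" using r(1) RQ t(1) by auto
      have "f \<otimes>\<^bsub>Q\<^esub> ?s \<in> R" using r(3)[OF f(1)] .
      moreover have "\<forall>b\<in>\<mm>. \<exists>c\<in>R. b \<otimes>\<^bsub>Q\<^esub> (f \<otimes>\<^bsub>Q\<^esub> ?s) = f \<otimes>\<^bsub>Q\<^esub> c"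
      proof
        fix b assume b: "b \<in> \<mm>"
        then have "b \<in> carrier Q" using mR RQ by blast
        then show "\<exists>c\<in>R. b \<otimes>\<^bsub>Q\<^esub> (f \<otimes>\<^bsub>Q\<^esub> ?s) = f \<otimes>\<^bsub>Q\<^esub> c"
          using r(3)[OF b] Q.m_lcomm[OF _ fQ sQ] by blast
      qed
      moreover have "\<forall>y\<in>I. \<exists>z\<in>I. (f \<otimes>\<^bsub>Q\<^esub> ?s) \<otimes>\<^bsub>Q\<^esub> y = f \<otimes>\<^bsub>Q\<^esub> z"
      proof
        fix y assume y: "y \<in> I"
        then have yQ: "y \<in> carrier Q" using IQ by blast
        have "(f \<otimes>\<^bsub>Q\<^esub> ?s) \<otimes>\<^bsub>Q\<^esub> y = f \<otimes>\<^bsub>Q\<^esub> (r \<otimes>\<^bsub>Q\<^esub> (t \<otimes>\<^bsub>Q\<^esub> y))"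
          using yQ fQ rQ t(1) by (simp add: Q.m_assoc)
        then show "\<exists>z\<in>I. (f \<otimes>\<^bsub>Q\<^esub> ?s) \<otimes>\<^bsub>Q\<^esub> y = f \<otimes>\<^bsub>Q\<^esub> z" using I_smult[OF r(1) tI[OF y]] by blast
      qed
      ultimately obtain c where c: "c \<in> R" "f \<otimes>\<^bsub>Q\<^esub> ?s = f \<otimes>\<^bsub>Q\<^esub> c" using E by blast
      have "?s = c" by (rule cancel[OF sQ subsetD[OF RQ c(1)] c(2)])
      then show False using c(1) r(2) by simp
    qed
  qed

  have second: "ring_type (?A \<ltimes> ?M) = artinian_type (?A Quot I)"
    if cl: "closed_ideal Q R I" and IR: "I \<subset> R"
  proof -
    let ?T = "self_module ?A"
    note T = module_self_module[OF crA]
    have T_simps: "carrier ?T = R" "add ?T = add Q" "smult ?T = mult Q" "\<zero>\<^bsub>?T\<^esub> = \<zero>\<^bsub>Q\<^esub>"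
      and M_simps: "carrier ?M = I" "add ?M = add Q" "smult ?M = mult Q" "\<zero>\<^bsub>?M\<^esub> = \<zero>\<^bsub>Q\<^esub>"
      by (simp_all add: self_module_def)
    have IT: "submodule I ?A ?T"
      using submoduleD[OF S IS] IR unfolding submodule_iff[OF T] T_simps S_simps by auto
    have ideal: "ideal I ?A" using IT ideal_iff_submodule[OF crA] by blast
    have Im: "I \<subseteq> \<mm>" using IR by (intro local_proper_ideal[OF A ideal]) auto
    let ?W = "module_colon ?T I \<mm>"
    have W: "submodule ?W ?A ?T" by (rule submodule_module_colon[OF T IT m.a_subset])
    have W_iff: "x \<in> ?W \<longleftrightarrow> x \<in> R \<and> (\<forall>b\<in>\<mm>. b \<otimes>\<^bsub>Q\<^esub> x \<in> I)" for x
      unfolding module_colon_def T_simps by simp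
    let ?V = "?T\<lparr>carrier := ?W\<rparr>"
    have V: "module ?A ?V" by (rule submodule.submodule_is_module[OF W T])
    \<comment> \<open>\<open>I : \<mm> \<subseteq> I : I\<close>, since \<open>I \<subseteq> \<mm>\<close>.\<close>
    have colonR: "x \<in> R" if "x \<in> carrier Q" "\<And>b. b \<in> \<mm> \<Longrightarrow> b \<otimes>\<^bsub>Q\<^esub> x \<in> I" for x
    proof -
      have "x \<in> colon Q I I" unfolding colon_def using that Im IQ by (auto simp: Q.m_comm subset_iff)
      then show ?thesis using cl closed by blast
    qed
    have fM: "submodule (multiples ?M f) ?A ?M" using fR by (intro submodule_multiples[OF M]) simp
    have U: "submodule (module_colon ?M (multiples ?M f) \<mm>) ?A ?M"
      by (rule submodule_module_colon[OF M fM m.a_subset])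
    have WR: "x \<in> carrier Q" if "x \<in> ?W" for x using that W_iff RQ by blast
    have "cm_type ?A ?M = interval_length ?A ?M (multiples ?M f) (module_colon ?M (multiples ?M f) \<mm>)"
      by (rule cm_type_eq_interval_length[OF A assms(3) M f(1)]) (rule reg)
    also have "\<dots> = interval_length ?A ?V I (carrier ?V)"
    proof (rule interval_length_transfer[OF V M, where \<rho> = "\<lambda>a. a" and \<Phi> = "\<lambda>x. f \<otimes>\<^bsub>Q\<^esub> x", symmetric])
      show "(\<lambda>a. a) ` carrier ?A = carrier ?A" by simp
      show "multiples ?M f \<subseteq> module_colon ?M (multiples ?M f) \<mm>"
        using fR by (intro multiples_subset_module_colon[OF M _ m.a_subset]) simp
      show "f \<otimes>\<^bsub>Q\<^esub> (x \<oplus>\<^bsub>?V\<^esub> y) = f \<otimes>\<^bsub>Q\<^esub> x \<oplus>\<^bsub>?M\<^esub> f \<otimes>\<^bsub>Q\<^esub> y" if "x \<in> carrier ?V" "y \<in> carrier ?V" for x y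
        using that WR fQ by (simp add: self_module_def Q.r_distr)
      show "f \<otimes>\<^bsub>Q\<^esub> (a \<odot>\<^bsub>?V\<^esub> x) = a \<odot>\<^bsub>?M\<^esub> (f \<otimes>\<^bsub>Q\<^esub> x)" if "a \<in> carrier ?A" "x \<in> carrier ?V" for a x
        using that WR fQ RQ by (simp add: self_module_def Q.m_lcomm subset_iff)
      show "f \<otimes>\<^bsub>Q\<^esub> x \<in> module_colon ?M (multiples ?M f) \<mm>" if x: "x \<in> carrier ?V" for x
      proof -
        have xW: "x \<in> ?W" using x by simp
        have "b \<otimes>\<^bsub>Q\<^esub> (f \<otimes>\<^bsub>Q\<^esub> x) \<in> multiples ?M f" if b: "b \<in> \<mm>" for b
        proof -
          have "b \<otimes>\<^bsub>Q\<^esub> (f \<otimes>\<^bsub>Q\<^esub> x) = f \<otimes>\<^bsub>Q\<^esub> (b \<otimes>\<^bsub>Q\<^esub> x)"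
            using mR[OF b] RQ fQ WR[OF xW] by (intro Q.m_lcomm) auto
          then show ?thesis unfolding multiples using xW b W_iff by blast
        qed
        then show ?thesis unfolding module_colon_def M_simps using xW f(1) W_iff by blast
      qed
      show "\<exists>x\<in>carrier ?V. u \<ominus>\<^bsub>?M\<^esub> (f \<otimes>\<^bsub>Q\<^esub> x) \<in> multiples ?M f"
        if u: "u \<in> module_colon ?M (multiples ?M f) \<mm>" for u
      proof -
        let ?x = "inv\<^bsub>Q\<^esub> f \<otimes>\<^bsub>Q\<^esub> u"
        have uI: "u \<in> I" and colon: "\<And>b. b \<in> \<mm> \<Longrightarrow> b \<otimes>\<^bsub>Q\<^esub> u \<in> multiples ?M f"
          using u unfolding module_colon_def M_simps by auto
        have uQ: "u \<in> carrier Q" using uI IQ by blast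
        have xI: "b \<otimes>\<^bsub>Q\<^esub> ?x \<in> I" if b: "b \<in> \<mm>" for b
        proof -
          obtain z where z: "z \<in> I" "b \<otimes>\<^bsub>Q\<^esub> u = f \<otimes>\<^bsub>Q\<^esub> z" using colon[OF b] unfolding multiples by blast
          have bz: "b \<in> carrier Q" "z \<in> carrier Q" using mR[OF b] RQ z(1) IQ by auto
          have "f \<otimes>\<^bsub>Q\<^esub> (b \<otimes>\<^bsub>Q\<^esub> ?x) = b \<otimes>\<^bsub>Q\<^esub> (f \<otimes>\<^bsub>Q\<^esub> ?x)"
            using bz fQ finv uQ by (intro Q.m_lcomm) auto
          also have "\<dots> = f \<otimes>\<^bsub>Q\<^esub> z" using div[OF uQ] z(2) by simp
          finally have "b \<otimes>\<^bsub>Q\<^esub> ?x = z" by (rule cancel[rotated 2]) (use bz finv uQ in auto)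
          then show ?thesis using z(1) by simp
        qed
        have "?x \<in> R" using finv uQ xI by (intro colonR) auto
        then have "?x \<in> carrier ?V" using xI W_iff by simp
        moreover have "u \<ominus>\<^bsub>?M\<^esub> (f \<otimes>\<^bsub>Q\<^esub> ?x) = \<zero>\<^bsub>?M\<^esub>"
          using uI M.M.r_neg[of u] M_simps(1) div[OF uQ] by (simp add: M.M.minus_eq)
        ultimately show ?thesis using submoduleD(2)[OF M fM] by (metis (no_types, lifting))
      qed
      show "I = {x \<in> carrier ?V. f \<otimes>\<^bsub>Q\<^esub> x \<in> multiples ?M f}"
      proof (intro subset_antisym subsetI)
        fix x assume x: "x \<in> I"
        then have "x \<in> ?W" unfolding W_iff using IR I_smult mR by auto
        moreover have "f \<otimes>\<^bsub>Q\<^esub> x \<in> multiples ?M f" unfolding multiples using x by blast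
        ultimately show "x \<in> {x \<in> carrier ?V. f \<otimes>\<^bsub>Q\<^esub> x \<in> multiples ?M f}" by simp
      next
        fix x assume "x \<in> {x \<in> carrier ?V. f \<otimes>\<^bsub>Q\<^esub> x \<in> multiples ?M f}"
        then have "x \<in> ?W" "f \<otimes>\<^bsub>Q\<^esub> x \<in> multiples ?M f" by simp_all
        then obtain y where y: "x \<in> ?W" "y \<in> I" "f \<otimes>\<^bsub>Q\<^esub> x = f \<otimes>\<^bsub>Q\<^esub> y" unfolding multiples by blast
        have "x = y" by (rule cancel[OF WR[OF y(1)] subsetD[OF IQ y(2)] y(3)])
        then show "x \<in> I" using y(2) by simp
      qed
    qed (rule fM U)+
    also have "\<dots> = interval_length ?A ?T I ?W"
      using submodules_between_restrict[OF T W subset_refl, of I] by simp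
    also have "\<dots> = artinian_type (?A Quot I)"
      using IR by (intro artinian_type_quotient[OF A ideal, symmetric]) auto
    finally show ?thesis using first cl by simp
  qed
  show ?thesis using first second by blast
qed

end
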